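(* Let $(\mathcal S,\mathcal D,E,B)$ satisfy assumptions (i)–(iv) of the context, let $\Lambda=E(\mathcal S)$, and let $\mathrm W_\Lambda$ be the geodesic restriction of $\mathrm W$ to $\Lambda$. There is a constant $C\in(0,\infty)$ such that $$0\le \frac{\mathrm W_\Lambda(\lambda_0,\lambda_1)-\mathrm W(\lambda_0,\lambda_1)}{\mathrm W(\lambda_0,\lambda_1)^2}\le C$$ for all $\lambda_0,\lambda_1\in\Lambda$ with $\lambda_0\ne\lambda_1$.
   Context: $\Omega\subset\mathbb R^d$ is compact and convex, $\mathcal P(\Omega)$ is the set of probability measures on $\Omega$, $\mathrm W$ is the Wasserstein-2 distance, $\mathrm W(\mu,\nu)^2=\inf_{\pi}\int|x-y|^2\,d\pi$ over couplings $\pi$ of $\mu,\nu$. $L^2(\mu)$ means $L^2(\mu;\mathbb R^d)$. $\|\cdot\|_{C^1(\mathbb R^d)}$ is the supremum norm of the function and its first derivatives. $\#$ denotes push-forward. Assumptions. (i) $\mathcal S$ is a compact, connected, finite-dimensional smooth Riemannian manifold with tangent norms $\|\eta\|_\theta$ ($\eta\in T_\theta\mathcal S$) and induced distance $d_{\mathcal S}$. $\mathcal D\subset T\mathcal S$ is a subset on which the Riemannian exponential map is well defined, such that $(\theta,\eta)\in\mathcal D$ implies $(\theta,t\eta)\in\mathcal D$ for $t\in[0,1]$; for every $(\theta,\eta)\in\mathcal D$ the curve $\gamma(t)=\exp_\theta(t\eta)$, $t\in[0,1]$, is a constant speed geodesic from $\theta$ to $\exp_\theta(\eta)$ with $\|\dot\gamma(t)\|_{\gamma(t)}=\|\eta\|_\theta=d_{\mathcal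 S}(\theta,\exp_\theta(\eta))$ for $t\in[0,1]$; and, with $\mathcal D_\theta=\{\eta:(\theta,\eta)\in\mathcal D\}$, for any $\theta_0,\theta_1\in\mathcal S$ there is $\eta\in\mathcal D_{\theta_0}$ with $\theta_1=\exp_{\theta_0}(\eta)$. ($\mathcal S$ may have a boundary as long as it is a geodesically convex subset of a larger, not necessarily compact, such manifold and the construction of geodesics via $\mathcal D$ remains valid.) (ii) $E:\mathcal S\to\mathcal P(\Omega)$ is a bi-Lipschitz bijection from $(\mathcal S,d_{\mathcal S})$ onto $\Lambda:=E(\mathcal S)$ with metric $\mathrm W$; write $\lambda_\theta=E(\theta)$. All $\lambda\in\Lambda$ are absolutely continuous with respect to Lebesgue measure. (iii) For each $\theta\in\mathcal S$, $B_\theta:T_\theta\mathcal S\to C^1(\mathbb R^d;\mathbb R^d)$ is linear with values in gradient vector fields, and there is $C_0\in(0,\infty)$ such that for all $(\theta,\eta)\in\mathcal D$, $x\in\mathbb R^d$, $t\in[0,1]$, with $\gamma(t)=\exp_\theta(t\eta)$: $C_0^{-1}\|\eta\|_\theta\le\|B_\theta\eta\|_{L^2(\lambda_\theta)}\le C_0\|\eta\|_\theta$; $\|B_\theta\eta\|_{C^1(\mathbb R^d)}\le C_0\|\eta\|_\theta$; $|\partial_t[B_{\gamma(t)}\dot\gamma(t)](x)|\le C_0\|\eta\|_\theta^2$. (iv) For every Lipschitz curve $\gamma:[0,1]\to\mathcal S$, let $v(t,\cdot)=B_{\gamma(t)}\dot\gamma(t)$ (defined for a.e. $t$) and let $\varphi:[0,1]\times\Omega\to\mathbb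 R^d$ be the solution of $\varphi(0,\cdot)=\mathrm{id}$, $\partial_t\varphi(t,\cdot)=v(t,\varphi(t,\cdot))$ for a.e. $t$; then $\lambda_{\gamma(t)}=\varphi(t,\cdot)_\#\lambda_{\gamma(0)}$ for all $t\in[0,1]$. Energy and geodesic restriction. For a Lipschitz curve $\rho:[0,1]\to(\mathcal P(\Omega),\mathrm W)$, $\mathrm{CE}(\rho)$ is the set of measurable $v$ with $v(t)\in L^2(\rho(t))$ such that for all $\phi\in C^1([0,1]\times\Omega)$: $\int_0^1\int_\Omega\partial_t\phi(t,\cdot)\,d\rho(t)\,dt+\int_0^1\int_\Omega\langle\nabla\phi(t,\cdot),v(t)\rangle\,d\rho(t)\,dt=\int_\Omega\phi(1,\cdot)\,d\rho(1)-\int_\Omega\phi(0,\cdot)\,d\rho(0)$. Set $\mathrm{energy}(\rho)=\inf\{\int_0^1\|v(t)\|_{L^2(\rho(t))}^2dt: v\in\mathrm{CE}(\rho)\}$. For $\mu,\nu\in\Lambda$, $\mathrm W_\Lambda(\mu,\nu)=\inf\{\mathrm{energy}(\rho)^{1/2}:\rho\in\mathrm{Lip}([0,1];(\Lambda,\mathrm W)),\rho(0)=\mu,\rho(1)=\nu\}$. *)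

theory Defs
  imports "HOL-Probability.Probability"
begin

section \<open>Smooth Riemannian manifolds\<close>

text \<open>
  On an open set of a finite-dimensional space, \<open>Ck_on k U f\<close> says that \<open>f\<close> is \<open>k\<close> times
  continuously differentiable: all iterated directional derivatives exist and are continuous.
\<close>

primrec Ck_on :: "nat \<Rightarrow> 'a::real_normed_vector set \<Rightarrow> ('a \<Rightarrow> 'b::real_normed_vector) \<Rightarrow> bool" where
  "Ck_on 0 U f \<longleftrightarrow> continuous_on U f"
| "Ck_on (Suc k) U f \<longleftrightarrow> (\<forall>x\<in>U. f differentiable (at x)) \<and>
      (\<forall>h. Ck_on k U (\<lambda>x. frechet_derivative f (at x) h))"

definition smooth_on :: "'a::real_normed_vector set \<Rightarrow> ('a \<Rightarrow> 'b::real_normed_vector) \<Rightarrow> bool" where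
  "smooth_on U f \<longleftrightarrow> (\<forall>k. Ck_on k U f)"

text \<open>
  The manifold \<open>M\<close> is the whole type \<open>'m\<close> (Hausdorff and second countable by its sort); a chart is
  a pair of its domain and its coordinate map into the Euclidean model space \<open>'e\<close>.
\<close>

type_synonym ('m, 'e) chart = "'m set \<times> ('m \<Rightarrow> 'e)"

definition chart_inv :: "('m, 'e) chart \<Rightarrow> 'e \<Rightarrow> 'm" where
  "chart_inv c = inv_into (fst c) (snd c)"

definition smooth_atlas ::
    "('m::{t2_space,second_countable_topology}, 'e::euclidean_space) chart set \<Rightarrow> bool" where
  "smooth_atlas A \<longleftrightarrow>
     (\<Union>c\<in>A. fst c) = UNIV \<and>
     (\<forall>c\<in>A. open (fst c) \<and> open (snd c ` fst c) \<and>
        homeomorphism (fst c) (snd c ` fst c) (snd c) (chart_inv c)) \<and>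
     (\<forall>c\<in>A. \<forall>c'\<in>A. smooth_on (snd c ` (fst c \<inter> fst c')) (snd c' \<circ> chart_inv c))"

text \<open>
  A tangent vector at \<open>p\<close> is the family of its coordinate vectors in all charts around \<open>p\<close>,
  which transform by the Jacobians of the chart changes. Entries at other charts are set to \<open>0\<close>,
  so that equal tangent vectors are equal as functions.
\<close>

type_synonym ('m, 'e) tangent = "('m, 'e) chart \<Rightarrow> 'e"

definition tangent_space ::
    "('m, 'e::euclidean_space) chart set \<Rightarrow> 'm \<Rightarrow> ('m, 'e) tangent set" where
  "tangent_space A p = {\<eta>.
     (\<forall>c\<in>A. \<forall>c'\<in>A. p \<in> fst c \<longrightarrow> p \<in> fst c' \<longrightarrow>
        \<eta> c' = frechet_derivative (snd c' \<circ> chart_inv c) (at (snd c p)) (\<eta> c)) \<and>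
     (\<forall>c. \<not> (c \<in> A \<and> p \<in> fst c) \<longrightarrow> \<eta> c = 0)}"

definition tscale :: "real \<Rightarrow> ('m, 'e::euclidean_space) tangent \<Rightarrow> ('m, 'e) tangent" where
  "tscale a \<eta> = (\<lambda>c. a *\<^sub>R \<eta> c)"

definition tadd ::
    "('m, 'e::euclidean_space) tangent \<Rightarrow> ('m, 'e) tangent \<Rightarrow> ('m, 'e) tangent" where
  "tadd \<eta> \<xi> = (\<lambda>c. \<eta> c + \<xi> c)"

text \<open>
  A metric is given by its coordinate expressions: \<open>G c x\<close> is the inner product on the model
  space at the coordinate point \<open>x\<close> of the chart \<open>c\<close>.
\<close>

type_synonym ('m, 'e) metric_tensor = "('m, 'e) chart \<Rightarrow> 'e \<Rightarrow> 'e \<Rightarrow> 'e \<Rightarrow> real"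

definition riemannian_metric ::
    "('m, 'e::euclidean_space) chart set \<Rightarrow> ('m, 'e) metric_tensor \<Rightarrow> bool" where
  "riemannian_metric A G \<longleftrightarrow>
     (\<forall>c\<in>A. \<forall>x\<in>snd c ` fst c. bilinear (G c x) \<and>
        (\<forall>a b. G c x a b = G c x b a) \<and> (\<forall>a. a \<noteq> 0 \<longrightarrow> 0 < G c x a a)) \<and>
     (\<forall>c\<in>A. \<forall>a b. smooth_on (snd c ` fst c) (\<lambda>x. G c x a b)) \<and>
     (\<forall>c\<in>A. \<forall>c'\<in>A. \<forall>p\<in>fst c \<inter> fst c'. \<forall>a b.
        (let J = frechet_derivative (snd c' \<circ> chart_inv c) (at (snd c p))
         in G c (snd c p) a b = G c' (snd c' p) (J a) (J b)))"

definition riemannian_manifold ::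
    "('m::{t2_space,second_countable_topology}, 'e::euclidean_space) chart set \<Rightarrow>
     ('m, 'e) metric_tensor \<Rightarrow> bool" where
  "riemannian_manifold A G \<longleftrightarrow> smooth_atlas A \<and> riemannian_metric A G"

text \<open>By the transformation law of the metric, the choice of the chart is immaterial.\<close>

definition tnorm ::
    "('m, 'e::euclidean_space) chart set \<Rightarrow> ('m, 'e) metric_tensor \<Rightarrow> 'm \<Rightarrow> ('m, 'e) tangent \<Rightarrow> real"
  where
  "tnorm A G p \<eta> = (let c = (SOME c. c \<in> A \<and> p \<in> fst c) in sqrt (G c (snd c p) (\<eta> c) (\<eta> c)))"

text \<open>
  All curves are parametrised over the unit interval, with one-sided derivatives at its ends.
  Continuity is required separately in \<open>curve_differentiable_at\<close> because a coordinate map has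
  arbitrary values outside of its chart domain.
\<close>

definition curve_differentiable_at ::
    "('m::topological_space, 'e::euclidean_space) chart set \<Rightarrow> (real \<Rightarrow> 'm) \<Rightarrow> real \<Rightarrow> bool" where
  "curve_differentiable_at A \<gamma> t \<longleftrightarrow>
     continuous (at t within {0..1}) \<gamma> \<and>
     (\<forall>c\<in>A. \<gamma> t \<in> fst c \<longrightarrow> (snd c \<circ> \<gamma>) differentiable (at t within {0..1}))"

definition velocity ::
    "('m, 'e::euclidean_space) chart set \<Rightarrow> (real \<Rightarrow> 'm) \<Rightarrow> real \<Rightarrow> ('m, 'e) tangent" where
  "velocity A \<gamma> t =
     (\<lambda>c. if c \<in> A \<and> \<gamma> t \<in> fst c then vector_derivative (snd c \<circ> \<gamma>) (at t within {0..1}) else 0)"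

definition piecewise_C1_curve ::
    "('m::topological_space, 'e::euclidean_space) chart set \<Rightarrow> (real \<Rightarrow> 'm) \<Rightarrow> bool" where
  "piecewise_C1_curve A \<sigma> \<longleftrightarrow> continuous_on {0..1} \<sigma> \<and>
     (\<exists>F. finite F \<and> (\<forall>t\<in>{0..1} - F. curve_differentiable_at A \<sigma> t) \<and>
        (\<forall>c\<in>A. continuous_on {t\<in>{0..1} - F. \<sigma> t \<in> fst c} (\<lambda>t. velocity A \<sigma> t c)))"

definition curve_length ::
    "('m, 'e::euclidean_space) chart set \<Rightarrow> ('m, 'e) metric_tensor \<Rightarrow> (real \<Rightarrow> 'm) \<Rightarrow> ennreal" where
  "curve_length A G \<sigma> = (\<integral>\<^sup>+t\<in>{0..1}. ennreal (tnorm A G (\<sigma> t) (velocity A \<sigma> t)) \<partial>lborel)"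

text \<open>The distance on \<open>S\<close> induced by the metric: infimum of the lengths of curves inside \<open>S\<close>.\<close>

definition rdist ::
    "('m::topological_space, 'e::euclidean_space) chart set \<Rightarrow> ('m, 'e) metric_tensor \<Rightarrow>
     'm set \<Rightarrow> 'm \<Rightarrow> 'm \<Rightarrow> real" where
  "rdist A G S p q = enn2real (INF \<sigma>\<in>{\<sigma>. piecewise_C1_curve A \<sigma> \<and> \<sigma> ` {0..1} \<subseteq> S \<and>
     \<sigma> 0 = p \<and> \<sigma> 1 = q}. curve_length A G \<sigma>)"

text \<open>
  \<open>christoffel A G c x a b\<close> is the vector with components
  \<open>\<Sum>i j. \<Gamma>\<^sup>k\<^sub>i\<^sub>j a\<^sub>i b\<^sub>j\<close> of the Levi-Civita connection, in the index-free form
  \<open>G(\<Gamma>(a,b),w) = 1/2 (\<partial>\<^sub>a G(b,w) + \<partial>\<^sub>b G(a,w) - \<partial>\<^sub>w G(a,b))\<close>.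
\<close>

definition christoffel ::
    "('m, 'e::euclidean_space) metric_tensor \<Rightarrow> ('m, 'e) chart \<Rightarrow> 'e \<Rightarrow> 'e \<Rightarrow> 'e \<Rightarrow> 'e" where
  "christoffel G c x a b = (THE z. \<forall>w. G c x z w =
     (frechet_derivative (\<lambda>y. G c y b w) (at x) a
      + frechet_derivative (\<lambda>y. G c y a w) (at x) b
      - frechet_derivative (\<lambda>y. G c y a b) (at x) w) / 2)"

text \<open>The geodesic equation \<open>x'' + \<Gamma>(x', x') = 0\<close>, in every chart met by the curve.\<close>

definition is_geodesic ::
    "('m::topological_space, 'e::euclidean_space) chart set \<Rightarrow> ('m, 'e) metric_tensor \<Rightarrow>
     (real \<Rightarrow> 'm) \<Rightarrow> bool" where
  "is_geodesic A G \<sigma> \<longleftrightarrow> (\<forall>t\<in>{0..1}. curve_differentiable_at A \<sigma> t \<and>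
     (\<forall>c\<in>A. \<sigma> t \<in> fst c \<longrightarrow>
        ((\<lambda>s. velocity A \<sigma> s c) has_vector_derivative
           - christoffel G c (snd c (\<sigma> t)) (velocity A \<sigma> t c) (velocity A \<sigma> t c))
          (at t within {0..1})))"

definition geodesic_from ::
    "('m::topological_space, 'e::euclidean_space) chart set \<Rightarrow> ('m, 'e) metric_tensor \<Rightarrow>
     'm \<Rightarrow> ('m, 'e) tangent \<Rightarrow> (real \<Rightarrow> 'm) \<Rightarrow> bool" where
  "geodesic_from A G p \<eta> \<sigma> \<longleftrightarrow> is_geodesic A G \<sigma> \<and> \<sigma> 0 = p \<and> velocity A \<sigma> 0 = \<eta>"

definition rexp_defined ::
    "('m::topological_space, 'e::euclidean_space) chart set \<Rightarrow> ('m, 'e) metric_tensor \<Rightarrow>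
     'm \<Rightarrow> ('m, 'e) tangent \<Rightarrow> bool" where
  "rexp_defined A G p \<eta> \<longleftrightarrow> (\<exists>\<sigma>. geodesic_from A G p \<eta> \<sigma>)"

definition rexp ::
    "('m::topological_space, 'e::euclidean_space) chart set \<Rightarrow> ('m, 'e) metric_tensor \<Rightarrow>
     'm \<Rightarrow> ('m, 'e) tangent \<Rightarrow> 'm" where
  "rexp A G p \<eta> = (THE q. \<exists>\<sigma>. geodesic_from A G p \<eta> \<sigma> \<and> q = \<sigma> 1)"

definition geodesically_convex ::
    "('m::topological_space, 'e::euclidean_space) chart set \<Rightarrow> ('m, 'e) metric_tensor \<Rightarrow>
     'm set \<Rightarrow> bool" where
  "geodesically_convex A G S \<longleftrightarrow> (\<forall>p\<in>S. \<forall>q\<in>S. \<exists>\<sigma>. is_geodesic A G \<sigma> \<and> \<sigma> 0 = p \<and> \<sigma> 1 = q \<and>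
     \<sigma> ` {0..1} \<subseteq> S \<and> curve_length A G \<sigma> = ennreal (rdist A G UNIV p q))"

text \<open>
  The parameter space is a compact, connected, geodesically convex subset \<open>S\<close> of an ambient
  manifold, which need not be compact. For \<open>S = UNIV\<close> this is a compact manifold without boundary,
  and then geodesic convexity is no extra condition, as it follows from the properties of \<open>D\<close>.
\<close>

definition parameter_manifold ::
    "('m::{t2_space,second_countable_topology}, 'e::euclidean_space) chart set \<Rightarrow>
     ('m, 'e) metric_tensor \<Rightarrow> 'm set \<Rightarrow> ('m \<times> ('m, 'e) tangent) set \<Rightarrow> bool" where
  "parameter_manifold A G S D \<longleftrightarrow>
     riemannian_manifold A G \<and> connected (UNIV :: 'm set) \<and>
     compact S \<and> connected S \<and> geodesically_convex A G S \<and>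
     (\<forall>(\<theta>, \<eta>)\<in>D. \<theta> \<in> S \<and> \<eta> \<in> tangent_space A \<theta> \<and> rexp_defined A G \<theta> \<eta> \<and>
        (\<forall>t\<in>{0..1}. (\<theta>, tscale t \<eta>) \<in> D) \<and>
        (let \<gamma> = (\<lambda>t. rexp A G \<theta> (tscale t \<eta>)) in
           \<gamma> ` {0..1} \<subseteq> S \<and> geodesic_from A G \<theta> \<eta> \<gamma> \<and>
           (\<forall>s\<in>{0..1}. \<forall>t\<in>{0..1}.
              rdist A G S (\<gamma> s) (\<gamma> t) = \<bar>s - t\<bar> * rdist A G S \<theta> (rexp A G \<theta> \<eta>)) \<and>
           (\<forall>t\<in>{0..1}. tnorm A G (\<gamma> t) (velocity A \<gamma> t) = tnorm A G \<theta> \<eta>) \<and>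
           tnorm A G \<theta> \<eta> = rdist A G S \<theta> (rexp A G \<theta> \<eta>))) \<and>
     (\<forall>\<theta>0\<in>S. \<forall>\<theta>1\<in>S. \<exists>\<eta>. (\<theta>0, \<eta>) \<in> D \<and> rexp A G \<theta>0 \<eta> = \<theta>1)"

section \<open>Wasserstein distance, energy and geodesic restriction\<close>

text \<open>Probability measures on \<open>\<Omega>\<close> are Borel measures on the whole space concentrated on \<open>\<Omega>\<close>.\<close>

definition probs_on :: "'a::euclidean_space set \<Rightarrow> 'a measure set" where
  "probs_on \<Omega> = {\<mu>. sets \<mu> = sets borel \<and> prob_space \<mu> \<and> emeasure \<mu> \<Omega> = 1}"

definition couplings ::
    "'a::euclidean_space measure \<Rightarrow> 'a measure \<Rightarrow> ('a \<times> 'a) measure set" where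
  "couplings \<mu> \<nu> = {\<pi>. sets \<pi> = sets borel \<and> distr \<pi> borel fst = \<mu> \<and> distr \<pi> borel snd = \<nu>}"

definition W2 :: "'a::euclidean_space measure \<Rightarrow> 'a measure \<Rightarrow> real" where
  "W2 \<mu> \<nu> = sqrt (enn2real
     (INF \<pi>\<in>couplings \<mu> \<nu>. \<integral>\<^sup>+z. ennreal ((norm (fst z - snd z))\<^sup>2) \<partial>\<pi>))"

text \<open>
  \<open>C1_test \<Omega> \<phi> \<phi>t \<phi>x\<close>: the function \<open>\<phi>\<close> is of class \<open>C\<^sup>1\<close> on \<open>[0,1] \<times> \<Omega>\<close> (up to the boundary),
  with time derivative \<open>\<phi>t\<close> and spatial gradient \<open>\<phi>x\<close>. These are unique if \<open>\<Omega>\<close> has nonempty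
  interior, as it has for a convex set carrying an absolutely continuous probability measure.
\<close>

definition C1_test ::
    "'a::euclidean_space set \<Rightarrow> (real \<times> 'a \<Rightarrow> real) \<Rightarrow> (real \<times> 'a \<Rightarrow> real) \<Rightarrow> (real \<times> 'a \<Rightarrow> 'a) \<Rightarrow> bool"
  where
  "C1_test \<Omega> \<phi> \<phi>t \<phi>x \<longleftrightarrow>
     continuous_on ({0..1} \<times> \<Omega>) \<phi>t \<and> continuous_on ({0..1} \<times> \<Omega>) \<phi>x \<and>
     (\<forall>z\<in>{0..1} \<times> \<Omega>. (\<phi> has_derivative (\<lambda>(s, y). s * \<phi>t z + \<phi>x z \<bullet> y)) (at z within {0..1} \<times> \<Omega>))"

text \<open>
  Velocity fields are represented by Borel maps on the whole space-time; only the values on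
  \<open>[0,1] \<times> \<Omega>\<close> matter, and a field given there may be extended by \<open>0\<close>.
\<close>

definition CE :: "'a::euclidean_space set \<Rightarrow> (real \<Rightarrow> 'a measure) \<Rightarrow> (real \<Rightarrow> 'a \<Rightarrow> 'a) set" where
  "CE \<Omega> \<rho> = {v.
     (\<lambda>(t, x). v t x) \<in> borel_measurable borel \<and>
     (\<forall>t\<in>{0..1}. (\<integral>\<^sup>+x. ennreal ((norm (v t x))\<^sup>2) \<partial>\<rho> t) < \<infinity>) \<and>
     (\<forall>\<phi> \<phi>t \<phi>x. C1_test \<Omega> \<phi> \<phi>t \<phi>x \<longrightarrow>
        (LINT t:{0..1}|lborel. (LINT x:\<Omega>|\<rho> t. \<phi>t (t, x)))
        + (LINT t:{0..1}|lborel. (LINT x:\<Omega>|\<rho> t. \<phi>x (t, x) \<bullet> v t x))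
        = (LINT x:\<Omega>|\<rho> 1. \<phi> (1, x)) - (LINT x:\<Omega>|\<rho> 0. \<phi> (0, x)))}"

definition energy :: "'a::euclidean_space set \<Rightarrow> (real \<Rightarrow> 'a measure) \<Rightarrow> ennreal" where
  "energy \<Omega> \<rho> = (INF v\<in>CE \<Omega> \<rho>.
     \<integral>\<^sup>+t\<in>{0..1}. (\<integral>\<^sup>+x. ennreal ((norm (v t x))\<^sup>2) \<partial>\<rho> t) \<partial>lborel)"

definition esqrt :: "ennreal \<Rightarrow> ereal" where
  "esqrt e = (if e = \<infinity> then \<infinity> else ereal (sqrt (enn2real e)))"

definition lipschitz_curves :: "'a::euclidean_space measure set \<Rightarrow> (real \<Rightarrow> 'a measure) set" where
  "lipschitz_curves \<Lambda> = {\<rho>. (\<forall>t\<in>{0..1}. \<rho> t \<in> \<Lambda>) \<and>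
     (\<exists>L. \<forall>s\<in>{0..1}. \<forall>t\<in>{0..1}. W2 (\<rho> s) (\<rho> t) \<le> L * \<bar>s - t\<bar>)}"

text \<open>The geodesic restriction of \<open>W2\<close> to \<open>\<Lambda>\<close>; its value is \<open>\<infinity>\<close> if no curve has finite energy.\<close>

definition W2_restr ::
    "'a::euclidean_space set \<Rightarrow> 'a measure set \<Rightarrow> 'a measure \<Rightarrow> 'a measure \<Rightarrow> ereal" where
  "W2_restr \<Omega> \<Lambda> \<mu> \<nu> =
     (INF \<rho>\<in>{\<rho>\<in>lipschitz_curves \<Lambda>. \<rho> 0 = \<mu> \<and> \<rho> 1 = \<nu>}. esqrt (energy \<Omega> \<rho>))"

section \<open>Assumptions on the embedding and on the velocity fields\<close>

definition bilipschitz_parametrization ::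
    "'a::euclidean_space set \<Rightarrow> ('m::topological_space, 'e::euclidean_space) chart set \<Rightarrow>
     ('m, 'e) metric_tensor \<Rightarrow> 'm set \<Rightarrow> ('m \<Rightarrow> 'a measure) \<Rightarrow> bool" where
  "bilipschitz_parametrization \<Omega> A G S E \<longleftrightarrow>
     E ` S \<subseteq> probs_on \<Omega> \<and> inj_on E S \<and>
     (\<exists>L>0. \<forall>\<theta>\<in>S. \<forall>\<theta>'\<in>S. rdist A G S \<theta> \<theta>' / L \<le> W2 (E \<theta>) (E \<theta>') \<and>
        W2 (E \<theta>) (E \<theta>') \<le> L * rdist A G S \<theta> \<theta>') \<and>
     (\<forall>\<theta>\<in>S. absolutely_continuous lborel (E \<theta>))"

definition L2_norm :: "'a measure \<Rightarrow> ('a \<Rightarrow> 'b::real_normed_vector) \<Rightarrow> real" where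
  "L2_norm \<mu> f = sqrt (\<integral>x. (norm (f x))\<^sup>2 \<partial>\<mu>)"

definition C1_norm :: "('a::euclidean_space \<Rightarrow> 'a) \<Rightarrow> ennreal" where
  "C1_norm f = max (SUP x. ennreal (norm (f x))) (SUP x. ennreal (onorm (frechet_derivative f (at x))))"

definition velocity_field_map ::
    "('m::topological_space, 'e::euclidean_space) chart set \<Rightarrow> ('m, 'e) metric_tensor \<Rightarrow> 'm set \<Rightarrow>
     ('m \<times> ('m, 'e) tangent) set \<Rightarrow> ('m \<Rightarrow> 'a::euclidean_space measure) \<Rightarrow>
     ('m \<Rightarrow> ('m, 'e) tangent \<Rightarrow> 'a \<Rightarrow> 'a) \<Rightarrow> bool" where
  "velocity_field_map A G S D E B \<longleftrightarrow>
     (\<forall>\<theta>\<in>S. \<forall>\<eta>\<in>tangent_space A \<theta>. Ck_on 1 UNIV (B \<theta> \<eta>) \<and>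
        (\<exists>\<psi>. \<forall>x. GDERIV \<psi> x :> B \<theta> \<eta> x)) \<and>
     (\<forall>\<theta>\<in>S. \<forall>\<eta>\<in>tangent_space A \<theta>. \<forall>\<xi>\<in>tangent_space A \<theta>. \<forall>a b x.
        B \<theta> (tadd (tscale a \<eta>) (tscale b \<xi>)) x = a *\<^sub>R B \<theta> \<eta> x + b *\<^sub>R B \<theta> \<xi> x) \<and>
     (\<exists>C0>0. \<forall>(\<theta>, \<eta>)\<in>D.
        tnorm A G \<theta> \<eta> / C0 \<le> L2_norm (E \<theta>) (B \<theta> \<eta>) \<and>
        L2_norm (E \<theta>) (B \<theta> \<eta>) \<le> C0 * tnorm A G \<theta> \<eta> \<and>
        C1_norm (B \<theta> \<eta>) \<le> ennreal (C0 * tnorm A G \<theta> \<eta>) \<and>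
        (let \<gamma> = (\<lambda>t. rexp A G \<theta> (tscale t \<eta>)) in
           \<forall>x. \<forall>t\<in>{0..1}. \<exists>w. ((\<lambda>s. B (\<gamma> s) (velocity A \<gamma> s) x) has_vector_derivative w)
             (at t within {0..1}) \<and> norm w \<le> C0 * (tnorm A G \<theta> \<eta>)\<^sup>2))"

definition absolutely_continuous_curve :: "(real \<Rightarrow> 'a::metric_space) \<Rightarrow> bool" where
  "absolutely_continuous_curve f \<longleftrightarrow> (\<forall>\<epsilon>>0. \<exists>\<delta>>0. \<forall>(n::nat) a b.
     (\<forall>i<n. 0 \<le> a i \<and> a i \<le> b i \<and> b i \<le> 1) \<and>
     (\<forall>i<n. \<forall>j<n. i \<noteq> j \<longrightarrow> {a i<..<b i} \<inter> {a j<..<b j} = {}) \<and>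
     (\<Sum>i<n. b i - a i) < \<delta> \<longrightarrow> (\<Sum>i<n. dist (f (a i)) (f (b i))) < \<epsilon>)"

text \<open>
  Flow of the time-dependent field \<open>v(t) = B\<^sub>\<gamma>\<^sub>(\<^sub>t\<^sub>) \<gamma>'(t)\<close>, which is defined for almost every \<open>t\<close>
  only. The differential equation is understood in the sense of Caratheodory: without absolute
  continuity in time, validity for almost every \<open>t\<close> would not determine the solution.
\<close>

definition is_flow ::
    "'a::euclidean_space set \<Rightarrow> ('m::topological_space, 'e::euclidean_space) chart set \<Rightarrow>
     ('m \<Rightarrow> ('m, 'e) tangent \<Rightarrow> 'a \<Rightarrow> 'a) \<Rightarrow> (real \<Rightarrow> 'm) \<Rightarrow> (real \<Rightarrow> 'a \<Rightarrow> 'a) \<Rightarrow> bool" where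
  "is_flow \<Omega> A B \<gamma> \<phi> \<longleftrightarrow>
     (\<forall>x\<in>\<Omega>. \<phi> 0 x = x \<and> absolutely_continuous_curve (\<lambda>t. \<phi> t x)) \<and>
     (AE t in lborel. t \<in> {0..1} \<longrightarrow> curve_differentiable_at A \<gamma> t \<and>
        (\<forall>x\<in>\<Omega>. ((\<lambda>s. \<phi> s x) has_vector_derivative B (\<gamma> t) (velocity A \<gamma> t) (\<phi> t x))
          (at t within {0..1})))"

text \<open>
  The flow is only given on \<open>\<Omega>\<close>, hence the push-forward is that of the measure restricted to \<open>\<Omega>\<close>
  (which carries full mass).
\<close>

definition flow_compatible ::
    "'a::euclidean_space set \<Rightarrow> ('m::topological_space, 'e::euclidean_space) chart set \<Rightarrow>
     ('m, 'e) metric_tensor \<Rightarrow> 'm set \<Rightarrow> ('m \<Rightarrow> 'a measure) \<Rightarrow>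
     ('m \<Rightarrow> ('m, 'e) tangent \<Rightarrow> 'a \<Rightarrow> 'a) \<Rightarrow> bool" where
  "flow_compatible \<Omega> A G S E B \<longleftrightarrow>
     (\<forall>\<gamma> \<phi>. \<gamma> ` {0..1} \<subseteq> S \<and>
        (\<exists>L. \<forall>s\<in>{0..1}. \<forall>t\<in>{0..1}. rdist A G S (\<gamma> s) (\<gamma> t) \<le> L * \<bar>s - t\<bar>) \<and>
        is_flow \<Omega> A B \<gamma> \<phi> \<longrightarrow>
        (\<forall>t\<in>{0..1}. \<phi> t \<in> restrict_space (E (\<gamma> 0)) \<Omega> \<rightarrow>\<^sub>M borel \<and>
           E (\<gamma> t) = distr (restrict_space (E (\<gamma> 0)) \<Omega>) borel (\<phi> t)))"

end

theory Submission
  imports Defs "HOL-Complex_Analysis.Great_Picard"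
begin

text \<open>
  Both bounds rest on one estimate for \<open>\<theta>, \<theta>' \<in> S\<close> at distance \<open>\<epsilon>\<close>, joined by \<open>exp\<^sub>\<theta>(t \<eta>)\<close>. With
  \<open>f = B\<^sub>\<theta> \<eta> = \<nabla>\<psi>\<close>, the flow moves \<open>E \<theta>\<close> to \<open>E \<theta>'\<close> by a map \<open>T = id + f + O(\<epsilon>\<^sup>2)\<close>, with velocity
  \<open>f + O(\<epsilon>\<^sup>2)\<close> along the trajectories. So the energy of the geodesic is at most
  \<open>w + O(\<epsilon>\<^sup>3)\<close> with \<open>w = \<parallel>f\<parallel>\<^sup>2\<close> in \<open>L\<^sup>2(E \<theta>)\<close>, and \<open>\<integral>\<psi> dE \<theta>' - \<integral>\<psi> dE \<theta> \<ge> w - O(\<epsilon>\<^sup>3)\<close>.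

  Upper bound: evaluating the same difference with a nearly optimal coupling, Young's inequality gives
  \<open>w \<le> W\<^sup>2 + O(\<epsilon>\<^sup>3)\<close>, and \<open>\<epsilon> = O(W)\<close>; so the energy is at most \<open>(W + C W\<^sup>2)\<^sup>2\<close>.

  Lower bound: let \<open>v\<close> solve the continuity equation of a Lipschitz curve \<open>\<rho>\<close>. On a time interval \<open>I\<close> of length
  \<open>h\<close>, testing with \<open>\<psi>\<close> and Young's inequality give \<open>w \<le> h \<integral>\<^sub>I \<parallel>v\<parallel>\<^sup>2 + O(h\<^sup>3)\<close>. The composition of the maps \<open>T\<close>
  of \<open>n\<close> intervals of length \<open>1/n\<close> pushes \<open>\<rho>(0)\<close> to \<open>\<rho>(1)\<close> at cost at most \<open>\<integral> \<parallel>v\<parallel>\<^sup>2 + O(1/n)\<close>. This replaces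
  both the Benamou-Brenier formula and the triangle inequality of the Wasserstein distance.
\<close>

section \<open>Peano existence\<close>

text \<open>Both bounds need cubic precision. Cauchy-Schwarz over n steps multiplies the sum of the
  step errors by n, so errors O(n^-3) leave O(1/n), while O(n^-2) would not vanish. For the upper
  bound, the square root of W^2 + O(W^3) is W + O(W^2). The cube arises because f = O(\<epsilon>) is
  paired with second-order errors of displacements and velocities. The gradient structure enters
  because the difference of the integrals of \<psi> depends on the two end measures only: through T,
  through any coupling and through any solution of the continuity equation it is the same number,
  and each evaluation relates w to another cost. Young's inequality leaves w/2 on the right;
  absorbing it doubles the constants. Bi-Lipschitz continuity acts in both directions: d \<le> L W
  turns \<epsilon> into W and lifts Lipschitz curves of measures to S; W \<le> L d controls W in the
  error terms and makes the curve along a geodesic admissible.\<close>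

lemma indefinite_integral_lipschitz:
  fixes g :: "real \<Rightarrow> 'a::euclidean_space"
  assumes cont: "continuous_on UNIV g" and bnd: "\<And>t. norm (g t) \<le> M"
  shows "norm (integral {0..s} g - integral {0..t} g) \<le> M * \<bar>s - t\<bar>"
proof -
  have int: "g integrable_on {a..b}" for a b :: real
    using cont continuous_on_subset integrable_continuous_real by blast
  have M: "0 \<le> M" using bnd[of 0] norm_ge_zero order_trans by blast
  have ord: "norm (integral {0..s} g - integral {0..t} g) \<le> M * (s - t)" if "0 \<le> t" "t \<le> s" for s t
  proof -
    have "integral {0..t} g + integral {t..s} g = integral {0..s} g"
      by (intro Henstock_Kurzweil_Integration.integral_combine that int)
    moreover have "norm (integral {t..s} g) \<le> M * (s - t)"
      using integral_bound[of t s g M] that bnd cont continuous_on_subset by blast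
    ultimately show ?thesis by (metis add_diff_cancel_left')
  qed
  \<comment> \<open>For negative \<open>r\<close> the interval is empty and the integral 0, so
    clamping at 0 extends the bound to all real times. The delayed iterates below are evaluated at
    negative times.\<close>
  have *: "integral {0..r} g = integral {0..max 0 r} g" for r
    by (cases "r \<le> 0") (auto simp: max_def le_less)
  have "norm (integral {0..max 0 s} g - integral {0..max 0 t} g) \<le> M * \<bar>max 0 s - max 0 t\<bar>"
    using ord[of "max 0 t" "max 0 s"] ord[of "max 0 s" "max 0 t"]
    by (cases "max 0 t \<le> max 0 s") (auto simp: norm_minus_commute abs_if)
  also have "\<dots> \<le> M * \<bar>s - t\<bar>" using M by (intro mult_left_mono) auto
  finally show ?thesis using * by metis
qed

text \<open>Tonelli's scheme: solve the equation with a delay, then let the delay tend to 0.\<close>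

lemma peano_existence:
  fixes v :: "real \<Rightarrow> 'a::euclidean_space \<Rightarrow> 'a"
  assumes cont: "continuous_on UNIV (\<lambda>(t, x). v t x)" and bnd: "\<And>t x. norm (v t x) \<le> M"
  shows "\<exists>u. u 0 = x \<and> (\<forall>t\<in>{0..1}. (u has_vector_derivative v t (u t)) (at t within {0..1}))"
proof -
  have M: "0 \<le> M" using bnd[of 0 0] norm_ge_zero order_trans by blast
  have vcont: "continuous_on T (\<lambda>s. v s (p s))" if "continuous_on T p" for p T
    using continuous_on_compose2[OF cont continuous_on_Pair[OF continuous_on_id that]] by simp
  define P :: "real \<Rightarrow> nat \<Rightarrow> real \<Rightarrow> 'a" where
    "P = (\<lambda>\<delta>. rec_nat (\<lambda>t. x) (\<lambda>_ p t. x + integral {0..t} (\<lambda>s. v s (p (s - \<delta>)))))"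
  have P0: "P \<delta> 0 = (\<lambda>t. x)" and PS: "P \<delta> (Suc k) = (\<lambda>t. x + integral {0..t} (\<lambda>s. v s (P \<delta> k (s - \<delta>))))"
    for \<delta> k by (auto simp: P_def)
  have lip: "\<forall>s t. norm (P \<delta> k s - P \<delta> k t) \<le> M * \<bar>s - t\<bar>" for \<delta> k
  proof (induction k)
    case 0 then show ?case using M by (simp add: P0)
  next
    case (Suc j)
    have "M-lipschitz_on UNIV (P \<delta> j)"
      using M Suc by (auto intro!: lipschitz_onI simp: dist_norm)
    then have "continuous_on UNIV (P \<delta> j)" by (rule lipschitz_on_continuous_on)
    then have "continuous_on UNIV (\<lambda>s. P \<delta> j (s - \<delta>))"
      by (rule continuous_on_compose2) (auto intro!: continuous_intros)
    from indefinite_integral_lipschitz[OF vcont[OF this] bnd] show ?case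
      unfolding PS by simp
  qed
  then have Plip: "norm (P \<delta> k s - P \<delta> k t) \<le> M * \<bar>s - t\<bar>" for \<delta> k s t by blast
  have "M-lipschitz_on UNIV (P \<delta> k)" for \<delta> k
    using M Plip by (auto intro!: lipschitz_onI simp: dist_norm)
  then have Pcont: "continuous_on UNIV (P \<delta> k)" for \<delta> k by (rule lipschitz_on_continuous_on)
  \<comment> \<open>Up to time \<open>t\<close> the right-hand side reads the previous iterate only
    up to \<open>t - \<delta>\<close>, so every iteration settles one more interval of length
    \<open>\<delta>\<close>: the method of steps, written as an iteration that becomes
    stationary.\<close>
  have agree: "P \<delta> k t = P \<delta> (Suc k) t" if "t \<le> real k * \<delta>" "\<delta> > 0" for \<delta> k t
    using that
  proof (induction k arbitrary: t)
    case 0 then show ?case by (cases "t = 0") (auto simp: P0 PS)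
  next
    case (Suc k)
    have "integral {0..t} (\<lambda>s. v s (P \<delta> k (s - \<delta>))) = integral {0..t} (\<lambda>s. v s (P \<delta> (Suc k) (s - \<delta>)))"
    proof (rule integral_cong)
      fix s assume "s \<in> {0..t}"
      then have "P \<delta> k (s - \<delta>) = P \<delta> (Suc k) (s - \<delta>)"
        using Suc.prems by (intro Suc.IH) (auto simp: algebra_simps)
      then show "v s (P \<delta> k (s - \<delta>)) = v s (P \<delta> (Suc k) (s - \<delta>))" by simp
    qed
    then show ?case unfolding PS[of \<delta> k] PS[of \<delta> "Suc k"] by simp
  qed
  define d where "d n = 1 / real (Suc n)" for n
  define u where "u n = P (d n) (Suc n)" for n
  define q where "q n s = P (d n) n (s - d n)" for n s
  have u_eq: "u n t = x + integral {0..t} (\<lambda>s. v s (q n s))" for n t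
    by (simp add: u_def q_def PS)
  have uq: "norm (q n s - u n s) \<le> M * d n" if "s \<le> 1" for n s
  proof -
    \<comment> \<open>With delay 1/(n+1), iterate number n is settled up to time n/(n+1) =
      \<open>1 - d n\<close>, which covers every delayed time \<open>s - d n\<close> with s \<le> 1.
      Hence \<open>u n\<close> solves the delayed equation on the whole unit interval.\<close>
    have "real n * d n = 1 - d n" "0 < d n" by (auto simp: d_def field_simps)
    then have "q n s = u n (s - d n)" unfolding q_def u_def
      using that by (intro agree) auto
    then show ?thesis using Plip[of "d n" "Suc n" "s - d n" s] by (simp add: u_def d_def)
  qed
  have ulip: "norm (u n s - u n t) \<le> M * \<bar>s - t\<bar>" for n s t
    unfolding u_def by (rule Plip)
  have u0: "u n 0 = x" for n by (simp add: u_eq)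
  obtain g k where g: "continuous_on {0..1} g" and k: "strict_mono (k :: nat \<Rightarrow> nat)"
    and conv: "\<And>e. 0 < e \<Longrightarrow> \<exists>N. \<forall>n s. n \<ge> N \<and> s \<in> {0..1} \<longrightarrow> norm (u (k n) s - g s) < e"
  proof (rule Arzela_Ascoli[of "{0..1::real}" u "norm x + M"])
    show "norm (u n s) \<le> norm x + M" if "s \<in> {0..1}" for n s
    proof -
      have "norm (u n s - x) \<le> M * s" using ulip[of n s 0] that by (simp add: u0)
      moreover have "M * s \<le> M * 1" using that M by (intro mult_left_mono) auto
      ultimately show ?thesis using norm_triangle_sub[of "u n s" x] by linarith
    qed
    show "\<exists>d>0. \<forall>n y. y \<in> {0..1} \<and> norm (s - y) < d \<longrightarrow> norm (u n s - u n y) < e"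
      if "s \<in> {0..1}" "0 < e" for s e :: real
    proof (intro exI conjI allI impI)
      show "0 < e / (M + 1)" using that M by simp
      fix n y assume "y \<in> {0..1} \<and> norm (s - y) < e / (M + 1)"
      then have "(M + 1) * \<bar>s - y\<bar> < e" using M by (simp add: pos_less_divide_eq mult.commute)
      then show "norm (u n s - u n y) < e" using ulip[of n s y] by (simp add: algebra_simps)
    qed
  qed auto
  have lim: "(\<lambda>n. u (k n) s) \<longlonglongrightarrow> g s" if "s \<in> {0..1}" for s
    using conv that unfolding LIMSEQ_iff by blast
  have dlim: "(\<lambda>n. M * d (k n)) \<longlonglongrightarrow> 0"
  proof -
    have "d \<longlonglongrightarrow> 0" unfolding d_def using LIMSEQ_inverse_real_of_nat by (simp add: inverse_eq_divide)
    then have "(\<lambda>n. d (k n)) \<longlonglongrightarrow> 0" using LIMSEQ_subseq_LIMSEQ[OF _ k] by (auto simp: o_def)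
    then show ?thesis using tendsto_mult_right_zero by blast
  qed
  have qlim: "(\<lambda>n. q (k n) s) \<longlonglongrightarrow> g s" if "s \<in> {0..1}" for s
  proof -
    have "(\<lambda>n. q (k n) s - u (k n) s) \<longlonglongrightarrow> 0"
      by (rule Lim_null_comparison[OF _ dlim]) (use uq that in auto)
    from tendsto_add[OF this lim[OF that]] show ?thesis by simp
  qed
  have g_eq: "g t = x + integral {0..t} (\<lambda>s. v s (g s))" if "t \<in> {0..1}" for t
  proof -
    have "(\<lambda>n. integral {0..t} (\<lambda>s. v s (q (k n) s))) \<longlonglongrightarrow> integral {0..t} (\<lambda>s. v s (g s))"
    proof (rule dominated_convergence(2)[where h = "\<lambda>_. M"])
      show "(\<lambda>s. v s (q (k n) s)) integrable_on {0..t}" for n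
      proof (intro integrable_continuous_real vcont)
        show "continuous_on {0..t} (q (k n))" unfolding q_def
          by (rule continuous_on_compose2[OF Pcont]) (auto intro!: continuous_intros)
      qed
      show "(\<lambda>n. v s (q (k n) s)) \<longlonglongrightarrow> v s (g s)" if "s \<in> {0..t}" for s
      proof -
        have "continuous_on UNIV (v s)"
          using continuous_on_compose2[OF cont continuous_on_Pair[OF continuous_on_const continuous_on_id]] by simp
        then have "isCont (v s) (g s)" by (simp add: continuous_on_eq_continuous_at)
        then show ?thesis using qlim[of s] that \<open>t \<in> {0..1}\<close> by (auto intro: isCont_tendsto_compose)
      qed
    qed (use bnd in auto)
    then have "(\<lambda>n. u (k n) t) \<longlonglongrightarrow> x + integral {0..t} (\<lambda>s. v s (g s))"
      unfolding u_eq by (intro tendsto_intros)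
    with lim[OF that] show ?thesis using LIMSEQ_unique by blast
  qed
  have "(g has_vector_derivative v t (g t)) (at t within {0..1})" if t: "t \<in> {0..1}" for t
  proof -
    have "((\<lambda>t. x + integral {0..t} (\<lambda>s. v s (g s))) has_vector_derivative 0 + v t (g t)) (at t within {0..1})"
      by (intro has_vector_derivative_add has_vector_derivative_const
          integral_has_vector_derivative vcont g t)
    then show ?thesis
      using has_vector_derivative_transform[OF t, of g "\<lambda>t. x + integral {0..t} (\<lambda>s. v s (g s))"] g_eq by simp
  qed
  moreover have "g 0 = x" using g_eq[of 0] by simp
  ultimately show ?thesis by blast
qed

section \<open>Potentials, couplings and weak time derivatives\<close>

lemma gradient_bound:
  fixes \<psi> :: "'a::euclidean_space \<Rightarrow> real"
  assumes grad: "\<And>z. GDERIV \<psi> z :> f z" and bnd: "\<And>z. z \<in> closed_segment x y \<Longrightarrow> norm (f z) \<le> M"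
  shows "\<bar>\<psi> y - \<psi> x\<bar> \<le> M * norm (y - x)"
proof -
  have "norm (\<psi> y - \<psi> x) \<le> M * norm (y - x)"
  proof (rule differentiable_bound[OF convex_closed_segment])
    show "(\<psi> has_derivative (\<lambda>h. h \<bullet> f z)) (at z within closed_segment x y)" for z
      by (rule has_derivative_at_withinI) (use grad in \<open>simp add: gderiv_def\<close>)
    show "onorm (\<lambda>h. h \<bullet> f z) \<le> M" if "z \<in> closed_segment x y" for z
    proof (rule onorm_le)
      fix h
      have "norm (h \<bullet> f z) \<le> norm h * norm (f z)" using Cauchy_Schwarz_ineq2 by simp
      also have "\<dots> \<le> norm h * M" using bnd[OF that] by (intro mult_left_mono) auto
      finally show "norm (h \<bullet> f z) \<le> M * norm h" by (simp add: mult.commute)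
    qed
  qed auto
  then show ?thesis by simp
qed

text \<open>The mean value inequality on the segment, applied to \<open>\<psi>\<close> minus the
  linear function \<open>z \<bullet> f x\<close>: its gradient \<open>f z - f x\<close> is at most
  \<open>M * norm (y - x)\<close> there, hence the constant \<open>M\<close> instead of
  \<open>M / 2\<close>.\<close>

lemma gradient_expansion:
  fixes \<psi> :: "'a::euclidean_space \<Rightarrow> real"
  assumes grad: "\<And>z. GDERIV \<psi> z :> f z" and M: "0 \<le> M"
    and lip: "\<And>z w. norm (f z - f w) \<le> M * norm (z - w)"
  shows "\<bar>\<psi> y - \<psi> x - f x \<bullet> (y - x)\<bar> \<le> M * (norm (y - x))\<^sup>2"
proof -
  have "\<bar>(\<psi> y - y \<bullet> f x) - (\<psi> x - x \<bullet> f x)\<bar> \<le> (M * norm (y - x)) * norm (y - x)"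
  proof (rule gradient_bound[where f = "\<lambda>z. f z - f x"])
    show "GDERIV (\<lambda>z. \<psi> z - z \<bullet> f x) z :> f z - f x" for z
      using grad[of z] unfolding gderiv_def
      by (auto intro!: derivative_eq_intros simp: inner_diff_right)
    fix z assume "z \<in> closed_segment x y"
    then have "norm (z - x) \<le> norm (y - x)" using segment_bound by blast
    then show "norm (f z - f x) \<le> M * norm (y - x)"
      using lip[of z x] M mult_left_mono order_trans by blast
  qed
  then show ?thesis by (simp add: algebra_simps inner_diff_right inner_commute power2_eq_square)
qed

text \<open>Through \<open>enn2real\<close>, \<open>W2\<close> reads an infinite infimum as 0. A
  coupling \<open>\<pi>0\<close> of finite cost excludes this, so that the infimum is the square of
  \<open>W2\<close> and is approached up to \<open>\<delta>\<close>.\<close>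

lemma W2_coupling:
  assumes "\<pi>0 \<in> couplings \<mu> \<nu>" "(\<integral>\<^sup>+z. ennreal ((norm (fst z - snd z))\<^sup>2) \<partial>\<pi>0) < \<infinity>" "0 < \<delta>"
  obtains \<pi> where "\<pi> \<in> couplings \<mu> \<nu>"
    "(\<integral>\<^sup>+z. ennreal ((norm (fst z - snd z))\<^sup>2) \<partial>\<pi>) \<le> ennreal ((W2 \<mu> \<nu>)\<^sup>2 + \<delta>)"
proof -
  let ?I = "INF \<pi>\<in>couplings \<mu> \<nu>. \<integral>\<^sup>+z. ennreal ((norm (fst z - snd z))\<^sup>2) \<partial>\<pi>"
  have "?I < \<infinity>" by (rule le_less_trans[rotated, OF assms(2)]) (rule INF_lower[OF assms(1)])
  then have I: "?I = ennreal ((W2 \<mu> \<nu>)\<^sup>2)" unfolding W2_def by simp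
  also have "\<dots> < ennreal ((W2 \<mu> \<nu>)\<^sup>2 + \<delta>)" using assms by (simp add: ennreal_lessI)
  finally obtain \<pi> where "\<pi> \<in> couplings \<mu> \<nu>"
    "(\<integral>\<^sup>+z. ennreal ((norm (fst z - snd z))\<^sup>2) \<partial>\<pi>) < ennreal ((W2 \<mu> \<nu>)\<^sup>2 + \<delta>)"
    unfolding INF_less_iff by blast
  then show thesis using that less_imp_le by blast
qed

text \<open>Rounding \<open>t\<close> down to a grid of step 1/(n+1) leaves countably many sections,
  each of them measurable; continuity in \<open>t\<close> gives pointwise convergence. It provides
  the joint measurability of the flow.\<close>

lemma borel_measurable_caratheodory:
  fixes Y :: "real \<Rightarrow> 'x \<Rightarrow> 'b::metric_space"
  assumes meas: "\<And>t. Y t \<in> borel_measurable M"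
    and cont: "\<And>x. x \<in> space M \<Longrightarrow> continuous_on UNIV (\<lambda>t. Y t x)"
  shows "(\<lambda>(t, x). Y t x) \<in> borel_measurable (borel \<Otimes>\<^sub>M M)"
proof (rule borel_measurable_LIMSEQ_metric)
  fix n :: nat
  let ?g = "\<lambda>z::real \<times> 'x. \<lfloor>real (Suc n) * fst z\<rfloor>"
  have [measurable]: "Y t \<in> borel_measurable M" for t by (rule meas)
  have "(\<lambda>z. (\<lambda>i z. Y (real_of_int i / real (Suc n)) (snd z)) (?g z) z) \<in> borel_measurable (borel \<Otimes>\<^sub>M M)"
    by (rule measurable_compose_countable) measurable
  then show "(\<lambda>z. Y (real_of_int \<lfloor>real (Suc n) * fst z\<rfloor> / real (Suc n)) (snd z)) \<in> borel_measurable (borel \<Otimes>\<^sub>M M)"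
    by simp
next
  fix z :: "real \<times> 'x" assume z: "z \<in> space (borel \<Otimes>\<^sub>M M)"
  obtain t x where tx: "z = (t, x)" by (cases z)
  have x: "x \<in> space M" using z tx by (auto simp: space_pair_measure)
  have "(\<lambda>n. real_of_int \<lfloor>real (Suc n) * t\<rfloor> / real (Suc n) - t) \<longlonglongrightarrow> 0"
  proof (rule Lim_null_comparison[OF _ LIMSEQ_inverse_real_of_nat])
    show "\<forall>\<^sub>F n in sequentially. norm (real_of_int \<lfloor>real (Suc n) * t\<rfloor> / real (Suc n) - t) \<le> inverse (real (Suc n))"
    proof (intro always_eventually allI)
      fix n
      have "\<bar>real_of_int \<lfloor>real (Suc n) * t\<rfloor> - real (Suc n) * t\<bar> \<le> 1" by linarith
      then have "\<bar>real_of_int \<lfloor>real (Suc n) * t\<rfloor> - real (Suc n) * t\<bar> / real (Suc n) \<le> 1 / real (Suc n)"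
        by (intro divide_right_mono) auto
      moreover have "real_of_int \<lfloor>real (Suc n) * t\<rfloor> / real (Suc n) - t
          = (real_of_int \<lfloor>real (Suc n) * t\<rfloor> - real (Suc n) * t) / real (Suc n)"
        by (simp add: field_simps)
      ultimately show "norm (real_of_int \<lfloor>real (Suc n) * t\<rfloor> / real (Suc n) - t) \<le> inverse (real (Suc n))"
        by (simp add: inverse_eq_divide abs_divide)
    qed
  qed
  then have "(\<lambda>n. real_of_int \<lfloor>real (Suc n) * t\<rfloor> / real (Suc n)) \<longlonglongrightarrow> t"
    using LIM_zero_iff by blast
  moreover have "isCont (\<lambda>t. Y t x) t" using cont[OF x] by (simp add: continuous_on_eq_continuous_at)
  ultimately show "(\<lambda>n. Y (real_of_int \<lfloor>real (Suc n) * fst z\<rfloor> / real (Suc n)) (snd z)) \<longlonglongrightarrow> (case z of (t, x) \<Rightarrow> Y t x)"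
    unfolding tx by (auto intro: isCont_tendsto_compose)
qed

section \<open>Increments of Lipschitz functions with an integrable weak derivative\<close>

lemma has_real_derivative_max_square:
  "((\<lambda>u::real. (max 0 u)\<^sup>2) has_real_derivative 2 * max 0 u) (at u)"
proof -
  consider "u > 0" | "u < 0" | "u = 0" by linarith
  then show ?thesis
  proof cases
    case 1
    have "((\<lambda>u::real. u\<^sup>2) has_real_derivative 2 * u) (at u)" by (auto intro!: derivative_eq_intros)
    then show ?thesis
      by (rule DERIV_cong[OF has_field_derivative_transform_within_open[where S = "{0<..}"]]) (use 1 in auto)
  next
    case 2
    have "((\<lambda>u::real. 0) has_real_derivative 0) (at u)" by simp
    then show ?thesis
      by (rule DERIV_cong[OF has_field_derivative_transform_within_open[where S = "{..<0}"]]) (use 2 in auto)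
  next
    case 3
    have "((\<lambda>h::real. (max 0 h)\<^sup>2 / h) \<longlongrightarrow> 0) (at 0)"
    proof (rule Lim_null_comparison)
      show "\<forall>\<^sub>F h::real in at 0. norm ((max 0 h)\<^sup>2 / h) \<le> \<bar>h\<bar>"
        by (intro always_eventually allI) (auto simp: max_def power2_eq_square)
      show "((\<lambda>h::real. \<bar>h\<bar>) \<longlongrightarrow> 0) (at 0)" by (rule tendsto_rabs_zero) (rule tendsto_ident_at)
    qed
    then show ?thesis using 3 by (simp add: DERIV_def)
  qed
qed

text \<open>Tested with C^1 ramps that rise from 0 to 1 on a shrinking interval to the right of
  \<open>a\<close>: their derivatives concentrate at \<open>a\<close> and produce
  \<open>F a\<close>, while the ramps tend to the indicator of \<open>{a<..1}\<close>. With 1 as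
  right end, one ramp does instead of two.\<close>

lemma weak_derivative_increment_to_end:
  fixes F g :: "real \<Rightarrow> real"
  assumes lip: "\<And>s t. s \<in> {0..1} \<Longrightarrow> t \<in> {0..1} \<Longrightarrow> \<bar>F s - F t\<bar> \<le> M * \<bar>s - t\<bar>"
    and int: "set_integrable lborel {0..1} g"
    and weak: "\<And>\<zeta> \<zeta>'. (\<And>s. (\<zeta> has_real_derivative \<zeta>' s) (at s)) \<Longrightarrow> continuous_on UNIV \<zeta>' \<Longrightarrow>
      (LINT s:{0..1}|lborel. \<zeta>' s * F s) + (LINT s:{0..1}|lborel. \<zeta> s * g s) = \<zeta> 1 * F 1 - \<zeta> 0 * F 0"
    and a: "0 \<le> a" "a \<le> 1"
  shows "F 1 - F a = (LINT s:{a<..1}|lborel. g s)"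
proof -
  consider "a = 0" | "a = 1" | "0 < a" "a < 1" using a by linarith
  then show ?thesis
  proof cases
    case 1
    have "(LINT s:{0..1}|lborel. g s) = F 1 - F 0"
      using weak[of "\<lambda>_. 1" "\<lambda>_. 0"] by simp
    moreover have "(LINT s:{0..1}|lborel. g s) = (LINT s:{0<..1}|lborel. g s)"
      unfolding set_lebesgue_integral_def
    proof (rule integral_cong_AE)
      show "AE s in lborel. indicat_real {0..1} s *\<^sub>R g s = indicat_real {0<..1} s *\<^sub>R g s"
        using AE_lborel_singleton[of "0::real"] by eventually_elim (auto simp: indicator_def)
      show "(\<lambda>s. indicat_real {0..1} s *\<^sub>R g s) \<in> borel_measurable lborel"
        using int unfolding set_integrable_def by auto
      have "set_integrable lborel {0<..1} g" by (rule set_integrable_subset[OF int]) auto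
      then show "(\<lambda>s. indicat_real {0<..1} s *\<^sub>R g s) \<in> borel_measurable lborel"
        unfolding set_integrable_def by auto
    qed
    ultimately show ?thesis using 1 by simp
  next
    case 2
    then show ?thesis by (simp add: set_lebesgue_integral_def)
  next
    case 3
    \<comment> \<open>a quadratic spline that is a \<open>C\<^sup>1\<close> step from \<open>0\<close> to \<open>1\<close> on the unit interval\<close>
    define q where "q u = 2 * (max 0 u)\<^sup>2 - 4 * (max 0 (u - 1/2))\<^sup>2 + 2 * (max 0 (u - 1))\<^sup>2" for u :: real
    define q' where "q' u = 4 * max 0 u - 8 * max 0 (u - 1/2) + 4 * max 0 (u - 1)" for u :: real
    have dm: "((\<lambda>u. (max 0 (u - c))\<^sup>2) has_real_derivative 2 * max 0 (u - c)) (at u)" for c u :: real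
      by (rule DERIV_cong[OF DERIV_chain2[OF has_real_derivative_max_square, of "\<lambda>u. u - c" 1 u UNIV]])
        (auto intro!: derivative_eq_intros)
    have dq: "(q has_real_derivative q' u) (at u)" for u
    proof -
      have "((\<lambda>u. 2 * (max 0 (u - 0))\<^sup>2 - 4 * (max 0 (u - 1/2))\<^sup>2 + 2 * (max 0 (u - 1))\<^sup>2) has_real_derivative
          2 * (2 * max 0 (u - 0)) - 4 * (2 * max 0 (u - 1/2)) + 2 * (2 * max 0 (u - 1))) (at u)"
        by (intro DERIV_add DERIV_diff DERIV_cmult dm)
      then show ?thesis by (simp add: q_def[abs_def] q'_def)
    qed
    have q0: "q u = 0" if "u \<le> 0" for u using that by (simp add: q_def)
    have q1: "q u = 1" if "u \<ge> 1" for u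
      using that by (simp add: q_def power2_eq_square algebra_simps)
    have q'0: "q' u = 0" if "u \<notin> {0..1}" for u using that by (auto simp: q'_def max_def)
    have q'nn: "q' u \<ge> 0" for u by (auto simp: q'_def max_def)
    have q_mono: "q u \<le> q w" if "u \<le> w" for u w
      by (rule DERIV_nonneg_imp_nondecreasing[OF that]) (intro exI conjI, rule dq, rule q'nn)
    have qbd: "0 \<le> q u" "q u \<le> 1" for u
      using q_mono[of "min u 0" u] q_mono[of u "max u 1"] q0[of "min u 0"] q1[of "max u 1"] by auto
    have q'cont: "continuous_on UNIV q'" unfolding q'_def by (intro continuous_intros)
    have Fcont: "continuous_on {0..1} F"
    proof -
      have "(max M 0)-lipschitz_on {0..1} F"
      proof (rule lipschitz_onI)
        fix s t :: real assume "s \<in> {0..1}" "t \<in> {0..1}"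
        from lip[OF this] have "\<bar>F s - F t\<bar> \<le> M * \<bar>s - t\<bar>" .
        also have "\<dots> \<le> max M 0 * \<bar>s - t\<bar>" by (intro mult_right_mono) auto
        finally show "dist (F s) (F t) \<le> max M 0 * dist s t" by (simp add: dist_real_def)
      qed simp
      then show ?thesis by (rule lipschitz_on_continuous_on)
    qed
    \<comment> \<open>The ramp has width \<open>1 / k n\<close>. The summand
      \<open>1 / (1 - a)\<close> makes it reach its top by time 1 for every n, so that
      \<open>\<zeta> n 1 = 1\<close>.\<close>
    define k where "k n = real n + 1 / (1 - a)" for n
    have kpos: "0 < k n" "1 \<le> k n * (1 - a)" for n
    proof -
      show "0 < k n" using 3 by (simp add: k_def add_nonneg_pos)
      have "k n * (1 - a) = real n * (1 - a) + 1" using 3 by (simp add: k_def distrib_right)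
      then show "1 \<le> k n * (1 - a)" using 3 by simp
    qed
    define \<zeta> where "\<zeta> n s = q (k n * (s - a))" for n s
    define \<zeta>' where "\<zeta>' n s = k n * q' (k n * (s - a))" for n s
    have d\<zeta>: "(\<zeta> n has_real_derivative \<zeta>' n s) (at s)" for n s
      unfolding \<zeta>_def \<zeta>'_def
      by (rule DERIV_cong[OF DERIV_chain2[OF dq, of "\<lambda>s. k n * (s - a)" "k n" s UNIV]])
        (auto intro!: derivative_eq_intros)
    have \<zeta>'cont: "continuous_on UNIV (\<zeta>' n)" for n
      unfolding \<zeta>'_def by (intro continuous_intros continuous_on_compose2[OF q'cont]) auto
    have ends: "\<zeta> n 1 = 1" "\<zeta> n 0 = 0" for n
      using kpos[of n] 3 by (auto simp: \<zeta>_def intro!: q0 q1 mult_nonneg_nonpos)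
    have \<zeta>'int: "set_integrable lborel {0..1} (\<zeta>' n)" for n
      by (intro borel_integrable_atLeastAtMost' continuous_on_subset[OF \<zeta>'cont]) auto
    have \<zeta>'F: "set_integrable lborel {0..1} (\<lambda>s. \<zeta>' n s * F s)" for n
      by (intro borel_integrable_atLeastAtMost' continuous_on_mult Fcont continuous_on_subset[OF \<zeta>'cont]) auto
    have mass: "(LINT s:{0..1}|lborel. \<zeta>' n s) = 1" for n
    proof -
      have "(LINT s:{0..1}|lborel. \<zeta>' n s) = integral {0..1} (\<zeta>' n)"
        by (rule set_borel_integral_eq_integral(2)[OF \<zeta>'int])
      also have "\<dots> = \<zeta> n 1 - \<zeta> n 0"
        by (intro integral_unique fundamental_theorem_of_calculus)
          (auto intro!: has_field_derivative_at_within d\<zeta> simp flip: has_real_derivative_iff_has_vector_derivative)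
      finally show ?thesis by (simp add: ends)
    qed
    \<comment> \<open>\<open>\<zeta>' n\<close> is a nonnegative weight of mass 1 living on times
      between \<open>a\<close> and \<open>a + 1 / k n\<close>, so it averages values of
      \<open>F\<close> that differ from \<open>F a\<close> by at most
      \<open>\<bar>M\<bar> / k n\<close>.\<close>
    have near: "\<bar>(LINT s:{0..1}|lborel. \<zeta>' n s * F s) - F a\<bar> \<le> \<bar>M\<bar> / k n" for n
    proof -
      have "(LINT s:{0..1}|lborel. \<zeta>' n s * F s) - F a = (LINT s:{0..1}|lborel. \<zeta>' n s * F s - \<zeta>' n s * F a)"
        using mass[of n] by (subst set_integral_diff(2)[OF \<zeta>'F]) (auto intro!: set_integrable_mult_left \<zeta>'int)
      also have "\<bar>\<dots>\<bar> \<le> (LINT s:{0..1}|lborel. \<bar>\<zeta>' n s * F s - \<zeta>' n s * F a\<bar>)"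
        using set_integral_norm_bound[of lborel "{0..1}" "\<lambda>s. \<zeta>' n s * F s - \<zeta>' n s * F a"] \<zeta>'F \<zeta>'int
        by (auto intro!: set_integral_diff set_integrable_mult_left)
      also have "\<dots> \<le> (LINT s:{0..1}|lborel. \<zeta>' n s * (\<bar>M\<bar> / k n))"
      proof (rule set_integral_mono)
        show "set_integrable lborel {0..1} (\<lambda>s. \<bar>\<zeta>' n s * F s - \<zeta>' n s * F a\<bar>)"
          using \<zeta>'F \<zeta>'int by (intro set_integrable_abs set_integral_diff set_integrable_mult_left) auto
        show "set_integrable lborel {0..1} (\<lambda>s. \<zeta>' n s * (\<bar>M\<bar> / k n))"
          using \<zeta>'int by (intro set_integrable_mult_left) auto
        fix s :: real assume s: "s \<in> {0..1}"
        have nn: "0 \<le> \<zeta>' n s" using kpos q'nn by (simp add: \<zeta>'_def less_imp_le)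
        show "\<bar>\<zeta>' n s * F s - \<zeta>' n s * F a\<bar> \<le> \<zeta>' n s * (\<bar>M\<bar> / k n)"
        proof (cases "k n * (s - a) \<in> {0..1}")
          case False
          then show ?thesis by (simp add: \<zeta>'_def q'0)
        next
          case True
          then have *: "0 \<le> s - a" "s - a \<le> 1 / k n"
            using kpos(1)[of n] by (auto simp: zero_le_mult_iff field_simps)
          have "\<bar>F s - F a\<bar> \<le> M * \<bar>s - a\<bar>" using lip s 3 by simp
          also have "\<dots> \<le> \<bar>M\<bar> * (1 / k n)" using * by (intro mult_mono) auto
          finally have "\<zeta>' n s * \<bar>F s - F a\<bar> \<le> \<zeta>' n s * (\<bar>M\<bar> / k n)" using nn by (intro mult_left_mono) auto
          then show ?thesis using nn by (simp add: abs_mult flip: right_diff_distrib)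
        qed
      qed
      also have "\<dots> = \<bar>M\<bar> / k n" by (simp add: mass)
      finally show ?thesis .
    qed
    have "(\<lambda>n. (LINT s:{0..1}|lborel. \<zeta>' n s * F s) - F a) \<longlonglongrightarrow> 0"
    proof (rule Lim_null_comparison[OF always_eventually])
      show "\<forall>n. norm ((LINT s:{0..1}|lborel. \<zeta>' n s * F s) - F a) \<le> \<bar>M\<bar> / k n" using near by simp
      have "filterlim k at_top sequentially"
        by (rule filterlim_at_top_mono[OF filterlim_real_sequentially always_eventually]) (use 3 in \<open>simp add: k_def\<close>)
      then show "(\<lambda>n. \<bar>M\<bar> / k n) \<longlonglongrightarrow> 0" by (intro real_tendsto_divide_at_top[OF tendsto_const])
    qed
    then have lim1: "(\<lambda>n. (LINT s:{0..1}|lborel. \<zeta>' n s * F s)) \<longlonglongrightarrow> F a"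
      using LIM_zero_iff by blast
    have lim2: "(\<lambda>n. (LINT s:{0..1}|lborel. \<zeta> n s * g s)) \<longlonglongrightarrow> (LINT s:{a<..1}|lborel. g s)"
      unfolding set_lebesgue_integral_def
    proof (rule integral_dominated_convergence)
      have gm: "(\<lambda>s. indicat_real {0..1} s *\<^sub>R g s) \<in> borel_measurable lborel"
        using int unfolding set_integrable_def by auto
      have "set_integrable lborel {a<..1} g" by (rule set_integrable_subset[OF int]) (use 3 in auto)
      then show "(\<lambda>s. indicat_real {a<..1} s *\<^sub>R g s) \<in> borel_measurable lborel"
        unfolding set_integrable_def by auto
      show "integrable lborel (\<lambda>s. \<bar>indicat_real {0..1} s *\<^sub>R g s\<bar>)"
        using int unfolding set_integrable_def by (rule integrable_abs)
      have "continuous_on UNIV (\<zeta> n)" for n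
        using d\<zeta> by (meson DERIV_isCont continuous_at_imp_continuous_on)
      then have "\<zeta> n \<in> borel_measurable borel" for n
        by (rule borel_measurable_continuous_onI)
      then have "(\<lambda>s. \<zeta> n s * (indicat_real {0..1} s *\<^sub>R g s)) \<in> borel_measurable lborel" for n
        using gm by (intro borel_measurable_times) auto
      then show "(\<lambda>s. indicat_real {0..1} s *\<^sub>R (\<zeta> n s * g s)) \<in> borel_measurable lborel" for n
        by (simp add: mult.left_commute)
      show "AE s in lborel. norm (indicat_real {0..1} s *\<^sub>R (\<zeta> n s * g s)) \<le> \<bar>indicat_real {0..1} s *\<^sub>R g s\<bar>" for n
        using qbd by (intro AE_I2) (auto simp: \<zeta>_def abs_mult indicator_def intro!: mult_left_le_one_le)
      show "AE s in lborel. (\<lambda>n. indicat_real {0..1} s *\<^sub>R (\<zeta> n s * g s)) \<longlonglongrightarrow> indicat_real {a<..1} s *\<^sub>R g s"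
      proof (intro AE_I2)
        fix s :: real
        show "(\<lambda>n. indicat_real {0..1} s *\<^sub>R (\<zeta> n s * g s)) \<longlonglongrightarrow> indicat_real {a<..1} s *\<^sub>R g s"
        proof (cases "a < s")
          case False
          then have "\<zeta> n s = 0" for n
            using kpos(1)[of n] by (auto simp: \<zeta>_def intro!: q0 mult_nonneg_nonpos)
          then show ?thesis using False by simp
        next
          case True
          obtain N :: nat where N: "1 / (s - a) < N" using reals_Archimedean2 by blast
          have "\<zeta> n s = 1" if "n \<ge> N" for n
          proof -
            have "1 / (s - a) \<le> k n" using N that 3 unfolding k_def
              by (intro order_trans[OF less_imp_le[OF N]]) (auto intro: add_increasing2)
            then have "1 \<le> k n * (s - a)" using True by (simp add: field_simps)
            then show ?thesis by (simp add: \<zeta>_def q1)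
          qed
          then have "\<forall>\<^sub>F n in sequentially. indicat_real {0..1} s *\<^sub>R (\<zeta> n s * g s) = indicat_real {a<..1} s *\<^sub>R g s"
            unfolding eventually_sequentially using True 3 by (intro exI[of _ N]) (auto simp: indicator_def)
          then show ?thesis by (rule tendsto_eventually)
        qed
      qed
    qed
    have "(\<lambda>n. F 1) \<longlonglongrightarrow> F a + (LINT s:{a<..1}|lborel. g s)"
      using tendsto_add[OF lim1 lim2] weak[OF d\<zeta> \<zeta>'cont] by (simp add: ends)
    then have "F 1 = F a + (LINT s:{a<..1}|lborel. g s)" using LIMSEQ_unique tendsto_const by blast
    then show ?thesis by simp
  qed
qed

lemma weak_derivative_increment:
  fixes F g :: "real \<Rightarrow> real"
  assumes lip: "\<And>s t. s \<in> {0..1} \<Longrightarrow> t \<in> {0..1} \<Longrightarrow> \<bar>F s - F t\<bar> \<le> M * \<bar>s - t\<bar>"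
    and int: "set_integrable lborel {0..1} g"
    and weak: "\<And>\<zeta> \<zeta>'. (\<And>s. (\<zeta> has_real_derivative \<zeta>' s) (at s)) \<Longrightarrow> continuous_on UNIV \<zeta>' \<Longrightarrow>
      (LINT s:{0..1}|lborel. \<zeta>' s * F s) + (LINT s:{0..1}|lborel. \<zeta> s * g s) = \<zeta> 1 * F 1 - \<zeta> 0 * F 0"
    and ab: "0 \<le> a" "a \<le> b" "b \<le> 1"
  shows "F b - F a = (LINT s:{a<..b}|lborel. g s)"
proof -
  have "F 1 - F a = (LINT s:{a<..1}|lborel. g s)" "F 1 - F b = (LINT s:{b<..1}|lborel. g s)"
    using weak_derivative_increment_to_end[OF lip int weak] ab by auto
  moreover have "(LINT s:{a<..b} \<union> {b<..1}|lborel. g s) = (LINT s:{a<..b}|lborel. g s) + (LINT s:{b<..1}|lborel. g s)"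
    by (rule set_integral_Un) (use ab in \<open>auto intro!: set_integrable_subset[OF int]\<close>)
  moreover have "{a<..b} \<union> {b<..1} = {a<..1}" using ab by auto
  ultimately show ?thesis by simp
qed

section \<open>Transport maps and their cost along chains\<close>

lemma map_coupling:
  fixes \<mu> :: "'a::euclidean_space measure"
  assumes sets: "sets \<mu> = sets borel" and T: "T \<in> borel_measurable borel"
  shows "distr \<mu> borel (\<lambda>x. (x, T x)) \<in> couplings \<mu> (distr \<mu> borel T)"
    and "(\<integral>\<^sup>+z. ennreal ((norm (fst z - snd z))\<^sup>2) \<partial>distr \<mu> borel (\<lambda>x. (x, T x)))
      = (\<integral>\<^sup>+x. ennreal ((norm (T x - x))\<^sup>2) \<partial>\<mu>)"
proof -
  have [measurable]: "T \<in> borel_measurable \<mu>" using T measurable_cong_sets[OF sets refl] by blast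
  have [measurable]: "(\<lambda>x. x) \<in> borel_measurable \<mu>" using sets by (rule measurable_ident_sets)
  have [measurable]: "(\<lambda>x. (x, T x)) \<in> borel_measurable \<mu>" by simp
  show "distr \<mu> borel (\<lambda>x. (x, T x)) \<in> couplings \<mu> (distr \<mu> borel T)"
    unfolding couplings_def by (auto simp: distr_distr o_def borel_prod[symmetric] distr_id2[OF sets[symmetric]])
  show "(\<integral>\<^sup>+z. ennreal ((norm (fst z - snd z))\<^sup>2) \<partial>distr \<mu> borel (\<lambda>x. (x, T x)))
      = (\<integral>\<^sup>+x. ennreal ((norm (T x - x))\<^sup>2) \<partial>\<mu>)"
    by (subst nn_integral_distr) (auto simp: borel_prod[symmetric] norm_minus_commute)
qed

lemma W2_square_le_map:
  assumes "sets \<mu> = sets borel" "T \<in> borel_measurable borel"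
    and cost: "(\<integral>\<^sup>+x. ennreal ((norm (T x - x))\<^sup>2) \<partial>\<mu>) \<le> ennreal c" and c: "0 \<le> c"
  shows "(W2 \<mu> (distr \<mu> borel T))\<^sup>2 \<le> c"
proof -
  have "(INF \<pi>\<in>couplings \<mu> (distr \<mu> borel T). \<integral>\<^sup>+z. ennreal ((norm (fst z - snd z))\<^sup>2) \<partial>\<pi>)
      \<le> (\<integral>\<^sup>+z. ennreal ((norm (fst z - snd z))\<^sup>2) \<partial>distr \<mu> borel (\<lambda>x. (x, T x)))"
    by (rule INF_lower) (rule map_coupling[OF assms(1,2)])
  also note map_coupling(2)[OF assms(1,2)]
  also note cost
  finally have "enn2real (INF \<pi>\<in>couplings \<mu> (distr \<mu> borel T). \<integral>\<^sup>+z. ennreal ((norm (fst z - snd z))\<^sup>2) \<partial>\<pi>) \<le> c"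
    using c enn2real_leI by blast
  then show ?thesis unfolding W2_def by simp
qed

text \<open>Cauchy-Schwarz for a composition of \<open>k\<close> maps: the squared total
  displacement is at most \<open>k\<close> times the sum of the squared displacements. The cost
  \<open>c j\<close> is measured under \<open>\<rho> j\<close>, the law of the point reached so far,
  so it can be pulled back to \<open>\<rho> 0\<close>.\<close>

lemma chained_maps_cost:
  fixes \<rho> :: "nat \<Rightarrow> 'a::euclidean_space measure"
  assumes sets: "\<And>k. k \<le> n \<Longrightarrow> sets (\<rho> k) = sets borel" and c: "\<And>k. 0 \<le> c k"
    and step: "\<And>k. k < n \<Longrightarrow> \<exists>T\<in>borel_measurable borel. \<rho> (Suc k) = distr (\<rho> k) borel T \<and>
      (\<integral>\<^sup>+x. ennreal ((norm (T x - x))\<^sup>2) \<partial>\<rho> k) \<le> ennreal (c k)"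
    and k: "k \<le> n"
  shows "\<exists>T\<in>borel_measurable borel. \<rho> k = distr (\<rho> 0) borel T \<and>
      (\<integral>\<^sup>+x. ennreal ((norm (T x - x))\<^sup>2) \<partial>\<rho> 0) \<le> ennreal (real k * (\<Sum>j<k. c j))"
  using k
proof (induction k)
  case 0
  have "\<rho> 0 = distr (\<rho> 0) borel (\<lambda>x. x)" using sets[of 0] by (simp add: distr_id2)
  then show ?case by (intro bexI[of _ "\<lambda>x. x"]) auto
next
  case (Suc k)
  then obtain S where [measurable]: "S \<in> borel_measurable borel" and S: "\<rho> k = distr (\<rho> 0) borel S"
    and Scost: "(\<integral>\<^sup>+x. ennreal ((norm (S x - x))\<^sup>2) \<partial>\<rho> 0) \<le> ennreal (real k * (\<Sum>j<k. c j))" by auto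
  have "k < n" using Suc.prems by simp
  from step[OF this] obtain T where [measurable]: "T \<in> borel_measurable borel" and T: "\<rho> (Suc k) = distr (\<rho> k) borel T"
    and Tcost: "(\<integral>\<^sup>+x. ennreal ((norm (T x - x))\<^sup>2) \<partial>\<rho> k) \<le> ennreal (c k)" by blast
  have [measurable_cong]: "sets (\<rho> 0) = sets borel" using sets by simp
  have eq: "\<rho> (Suc k) = distr (\<rho> 0) borel (\<lambda>x. T (S x))"
    unfolding T S by (subst distr_distr) (auto simp: o_def)
  have TS: "(\<integral>\<^sup>+x. ennreal ((norm (T (S x) - S x))\<^sup>2) \<partial>\<rho> 0) \<le> ennreal (c k)"
    using Tcost unfolding S by (subst (asm) nn_integral_distr) auto
  have sum: "0 \<le> (\<Sum>j<k. c j)" using c by (intro sum_nonneg) auto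
  have "(\<integral>\<^sup>+x. ennreal ((norm (T (S x) - x))\<^sup>2) \<partial>\<rho> 0) \<le> ennreal (real (Suc k) * (\<Sum>j<Suc k. c j))"
  \<comment> \<open>The weight \<open>1 / k\<close> of the splitting used below degenerates for
    \<open>k = 0\<close>. There the accumulated cost is 0, so \<open>S\<close> is the identity
    almost everywhere.\<close>
  proof (cases "k = 0")
    case True
    then have "(\<integral>\<^sup>+x. ennreal ((norm (S x - x))\<^sup>2) \<partial>\<rho> 0) = 0" using Scost by simp
    then have "AE x in \<rho> 0. ennreal ((norm (S x - x))\<^sup>2) = 0"
      by (subst (asm) nn_integral_0_iff_AE) auto
    then have "AE x in \<rho> 0. S x = x" by eventually_elim (simp add: ennreal_eq_0_iff)
    then have "AE x in \<rho> 0. ennreal ((norm (T (S x) - x))\<^sup>2) = ennreal ((norm (T (S x) - S x))\<^sup>2)"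
      by eventually_elim simp
    then have "(\<integral>\<^sup>+x. ennreal ((norm (T (S x) - x))\<^sup>2) \<partial>\<rho> 0) = (\<integral>\<^sup>+x. ennreal ((norm (T (S x) - S x))\<^sup>2) \<partial>\<rho> 0)"
      by (rule nn_integral_cong_AE)
    then show ?thesis using TS True by simp
  next
    case False
    \<comment> \<open>The weights satisfy \<open>(1 + 1 / k) * k = k + 1\<close>: the new cost and
      the accumulated ones then carry the same factor \<open>Suc k\<close>, and the induction
      closes.\<close>
    have sq: "(a + b)\<^sup>2 \<le> real (Suc k) * a\<^sup>2 + (1 + 1 / real k) * b\<^sup>2" for a b :: real
    proof -
      have "0 \<le> (real k * a - b)\<^sup>2 / real k" by simp
      also have "\<dots> = real (Suc k) * a\<^sup>2 + (1 + 1 / real k) * b\<^sup>2 - (a + b)\<^sup>2"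
        using False by (simp add: field_simps power2_eq_square)
      finally show ?thesis by simp
    qed
    have "(norm (T (S x) - x))\<^sup>2 \<le> real (Suc k) * (norm (T (S x) - S x))\<^sup>2 + (1 + 1 / real k) * (norm (S x - x))\<^sup>2" for x
    proof -
      have "norm (T (S x) - x) \<le> norm (T (S x) - S x) + norm (S x - x)"
        using norm_triangle_ineq[of "T (S x) - S x" "S x - x"] by simp
      then have "(norm (T (S x) - x))\<^sup>2 \<le> (norm (T (S x) - S x) + norm (S x - x))\<^sup>2" by (intro power_mono) auto
      then show ?thesis using sq order_trans by blast
    qed
    then have "(\<integral>\<^sup>+x. ennreal ((norm (T (S x) - x))\<^sup>2) \<partial>\<rho> 0)
        \<le> (\<integral>\<^sup>+x. ennreal (real (Suc k)) * ennreal ((norm (T (S x) - S x))\<^sup>2)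
              + ennreal (1 + 1 / real k) * ennreal ((norm (S x - x))\<^sup>2) \<partial>\<rho> 0)"
      by (intro nn_integral_mono) (simp add: ennreal_leI flip: ennreal_mult ennreal_plus del: of_nat_Suc)
    also have "\<dots> = ennreal (real (Suc k)) * (\<integral>\<^sup>+x. ennreal ((norm (T (S x) - S x))\<^sup>2) \<partial>\<rho> 0)
        + ennreal (1 + 1 / real k) * (\<integral>\<^sup>+x. ennreal ((norm (S x - x))\<^sup>2) \<partial>\<rho> 0)"
      by (simp add: nn_integral_add nn_integral_cmult del: of_nat_Suc)
    also have "\<dots> \<le> ennreal (real (Suc k)) * ennreal (c k)
        + ennreal (1 + 1 / real k) * ennreal (real k * (\<Sum>j<k. c j))"
      by (intro add_mono mult_left_mono TS Scost) auto
    also have "\<dots> = ennreal (real (Suc k) * c k + (1 + 1 / real k) * (real k * (\<Sum>j<k. c j)))"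
      using c sum by (simp add: ennreal_mult ennreal_plus del: of_nat_Suc)
    also have "real (Suc k) * c k + (1 + 1 / real k) * (real k * (\<Sum>j<k. c j)) = real (Suc k) * (\<Sum>j<Suc k. c j)"
      using False by (simp add: field_simps)
    finally show ?thesis .
  qed
  then show ?case using eq by (intro bexI[of _ "\<lambda>x. T (S x)"]) auto
qed

text \<open>Closed sets are stable under intersection and generate the Borel sets, and the indicator
  of a nonempty closed set is a limit of Lipschitz functions of the distance to it. So only
  Lipschitz integrands have to be checked, for which transport maps give estimates.\<close>

lemma measurable_subprob_algebra_lipschitz:
  fixes \<kappa> :: "real \<Rightarrow> 'a::euclidean_space measure"
  assumes prob: "\<And>t. prob_space (\<kappa> t)" and sets: "\<And>t. sets (\<kappa> t) = sets borel"
    and int: "\<And>g :: 'a \<Rightarrow> real. \<And>M. 0 \<le> M \<Longrightarrow> (\<And>x y. \<bar>g x - g y\<bar> \<le> M * norm (x - y)) \<Longrightarrow>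
      (\<lambda>t. integral\<^sup>L (\<kappa> t) g) \<in> borel_measurable borel"
  shows "\<kappa> \<in> borel \<rightarrow>\<^sub>M subprob_algebra borel"
proof (rule measurable_subprob_algebra_generated)
  show "sets borel = sigma_sets UNIV (Collect closed :: 'a set set)"
    by (subst borel_eq_closed) simp
  show "Int_stable (Collect closed :: 'a set set)" by (auto simp: Int_stable_def)
  show "subprob_space (\<kappa> t)" for t using prob prob_space_imp_subprob_space by blast
  show "sets (\<kappa> t) = sets borel" for t by (rule sets)
  have "space (\<kappa> t) = UNIV" for t using sets_eq_imp_space_eq[OF sets] by simp
  then show "(\<lambda>t. emeasure (\<kappa> t) UNIV) \<in> borel_measurable borel"
    using prob_space.emeasure_space_1[OF prob] by simp
  fix A :: "'a set" assume "A \<in> Collect closed"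
  then have A: "closed A" by simp
  show "(\<lambda>t. emeasure (\<kappa> t) A) \<in> borel_measurable borel"
  \<comment> \<open>\<open>infdist x {}\<close> is 0 by convention, so for the empty set the
    functions \<open>g k\<close> below would be constantly 1 instead of tending to 0.\<close>
  proof (cases "A = {}")
    case True then show ?thesis by simp
  next
    case False
    define g where "g k x = max 0 (1 - real k * infdist x A)" for k x
    have [measurable]: "g k \<in> borel_measurable borel" for k
      unfolding g_def by (intro borel_measurable_continuous_onI continuous_intros)
    have lim: "(\<lambda>k. integral\<^sup>L (\<kappa> t) (g k)) \<longlonglongrightarrow> measure (\<kappa> t) A" for t
    proof -
      interpret prob_space "\<kappa> t" by (rule prob)
      note [measurable_cong] = sets[of t]
      have "(\<lambda>k. integral\<^sup>L (\<kappa> t) (g k)) \<longlonglongrightarrow> integral\<^sup>L (\<kappa> t) (indicator A)"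
      proof (rule integral_dominated_convergence[where w = "\<lambda>_. 1"])
        show "(indicator A :: 'a \<Rightarrow> real) \<in> borel_measurable (\<kappa> t)"
          by (rule borel_measurable_indicator) (use A sets in auto)
        show "AE x in \<kappa> t. norm (g k x) \<le> 1" for k
          by (intro AE_I2) (auto simp: g_def infdist_nonneg)
        show "AE x in \<kappa> t. (\<lambda>k. g k x) \<longlonglongrightarrow> indicator A x"
        proof (intro AE_I2)
          fix x
          show "(\<lambda>k. g k x) \<longlonglongrightarrow> indicator A x"
          proof (cases "x \<in> A")
            case True then show ?thesis by (simp add: g_def)
          next
            case xA: False
            then have pos: "0 < infdist x A" using A False infdist_pos_not_in_closed by blast
            obtain N :: nat where N: "1 / infdist x A < real N" using reals_Archimedean2 by blast
            have "g k x = indicator A x" if "k \<ge> N" for k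
            proof -
              have "1 / infdist x A \<le> real k" using N that by simp
              then have "1 \<le> real k * infdist x A" using pos by (simp add: field_simps)
              then show ?thesis using xA by (simp add: g_def)
            qed
            then show ?thesis by (intro tendsto_eventually) (auto simp: eventually_sequentially)
          qed
        qed
      qed auto
      then show ?thesis using A by simp
    qed
    have "(\<lambda>t. integral\<^sup>L (\<kappa> t) (g k)) \<in> borel_measurable borel" for k
    proof (rule int[of "real k"])
      fix x y
      have "\<bar>infdist x A - infdist y A\<bar> \<le> norm (x - y)"
        using infdist_triangle_abs[of x A y] by (simp add: dist_norm)
      then have "real k * \<bar>infdist x A - infdist y A\<bar> \<le> real k * norm (x - y)" by (intro mult_left_mono) auto
      moreover have "\<bar>g k x - g k y\<bar> \<le> \<bar>real k * infdist x A - real k * infdist y A\<bar>" by (auto simp: g_def)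
      ultimately show "\<bar>g k x - g k y\<bar> \<le> real k * norm (x - y)"
        by (simp add: abs_mult flip: right_diff_distrib)
    qed simp
    then have "(\<lambda>t. measure (\<kappa> t) A) \<in> borel_measurable borel"
      by (rule borel_measurable_LIMSEQ_real[OF lim])
    then have "(\<lambda>t. ennreal (measure (\<kappa> t) A)) \<in> borel_measurable borel" by measurable
    moreover have "ennreal (measure (\<kappa> t) A) = emeasure (\<kappa> t) A" for t
    proof -
      interpret prob_space "\<kappa> t" by (rule prob)
      show ?thesis by (rule emeasure_eq_measure[symmetric])
    qed
    ultimately show ?thesis by simp
  qed
qed auto

text \<open>An integrand that varies with the parameter becomes a fixed function of the pair
  \<open>(x, y)\<close> once \<open>L x\<close> is pushed forward by
  \<open>y \<mapsto> (x, y)\<close>. It serves for the measurability in time of the action and of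
  the weak derivative.\<close>

lemma integral_measurable_subprob_algebra2:
  fixes f :: "'a \<Rightarrow> 'b \<Rightarrow> 'c::{banach, second_countable_topology}"
  assumes f[measurable]: "(\<lambda>(x, y). f x y) \<in> borel_measurable (M \<Otimes>\<^sub>M N)"
    and L[measurable]: "L \<in> measurable M (subprob_algebra N)"
  shows "(\<lambda>x. integral\<^sup>L (L x) (f x)) \<in> borel_measurable M"
proof -
  have "(\<lambda>x. distr (L x) (M \<Otimes>\<^sub>M N) (\<lambda>y. (x, y))) \<in> M \<rightarrow>\<^sub>M subprob_algebra (M \<Otimes>\<^sub>M N)"
    by (rule measurable_distr2[OF _ L]) simp
  from measurable_compose[OF this integral_measurable_subprob_algebra[OF f]]
  have "(\<lambda>x. integral\<^sup>L (distr (L x) (M \<Otimes>\<^sub>M N) (\<lambda>y. (x, y))) (\<lambda>(x, y). f x y)) \<in> borel_measurable M" .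
  then show ?thesis
    by (rule measurable_cong[THEN iffD1, rotated])
      (simp add: integral_distr measurable_compose[OF _ f] sets_kernel[OF L] cong: measurable_cong_sets)
qed

lemma esqrt_le:
  assumes "x \<le> ennreal (c\<^sup>2)" "0 \<le> c"
  shows "esqrt x \<le> ereal c"
proof -
  have "x \<noteq> \<infinity>" using assms by (auto simp: top_unique)
  moreover have "enn2real x \<le> c\<^sup>2" by (rule enn2real_leI) (use assms in auto)
  then have "sqrt (enn2real x) \<le> c" using assms(2) real_le_lsqrt by (simp add: real_sqrt_le_iff real_le_lsqrt)
  ultimately show ?thesis by (simp add: esqrt_def)
qed

lemma le_esqrt:
  assumes "ennreal (c\<^sup>2) \<le> x"
  shows "ereal c \<le> esqrt x"
proof (cases "x = \<infinity>")
  case False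
  then have "c\<^sup>2 \<le> enn2real x" using enn2real_mono[OF assms] by (simp add: top.not_eq_extremum)
  then have "c \<le> sqrt (enn2real x)" by (rule real_le_rsqrt)
  then show ?thesis using False by (simp add: esqrt_def)
qed (simp add: esqrt_def)

section \<open>Measures joined by transport flows\<close>

text \<open>
  The field \<open>v\<close> is not required to be Lipschitz in space: \<open>D\<close> need not be invariant under the geodesic
  flow, so the \<open>C\<^sup>1\<close> bound on \<open>B\<close> only covers time \<open>0\<close>, that is \<open>f\<close>. Hence trajectories come from Peano's theorem.
\<close>

definition transport_flow ::
    "'a::euclidean_space set \<Rightarrow> 'm set \<Rightarrow> ('m \<Rightarrow> 'm \<Rightarrow> real) \<Rightarrow> ('m \<Rightarrow> 'a measure) \<Rightarrow> real \<Rightarrow> 'm \<Rightarrow> 'm \<Rightarrow>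
     (real \<Rightarrow> 'm) \<Rightarrow> (real \<Rightarrow> 'a \<Rightarrow> 'a) \<Rightarrow> (real \<Rightarrow> 'a \<Rightarrow> 'a) \<Rightarrow> ('a \<Rightarrow> 'a) \<Rightarrow> ('a \<Rightarrow> real) \<Rightarrow> bool" where
  "transport_flow \<Omega> S d E C \<theta> \<theta>' \<gamma> v X f \<psi> \<longleftrightarrow>
     \<gamma> 0 = \<theta> \<and> \<gamma> 1 = \<theta>' \<and> \<gamma> ` {0..1} \<subseteq> S \<and>
     (\<forall>s\<in>{0..1}. \<forall>t\<in>{0..1}. d (\<gamma> s) (\<gamma> t) = \<bar>s - t\<bar> * d \<theta> \<theta>') \<and>
     continuous_on UNIV (\<lambda>(t, x). v t x) \<and>
     (\<forall>t\<in>{0..1}. \<forall>x. norm (v t x - f x) \<le> C * (d \<theta> \<theta>')\<^sup>2) \<and>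
     (\<forall>x. norm (f x) \<le> C * d \<theta> \<theta>') \<and>
     (\<forall>x y. norm (f x - f y) \<le> C * d \<theta> \<theta>' * norm (x - y)) \<and>
     (\<forall>x. GDERIV \<psi> x :> f x) \<and>
     (\<forall>x. X 0 x = x \<and> continuous_on {0..1} (\<lambda>t. X t x)) \<and>
     (\<forall>x\<in>\<Omega>. \<forall>t\<in>{0..1}. ((\<lambda>s. X s x) has_vector_derivative v t (X t x)) (at t within {0..1})) \<and>
     (\<forall>t\<in>{0..1}. X t \<in> borel_measurable borel \<and> E (\<gamma> t) = distr (E \<theta>) borel (X t))"

lemma transport_flow_end:
  assumes "transport_flow \<Omega> S d E C \<theta> \<theta>' \<gamma> v X f \<psi>"
  shows "X 1 \<in> borel_measurable borel" "E \<theta>' = distr (E \<theta>) borel (X 1)"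
proof -
  have "1 \<in> {0..1::real}" by simp
  then have "X 1 \<in> borel_measurable borel \<and> E (\<gamma> 1) = distr (E \<theta>) borel (X 1)" "\<gamma> 1 = \<theta>'"
    using assms unfolding transport_flow_def by blast+
  then show "X 1 \<in> borel_measurable borel" "E \<theta>' = distr (E \<theta>) borel (X 1)" by metis+
qed

text \<open>The manifold reduced to what both bounds use: a function \<open>d\<close> comparable
  with \<open>W2\<close> in both directions, and flows between any two points of \<open>S\<close>
  whose errors are controlled by powers of \<open>d\<close>.\<close>

locale transport_family =
  fixes \<Omega> :: "'a::euclidean_space set" and S :: "'m set" and d :: "'m \<Rightarrow> 'm \<Rightarrow> real"
    and E :: "'m \<Rightarrow> 'a measure" and C L :: real
  assumes compact_support: "compact \<Omega>"
    and probs: "\<theta> \<in> S \<Longrightarrow> E \<theta> \<in> probs_on \<Omega>"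
    and C_nonneg: "0 \<le> C" and L_nonneg: "0 \<le> L"
    and d_nonneg: "0 \<le> d \<theta> \<theta>'"
    and d_le_LW2: "\<theta> \<in> S \<Longrightarrow> \<theta>' \<in> S \<Longrightarrow> d \<theta> \<theta>' \<le> L * W2 (E \<theta>) (E \<theta>')"
    and W2_le_Ld: "\<theta> \<in> S \<Longrightarrow> \<theta>' \<in> S \<Longrightarrow> W2 (E \<theta>) (E \<theta>') \<le> L * d \<theta> \<theta>'"
    and flow_exists: "\<theta> \<in> S \<Longrightarrow> \<theta>' \<in> S \<Longrightarrow>
      \<exists>\<gamma> v X f \<psi>. transport_flow \<Omega> S d E C \<theta> \<theta>' \<gamma> v X f \<psi>"
begin

lemma closed_support: "closed \<Omega>" using compact_support compact_imp_closed by blast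

lemma support_borel [measurable]: "\<Omega> \<in> sets borel" using closed_support by simp

lemma sets_E: "\<theta> \<in> S \<Longrightarrow> sets (E \<theta>) = sets borel" using probs unfolding probs_on_def by blast

lemma prob_E: "\<theta> \<in> S \<Longrightarrow> prob_space (E \<theta>)" using probs unfolding probs_on_def by blast

lemma AE_support: "\<theta> \<in> S \<Longrightarrow> AE x in E \<theta>. x \<in> \<Omega>"
proof -
  assume \<theta>: "\<theta> \<in> S"
  interpret prob_space "E \<theta>" by (rule prob_E[OF \<theta>])
  have "emeasure (E \<theta>) \<Omega> = 1" using probs[OF \<theta>] unfolding probs_on_def by blast
  then show ?thesis using sets_E[OF \<theta>] by (intro AE_in_set_eq_1[THEN iffD2]) (auto simp: measure_def)
qed

lemma measurable_E: "\<theta> \<in> S \<Longrightarrow> g \<in> borel_measurable borel \<Longrightarrow> g \<in> borel_measurable (E \<theta>)"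
  using measurable_cong_sets[OF sets_E refl] by blast

lemma AE_map_support:
  assumes "\<theta> \<in> S" "\<theta>' \<in> S" "E \<theta>' = distr (E \<theta>) borel T" "T \<in> borel_measurable borel"
  shows "AE x in E \<theta>. T x \<in> \<Omega>"
proof -
  have "AE y in distr (E \<theta>) borel T. y \<in> \<Omega>"
    by (subst assms(3)[symmetric]) (rule AE_support[OF assms(2)])
  then show ?thesis by (subst (asm) AE_distr_iff) (use measurable_E assms in auto)
qed

lemma integrable_E:
  fixes g :: "'a \<Rightarrow> 'b::{banach, second_countable_topology}"
  assumes "\<theta> \<in> S" "g \<in> borel_measurable borel" "\<And>x. x \<in> \<Omega> \<Longrightarrow> norm (g x) \<le> B"
  shows "integrable (E \<theta>) g"
proof -
  interpret prob_space "E \<theta>" by (rule prob_E[OF assms(1)])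
  show ?thesis
    by (rule integrable_const_bound[where B = B])
      (use AE_support[OF assms(1)] assms measurable_E in \<open>auto elim!: eventually_mono\<close>)
qed

lemma integral_distr_E:
  fixes g :: "'a \<Rightarrow> 'b::{banach, second_countable_topology}"
  assumes "\<theta> \<in> S" "E \<theta>' = distr (E \<theta>) borel T" "T \<in> borel_measurable borel" "g \<in> borel_measurable borel"
  shows "(\<integral>x. g x \<partial>E \<theta>') = (\<integral>x. g (T x) \<partial>E \<theta>)"
  unfolding assms(2) by (rule integral_distr) (use assms measurable_E in auto)

definition R :: real where "R = diameter \<Omega>"

lemma R: "x \<in> \<Omega> \<Longrightarrow> y \<in> \<Omega> \<Longrightarrow> norm (x - y) \<le> R" "0 \<le> R"
  using diameter_bounded_bound[of \<Omega> x y] compact_imp_bounded[OF compact_support] diameter_ge_0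
  by (auto simp: R_def dist_norm)

text \<open>Almost no mass leaves \<Omega>, so none travels farther than the diameter. The bound
  trades a surplus factor \<epsilon> for a constant wherever an error is one order higher than the
  leading one.\<close>

lemma d_le_LR:
  assumes "\<theta> \<in> S" "\<theta>' \<in> S"
  shows "d \<theta> \<theta>' \<le> L * R"
proof -
  obtain \<gamma> v X f \<psi> where "transport_flow \<Omega> S d E C \<theta> \<theta>' \<gamma> v X f \<psi>" using flow_exists[OF assms] by blast
  note X = transport_flow_end[OF this]
  interpret prob_space "E \<theta>" by (rule prob_E[OF assms(1)])
  have "AE x in E \<theta>. ennreal ((norm (X 1 x - x))\<^sup>2) \<le> ennreal (R\<^sup>2)"
    using AE_support[OF assms(1)] AE_map_support[OF assms X(2,1)]
    by eventually_elim (intro ennreal_leI power_mono R, auto)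
  then have "(\<integral>\<^sup>+x. ennreal ((norm (X 1 x - x))\<^sup>2) \<partial>E \<theta>) \<le> (\<integral>\<^sup>+x. ennreal (R\<^sup>2) \<partial>E \<theta>)"
    by (rule nn_integral_mono_AE)
  also have "\<dots> = ennreal (R\<^sup>2)" by (simp add: emeasure_space_1)
  finally have "(W2 (E \<theta>) (E \<theta>'))\<^sup>2 \<le> R\<^sup>2"
    unfolding X(2) by (intro W2_square_le_map sets_E assms X) auto
  then have "W2 (E \<theta>) (E \<theta>') \<le> R" using R(2) by (rule power2_le_imp_le)
  then show ?thesis using d_le_LW2[OF assms] L_nonneg mult_left_mono order_trans by blast
qed

text \<open>The last two summands are the constants for \<open>\<bar>v\<bar> \<le> C (1 + L R) \<epsilon>\<close> and \<open>\<bar>v(t, X\<^sub>t x) - f x\<bar> = O(\<epsilon>\<^sup>2)\<close>.\<close>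

definition K :: real where
  "K = 1 + C + L + L * R + C * (1 + L * R) + (C + C * (C * (1 + L * R)))"

lemma K_ge: "1 \<le> K" "C \<le> K" "L \<le> K" "L * R \<le> K" "C * (1 + L * R) \<le> K" "C + C * (C * (1 + L * R)) \<le> K"
proof -
  have "0 \<le> L * R" "0 \<le> C * (1 + L * R)" "0 \<le> C * (C * (1 + L * R))" using C_nonneg L_nonneg R(2) by auto
  then show "1 \<le> K" "C \<le> K" "L \<le> K" "L * R \<le> K" "C * (1 + L * R) \<le> K" "C + C * (C * (1 + L * R)) \<le> K"
    using C_nonneg L_nonneg unfolding K_def by linarith+
qed

lemma d_le_K: "\<theta> \<in> S \<Longrightarrow> \<theta>' \<in> S \<Longrightarrow> d \<theta> \<theta>' \<le> K"
  using d_le_LR K_ge(4) order_trans by blast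

text \<open>What remains of a flow at time 1. The lower bound sees nothing else: a step of an
  arbitrary curve of measures is compared with the flow between its end points, not with the flow of
  the curve itself.\<close>

definition transport_map :: "'m \<Rightarrow> 'm \<Rightarrow> ('a \<Rightarrow> 'a) \<Rightarrow> ('a \<Rightarrow> 'a) \<Rightarrow> ('a \<Rightarrow> real) \<Rightarrow> bool" where
  "transport_map \<theta> \<theta>' T f \<psi> \<longleftrightarrow> T \<in> borel_measurable borel \<and> E \<theta>' = distr (E \<theta>) borel T \<and>
     (\<forall>x\<in>\<Omega>. norm (T x - x) \<le> K * d \<theta> \<theta>') \<and>
     (\<forall>x\<in>\<Omega>. norm (T x - x - f x) \<le> K * (d \<theta> \<theta>')\<^sup>2) \<and>
     (\<forall>x. norm (f x) \<le> K * d \<theta> \<theta>') \<and>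
     (\<forall>x y. norm (f x - f y) \<le> K * d \<theta> \<theta>' * norm (x - y)) \<and>
     (\<forall>x. GDERIV \<psi> x :> f x)"

text \<open>A field value at a moved point is first replaced by \<open>f\<close> at that point, at
  cost O(\<epsilon>^2), and then \<open>f\<close> is moved back by its own Lipschitz bound, since
  \<open>v\<close> carries no modulus of continuity in space.\<close>

lemma flow_estimates:
  assumes \<theta>: "\<theta> \<in> S" "\<theta>' \<in> S" and flow: "transport_flow \<Omega> S d E C \<theta> \<theta>' \<gamma> v X f \<psi>"
  shows "transport_map \<theta> \<theta>' (X 1) f \<psi>"
    and "t \<in> {0..1} \<Longrightarrow> norm (v t x) \<le> K * d \<theta> \<theta>'"
    and "x \<in> \<Omega> \<Longrightarrow> t \<in> {0..1} \<Longrightarrow> norm (v t (X t x) - f x) \<le> K * (d \<theta> \<theta>')\<^sup>2"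
proof -
  define \<epsilon> where "\<epsilon> = d \<theta> \<theta>'"
  have \<epsilon>: "0 \<le> \<epsilon>" "\<epsilon> \<le> L * R" using d_nonneg d_le_LR[OF \<theta>] by (auto simp: \<epsilon>_def)
  note flow = flow[unfolded transport_flow_def, folded \<epsilon>_def]
  have vf: "norm (v t x - f x) \<le> C * \<epsilon>\<^sup>2" if "t \<in> {0..1}" for t x using flow that by blast
  have f: "norm (f x) \<le> C * \<epsilon>" "norm (f x - f y) \<le> C * \<epsilon> * norm (x - y)" for x y using flow by blast+
  define c1 where "c1 = C * (1 + L * R)"
  have c1: "0 \<le> c1" using C_nonneg L_nonneg R(2) by (simp add: c1_def)
  have v1: "norm (v t x) \<le> c1 * \<epsilon>" if "t \<in> {0..1}" for t x
  proof -
    have "norm (v t x) \<le> C * \<epsilon> + C * \<epsilon>\<^sup>2" using vf[OF that, of x] f(1)[of x] norm_triangle_sub[of "v t x" "f x"] by linarith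
    also have "\<dots> = C * \<epsilon> * (1 + \<epsilon>)" by (simp add: algebra_simps power2_eq_square)
    also have "\<dots> \<le> C * \<epsilon> * (1 + L * R)" using \<epsilon> C_nonneg by (intro mult_left_mono) auto
    finally show ?thesis by (simp add: c1_def mult_ac)
  qed
  have X0: "X 0 x = x" for x using flow by blast
  have dX: "((\<lambda>s. X s x) has_vector_derivative v t (X t x)) (at t within {0..1})" if "x \<in> \<Omega>" "t \<in> {0..1}" for x t
    using flow that by blast
  have Xx: "norm (X t x - x) \<le> c1 * \<epsilon>" if x: "x \<in> \<Omega>" and t: "t \<in> {0..1}" for x t
  proof -
    have "norm (X t x - X 0 x) \<le> c1 * \<epsilon> * norm (t - 0)"
    proof (rule differentiable_bound[of "{0..1}" _ "\<lambda>t h. h *\<^sub>R v t (X t x)"])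
      show "((\<lambda>s. X s x) has_derivative (\<lambda>h. h *\<^sub>R v t (X t x))) (at t within {0..1})" if "t \<in> {0..1}" for t
        using dX[OF x that] by (simp add: has_vector_derivative_def)
      show "onorm (\<lambda>h. h *\<^sub>R v t (X t x)) \<le> c1 * \<epsilon>" if "t \<in> {0..1}" for t
        using v1[OF that, of "X t x"] by (intro onorm_le) (simp add: mult.commute mult_left_mono)
    qed (use t in auto)
    also have "\<dots> \<le> c1 * \<epsilon> * 1" using t c1 \<epsilon> by (intro mult_left_mono) auto
    finally show ?thesis by (simp add: X0)
  qed
  define c2 where "c2 = C + C * c1"
  have vX: "norm (v t (X t x) - f x) \<le> c2 * \<epsilon>\<^sup>2" if "x \<in> \<Omega>" "t \<in> {0..1}" for x t
  proof -
    have "norm (v t (X t x) - f x) \<le> norm (v t (X t x) - f (X t x)) + norm (f (X t x) - f x)"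
      using norm_triangle_ineq[of "v t (X t x) - f (X t x)" "f (X t x) - f x"] by simp
    also have "\<dots> \<le> C * \<epsilon>\<^sup>2 + C * \<epsilon> * norm (X t x - x)" using vf f that by (intro add_mono) auto
    also have "\<dots> \<le> C * \<epsilon>\<^sup>2 + C * \<epsilon> * (c1 * \<epsilon>)"
      using Xx that C_nonneg \<epsilon> by (intro add_mono mult_left_mono) auto
    finally show ?thesis by (simp add: c2_def algebra_simps power2_eq_square)
  qed
  have Xf: "norm (X 1 x - x - f x) \<le> c2 * \<epsilon>\<^sup>2" if x: "x \<in> \<Omega>" for x
  proof -
    \<comment> \<open>Subtracting the straight motion \<open>t *\<^sub>R f x\<close> turns the
      velocity into \<open>v - f\<close>, so the mean value inequality bounds the error of the
      displacement directly.\<close>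
    have "norm ((X 1 x - 1 *\<^sub>R f x) - (X 0 x - 0 *\<^sub>R f x)) \<le> c2 * \<epsilon>\<^sup>2 * norm (1 - 0 :: real)"
    proof (rule differentiable_bound[of "{0..1}" "\<lambda>t. X t x - t *\<^sub>R f x" "\<lambda>t h. h *\<^sub>R (v t (X t x) - f x)"])
      show "((\<lambda>t. X t x - t *\<^sub>R f x) has_derivative (\<lambda>h. h *\<^sub>R (v t (X t x) - f x))) (at t within {0..1})"
        if "t \<in> {0..1}" for t
        using has_vector_derivative_diff[OF dX[OF x that] has_vector_derivative_scaleR[OF DERIV_ident has_vector_derivative_const]]
        by (simp add: has_vector_derivative_def)
      show "onorm (\<lambda>h. h *\<^sub>R (v t (X t x) - f x)) \<le> c2 * \<epsilon>\<^sup>2" if "t \<in> {0..1}" for t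
        using vX[OF x that] by (intro onorm_le) (simp add: mult.commute mult_left_mono)
    qed auto
    then show ?thesis by (simp add: X0 algebra_simps)
  qed
  have le: "C * \<epsilon> \<le> K * \<epsilon>" "c1 * \<epsilon> \<le> K * \<epsilon>" "c2 * \<epsilon>\<^sup>2 \<le> K * \<epsilon>\<^sup>2"
    using K_ge(2,5,6) \<epsilon> unfolding c1_def c2_def by (auto intro!: mult_right_mono)
  show "t \<in> {0..1} \<Longrightarrow> norm (v t x) \<le> K * d \<theta> \<theta>'" using v1 le \<epsilon>_def order_trans by metis
  show "x \<in> \<Omega> \<Longrightarrow> t \<in> {0..1} \<Longrightarrow> norm (v t (X t x) - f x) \<le> K * (d \<theta> \<theta>')\<^sup>2"
    using vX le \<epsilon>_def order_trans by metis
  show "transport_map \<theta> \<theta>' (X 1) f \<psi>"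
    unfolding transport_map_def \<epsilon>_def[symmetric]
  proof (intro conjI ballI allI)
    show "norm (f x - f y) \<le> K * \<epsilon> * norm (x - y)" for x y
      using f(2)[of x y] mult_right_mono[OF le(1) norm_ge_zero] order_trans by blast
    show "norm (X 1 x - x) \<le> K * \<epsilon>" if "x \<in> \<Omega>" for x using Xx[OF that, of 1] le by simp
    show "norm (X 1 x - x - f x) \<le> K * \<epsilon>\<^sup>2" if "x \<in> \<Omega>" for x using Xf[OF that] le by simp
    show "norm (f x) \<le> K * \<epsilon>" for x using f(1)[of x] le by simp
    show "GDERIV \<psi> x :> f x" for x using flow by blast
  qed (use transport_flow_end[OF assms(3)] in blast)+
qed

lemma transport_map_exists: "\<theta> \<in> S \<Longrightarrow> \<theta>' \<in> S \<Longrightarrow> \<exists>T f \<psi>. transport_map \<theta> \<theta>' T f \<psi>"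
  using flow_exists flow_estimates(1) by blast

lemma gradient_measurable:
  fixes \<psi> :: "'a \<Rightarrow> real" and f :: "'a \<Rightarrow> 'a"
  assumes "\<And>x. GDERIV \<psi> x :> f x" "\<And>x y. norm (f x - f y) \<le> M * norm (x - y)"
  shows "continuous_on UNIV f" "f \<in> borel_measurable borel" "\<psi> \<in> borel_measurable borel"
proof -
  have "(max M 0)-lipschitz_on UNIV f"
  proof (rule lipschitz_onI)
    fix x y
    have "norm (f x - f y) \<le> M * norm (x - y)" by (rule assms)
    also have "\<dots> \<le> max M 0 * norm (x - y)" by (intro mult_right_mono) auto
    finally show "dist (f x) (f y) \<le> max M 0 * dist x y" by (simp add: dist_norm)
  qed simp
  then show "continuous_on UNIV f" by (rule lipschitz_on_continuous_on)
  then show "f \<in> borel_measurable borel" by (rule borel_measurable_continuous_onI)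
  have "isCont \<psi> x" for x using assms(1)[of x] unfolding gderiv_def by (rule has_derivative_continuous)
  then show "\<psi> \<in> borel_measurable borel"
    by (intro borel_measurable_continuous_onI continuous_at_imp_continuous_on) auto
qed

text \<open>\<open>T\<close> moves points of \<Omega> by at most
  \<open>K * d \<theta> \<theta>'\<close>, which bounds the increment without an optimal coupling.
  It is applied to cutoffs of distance functions, to \<open>\<psi>\<close> and to the squared norm
  of \<open>f\<close>.\<close>

lemma integral_lipschitz:
  fixes g :: "'a \<Rightarrow> real"
  assumes \<theta>: "\<theta> \<in> S" "\<theta>' \<in> S" and M: "0 \<le> M" and lip: "\<And>x y. \<bar>g x - g y\<bar> \<le> M * norm (x - y)"
  shows "\<bar>(\<integral>x. g x \<partial>E \<theta>') - (\<integral>x. g x \<partial>E \<theta>)\<bar> \<le> M * K * d \<theta> \<theta>'"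
proof -
  obtain T f \<psi> where T: "transport_map \<theta> \<theta>' T f \<psi>" using transport_map_exists[OF \<theta>] by blast
  have Tm[measurable]: "T \<in> borel_measurable borel" and ET: "E \<theta>' = distr (E \<theta>) borel T"
    and Tx: "\<And>x. x \<in> \<Omega> \<Longrightarrow> norm (T x - x) \<le> K * d \<theta> \<theta>'"
    using T unfolding transport_map_def by blast+
  have "M-lipschitz_on UNIV g" using M lip by (auto intro!: lipschitz_onI simp: dist_norm dist_real_def)
  then have g[measurable]: "g \<in> borel_measurable borel"
    using lipschitz_on_continuous_on borel_measurable_continuous_onI by blast
  interpret prob_space "E \<theta>" by (rule prob_E[OF \<theta>(1)])
  have diff: "norm (g (T x) - g x) \<le> M * K * d \<theta> \<theta>'" if "x \<in> \<Omega>" for x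
    using lip[of "T x" x] mult_left_mono[OF Tx[OF that] M] by (simp add: mult.assoc)
  \<comment> \<open>\<open>T x\<close> may lie outside of \<Omega>, where the bound \<open>B\<close>
    on \<open>g\<close> found below says nothing. The difference is bounded by the displacement
    instead, and integrability of \<open>g (T x)\<close> follows by adding \<open>g\<close>.\<close>
  have int: "integrable (E \<theta>) (\<lambda>x. g (T x) - g x)"
    by (rule integrable_E[OF \<theta>(1)]) (use diff in auto)
  have "compact (g ` \<Omega>)"
    using \<open>M-lipschitz_on UNIV g\<close> compact_support
    by (meson compact_continuous_image continuous_on_subset lipschitz_on_continuous_on subset_UNIV)
  then obtain B where B: "\<And>x. x \<in> \<Omega> \<Longrightarrow> norm (g x) \<le> B"
    using compact_imp_bounded bounded_iff by (metis imageI)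
  have intg: "integrable (E \<theta>) g" by (rule integrable_E[OF \<theta>(1) g B])
  have "(\<integral>x. g x \<partial>E \<theta>') - (\<integral>x. g x \<partial>E \<theta>) = (\<integral>x. g (T x) \<partial>E \<theta>) - (\<integral>x. g x \<partial>E \<theta>)"
    by (simp add: integral_distr_E[OF \<theta>(1) ET Tm g])
  also have "\<dots> = (\<integral>x. g (T x) - g x \<partial>E \<theta>)"
    using Bochner_Integration.integral_diff[OF Bochner_Integration.integrable_add[OF int intg] intg] by simp
  finally have eq: "(\<integral>x. g x \<partial>E \<theta>') - (\<integral>x. g x \<partial>E \<theta>) = (\<integral>x. g (T x) - g x \<partial>E \<theta>)" .
  have "\<bar>\<integral>x. g (T x) - g x \<partial>E \<theta>\<bar> \<le> (\<integral>x. \<bar>g (T x) - g x\<bar> \<partial>E \<theta>)"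
    by (rule integral_abs_bound)
  also have "\<dots> \<le> (\<integral>x. M * K * d \<theta> \<theta>' \<partial>E \<theta>)"
    by (intro integral_mono_AE) (use int AE_support[OF \<theta>(1)] diff in \<open>auto elim!: eventually_mono\<close>)
  finally show ?thesis unfolding eq by (simp add: prob_space)
qed

text \<open>The cross term contributes \<open>2 * K^2 * \<epsilon>^3\<close> and the square
  \<open>K^2 * \<epsilon>^4\<close>, which is at most \<open>K^3 * \<epsilon>^3\<close> because
  \<epsilon> \<le> \<open>K\<close>. Since 1 \<le> \<open>K\<close>, the total is at most
  \<open>3 * K^3 * \<epsilon>^3\<close>.\<close>

lemma square_norm_perturbation:
  fixes a b :: 'a
  assumes \<epsilon>: "0 \<le> \<epsilon>" "\<epsilon> \<le> K" and b: "norm b \<le> K * \<epsilon>" and ab: "norm (a - b) \<le> K * \<epsilon>\<^sup>2"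
  shows "(norm a)\<^sup>2 \<le> (norm b)\<^sup>2 + 3 * K ^ 3 * \<epsilon> ^ 3"
proof -
  have K1: "1 \<le> K" by (rule K_ge)
  have "norm a \<le> norm b + K * \<epsilon>\<^sup>2" using ab norm_triangle_sub[of a b] by linarith
  then have "(norm a)\<^sup>2 \<le> (norm b + K * \<epsilon>\<^sup>2)\<^sup>2" by (intro power_mono) auto
  also have "\<dots> = (norm b)\<^sup>2 + 2 * K * \<epsilon>\<^sup>2 * norm b + K\<^sup>2 * \<epsilon> ^ 3 * \<epsilon>"
    by (simp add: power2_eq_square power3_eq_cube algebra_simps)
  also have "\<dots> \<le> (norm b)\<^sup>2 + 2 * K * \<epsilon>\<^sup>2 * (K * \<epsilon>) + K\<^sup>2 * \<epsilon> ^ 3 * K"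
    using \<epsilon> b K1 by (intro add_mono mult_left_mono) auto
  also have "\<dots> = (norm b)\<^sup>2 + (2 * K\<^sup>2 + K ^ 3) * \<epsilon> ^ 3"
    by (simp add: power2_eq_square power3_eq_cube algebra_simps)
  also have "\<dots> \<le> (norm b)\<^sup>2 + (3 * K ^ 3) * \<epsilon> ^ 3"
    using K1 \<epsilon> power_increasing[of 2 3 K] by (intro add_left_mono mult_right_mono) auto
  finally show ?thesis by simp
qed

section \<open>The potential of a transport map and the cost of couplings\<close>

context
  fixes \<theta> \<theta>' T f \<psi>
  assumes \<theta>: "\<theta> \<in> S" "\<theta>' \<in> S" and T: "transport_map \<theta> \<theta>' T f \<psi>"
begin

lemma T_facts:
  shows T_meas: "T \<in> borel_measurable borel" and E_T: "E \<theta>' = distr (E \<theta>) borel T"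
    and T_x: "x \<in> \<Omega> \<Longrightarrow> norm (T x - x) \<le> K * d \<theta> \<theta>'"
    and T_f: "x \<in> \<Omega> \<Longrightarrow> norm (T x - x - f x) \<le> K * (d \<theta> \<theta>')\<^sup>2"
    and f_bound: "norm (f x) \<le> K * d \<theta> \<theta>'"
    and f_lip: "norm (f x - f y) \<le> K * d \<theta> \<theta>' * norm (x - y)"
    and f_grad: "GDERIV \<psi> x :> f x"
  using T unfolding transport_map_def by blast+

lemma f_meas: "f \<in> borel_measurable borel" and psi_meas: "\<psi> \<in> borel_measurable borel"
  by (rule gradient_measurable[OF f_grad f_lip])+

lemma psi_lip: "\<bar>\<psi> y - \<psi> x\<bar> \<le> K * d \<theta> \<theta>' * norm (y - x)"
  by (rule gradient_bound[OF f_grad f_bound])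

lemma psi_expand: "\<bar>\<psi> y - \<psi> x - f x \<bullet> (y - x)\<bar> \<le> K * d \<theta> \<theta>' * (norm (y - x))\<^sup>2"
  by (rule gradient_expansion[OF f_grad _ f_lip]) (use K_ge(1) d_nonneg in auto)

lemma psi_bounded: "\<exists>B. \<forall>x\<in>\<Omega>. norm (\<psi> x) \<le> B"
proof (cases "\<Omega> = {}")
  case True then show ?thesis by simp
next
  case False
  then obtain z where z: "z \<in> \<Omega>" by blast
  have nn: "0 \<le> K * d \<theta> \<theta>'" using K_ge(1) d_nonneg[of \<theta> \<theta>'] by simp
  have "norm (\<psi> x) \<le> \<bar>\<psi> z\<bar> + K * d \<theta> \<theta>' * R" if "x \<in> \<Omega>" for x
    using psi_lip[of x z] mult_left_mono[OF R(1)[OF that z] nn] unfolding real_norm_def by linarith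
  then show ?thesis by blast
qed

lemma f_sq_integrable: "\<tau> \<in> S \<Longrightarrow> integrable (E \<tau>) (\<lambda>x. (norm (f x))\<^sup>2)"
proof (rule integrable_E)
  note [measurable] = f_meas
  show "(\<lambda>x. (norm (f x))\<^sup>2) \<in> borel_measurable borel" by measurable
  show "norm ((norm (f x))\<^sup>2) \<le> (K * d \<theta> \<theta>')\<^sup>2" for x using power_mono[OF f_bound, of x 2] by simp
qed

text \<open>To first order the potential gains \<open>f x \<bullet> (T x - x)\<close> along
  \<open>T\<close>. This is the squared norm of \<open>f x\<close> up to
  \<open>K^2 * \<epsilon>^3\<close>, because the displacement is \<open>f x\<close> up to
  \<open>K * \<epsilon>^2\<close>; the Taylor remainder adds
  \<open>K^3 * \<epsilon>^3\<close>.\<close>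

lemma psi_gain:
  "(\<integral>x. (norm (f x))\<^sup>2 \<partial>E \<theta>) - 2 * K ^ 3 * (d \<theta> \<theta>') ^ 3 \<le> (\<integral>x. \<psi> x \<partial>E \<theta>') - (\<integral>x. \<psi> x \<partial>E \<theta>)"
proof -
  note [measurable] = f_meas psi_meas T_meas
  define \<epsilon> where "\<epsilon> = d \<theta> \<theta>'"
  have \<epsilon>: "0 \<le> \<epsilon>" "\<epsilon> \<le> K" using d_nonneg d_le_K[OF \<theta>] by (auto simp: \<epsilon>_def)
  have K1: "1 \<le> K" by (rule K_ge)
  interpret prob_space "E \<theta>" by (rule prob_E[OF \<theta>(1)])
  obtain B where B: "\<And>x. x \<in> \<Omega> \<Longrightarrow> norm (\<psi> x) \<le> B" using psi_bounded by blast
  have int\<psi>: "integrable (E \<theta>) \<psi>" by (rule integrable_E[OF \<theta>(1) psi_meas B])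
  have diff: "norm (\<psi> (T x) - \<psi> x) \<le> K * \<epsilon> * (K * \<epsilon>)" if "x \<in> \<Omega>" for x
  proof -
    have "0 \<le> K * \<epsilon>" using K1 \<epsilon> by simp
    from mult_left_mono[OF T_x[OF that] this] psi_lip[of "T x" x] show ?thesis
      unfolding \<epsilon>_def[symmetric] real_norm_def by linarith
  qed
  have int: "integrable (E \<theta>) (\<lambda>x. \<psi> (T x) - \<psi> x)"
    by (rule integrable_E[OF \<theta>(1) _ diff]) auto
  have "(\<integral>x. \<psi> x \<partial>E \<theta>') - (\<integral>x. \<psi> x \<partial>E \<theta>) = (\<integral>x. \<psi> (T x) \<partial>E \<theta>) - (\<integral>x. \<psi> x \<partial>E \<theta>)"
    by (simp add: integral_distr_E[OF \<theta>(1) E_T T_meas psi_meas])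
  also have "\<dots> = (\<integral>x. \<psi> (T x) - \<psi> x \<partial>E \<theta>)"
    using Bochner_Integration.integral_diff[OF Bochner_Integration.integrable_add[OF int int\<psi>] int\<psi>] by simp
  finally have eq: "(\<integral>x. \<psi> x \<partial>E \<theta>') - (\<integral>x. \<psi> x \<partial>E \<theta>) = (\<integral>x. \<psi> (T x) - \<psi> x \<partial>E \<theta>)" .
  have "(norm (f x))\<^sup>2 - 2 * K ^ 3 * \<epsilon> ^ 3 \<le> \<psi> (T x) - \<psi> x" if x: "x \<in> \<Omega>" for x
  proof -
    have "f x \<bullet> (T x - x) = (norm (f x))\<^sup>2 + f x \<bullet> (T x - x - f x)"
      by (simp add: inner_diff_right power2_norm_eq_inner)
    moreover have "\<bar>f x \<bullet> (T x - x - f x)\<bar> \<le> K * \<epsilon> * (K * \<epsilon>\<^sup>2)"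
      using T_f[OF x] f_bound[of x] K1 \<epsilon> unfolding \<epsilon>_def[symmetric]
      by (intro order_trans[OF Cauchy_Schwarz_ineq2] mult_mono) auto
    moreover have "\<bar>\<psi> (T x) - \<psi> x - f x \<bullet> (T x - x)\<bar> \<le> K * \<epsilon> * (K * \<epsilon>)\<^sup>2"
      using psi_expand[of "T x" x] K1 \<epsilon> T_x[OF x] unfolding \<epsilon>_def[symmetric]
      by (intro order_trans[OF psi_expand[unfolded \<epsilon>_def[symmetric]]] mult_left_mono power_mono) auto
    moreover have "K * \<epsilon> * (K * \<epsilon>\<^sup>2) + K * \<epsilon> * (K * \<epsilon>)\<^sup>2 \<le> 2 * K ^ 3 * \<epsilon> ^ 3"
    proof -
      have "K * \<epsilon> * (K * \<epsilon>\<^sup>2) + K * \<epsilon> * (K * \<epsilon>)\<^sup>2 = (K\<^sup>2 + K ^ 3) * \<epsilon> ^ 3"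
        by (simp add: power2_eq_square power3_eq_cube algebra_simps)
      also have "\<dots> \<le> (2 * K ^ 3) * \<epsilon> ^ 3"
        using K1 \<epsilon> power_increasing[of 2 3 K] by (intro mult_right_mono) auto
      finally show ?thesis by simp
    qed
    ultimately show ?thesis by linarith
  qed
  then have "(\<integral>x. (norm (f x))\<^sup>2 - 2 * K ^ 3 * \<epsilon> ^ 3 \<partial>E \<theta>) \<le> (\<integral>x. \<psi> (T x) - \<psi> x \<partial>E \<theta>)"
    by (intro integral_mono_AE)
      (use int f_sq_integrable[OF \<theta>(1)] AE_support[OF \<theta>(1)] in \<open>auto elim!: eventually_mono\<close>)
  then show ?thesis unfolding eq \<epsilon>_def[symmetric]
    using f_sq_integrable[OF \<theta>(1)] by (simp add: prob_space)
qed

text \<open>Stated for a general \<open>g\<close> because it is applied both to the displacement of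
  \<open>T\<close> and to the velocity along the trajectories.\<close>

lemma nn_integral_square_perturbation:
  assumes "\<And>x. x \<in> \<Omega> \<Longrightarrow> norm (g x - f x) \<le> K * (d \<theta> \<theta>')\<^sup>2"
  shows "(\<integral>\<^sup>+x. ennreal ((norm (g x))\<^sup>2) \<partial>E \<theta>) \<le> ennreal ((\<integral>x. (norm (f x))\<^sup>2 \<partial>E \<theta>) + 3 * K ^ 3 * (d \<theta> \<theta>') ^ 3)"
proof -
  interpret prob_space "E \<theta>" by (rule prob_E[OF \<theta>(1)])
  have "AE x in E \<theta>. ennreal ((norm (g x))\<^sup>2) \<le> ennreal ((norm (f x))\<^sup>2 + 3 * K ^ 3 * (d \<theta> \<theta>') ^ 3)"
    using AE_support[OF \<theta>(1)]
    by eventually_elim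
      (intro ennreal_leI square_norm_perturbation d_nonneg d_le_K \<theta> f_bound assms)
  then have "(\<integral>\<^sup>+x. ennreal ((norm (g x))\<^sup>2) \<partial>E \<theta>) \<le> (\<integral>\<^sup>+x. ennreal ((norm (f x))\<^sup>2 + 3 * K ^ 3 * (d \<theta> \<theta>') ^ 3) \<partial>E \<theta>)"
    by (rule nn_integral_mono_AE)
  also have "\<dots> = ennreal (\<integral>x. (norm (f x))\<^sup>2 + 3 * K ^ 3 * (d \<theta> \<theta>') ^ 3 \<partial>E \<theta>)"
    using f_sq_integrable[OF \<theta>(1)] K_ge(1) d_nonneg[of \<theta> \<theta>'] by (intro nn_integral_eq_integral) auto
  also have "(\<integral>x. (norm (f x))\<^sup>2 + 3 * K ^ 3 * (d \<theta> \<theta>') ^ 3 \<partial>E \<theta>) = (\<integral>x. (norm (f x))\<^sup>2 \<partial>E \<theta>) + 3 * K ^ 3 * (d \<theta> \<theta>') ^ 3"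
    using f_sq_integrable[OF \<theta>(1)] by (simp add: prob_space)
  finally show ?thesis .
qed

text \<open>Test an almost optimal coupling against the potential \<^term>\<open>\<psi>\<close>.\<close>

lemma f_sq_le_W2:
  "(\<integral>x. (norm (f x))\<^sup>2 \<partial>E \<theta>) \<le> (W2 (E \<theta>) (E \<theta>'))\<^sup>2 + 6 * K ^ 3 * (d \<theta> \<theta>') ^ 3"
proof -
  note [measurable] = f_meas psi_meas T_meas
  define \<epsilon> where "\<epsilon> = d \<theta> \<theta>'"
  have \<epsilon>: "0 \<le> \<epsilon>" "\<epsilon> \<le> K" using d_nonneg d_le_K[OF \<theta>] by (auto simp: \<epsilon>_def)
  have K1: "1 \<le> K" by (rule K_ge)
  define W where "W = W2 (E \<theta>) (E \<theta>')"
  have W: "0 \<le> W" "W \<le> K * \<epsilon>"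
    using W2_le_Ld[OF \<theta>] mult_right_mono[OF K_ge(3) \<epsilon>(1)] by (auto simp: W_def \<epsilon>_def W2_def)
  define w where "w = (\<integral>x. (norm (f x))\<^sup>2 \<partial>E \<theta>)"
  \<comment> \<open>\<open>\<delta>\<close> is the slack of an almost optimal coupling; it tends to
    0 once the constants in front of it are fixed.\<close>
  have main: "w \<le> (1 + 2 * K * \<epsilon>) * (W\<^sup>2 + \<delta>) + 4 * K ^ 3 * \<epsilon> ^ 3" if \<delta>: "0 < \<delta>" for \<delta>
  proof -
    have fin: "(\<integral>\<^sup>+z. ennreal ((norm (fst z - snd z))\<^sup>2) \<partial>distr (E \<theta>) borel (\<lambda>x. (x, T x))) < \<infinity>"
    proof -
      have "(\<integral>\<^sup>+x. ennreal ((norm (T x - x))\<^sup>2) \<partial>E \<theta>) < \<infinity>"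
        using nn_integral_square_perturbation[of "\<lambda>x. T x - x"] T_f by (auto intro: le_less_trans)
      then show ?thesis using map_coupling(2)[OF sets_E[OF \<theta>(1)] T_meas] by simp
    qed
    obtain \<pi> where \<pi>: "\<pi> \<in> couplings (E \<theta>) (E \<theta>')"
      and cost: "(\<integral>\<^sup>+z. ennreal ((norm (fst z - snd z))\<^sup>2) \<partial>\<pi>) \<le> ennreal (W\<^sup>2 + \<delta>)"
      using W2_coupling[OF map_coupling(1)[OF sets_E[OF \<theta>(1)] T_meas, folded E_T] fin \<delta>] unfolding W_def by blast
    have "sets \<pi> = sets borel" and \<pi>1: "distr \<pi> borel fst = E \<theta>" and \<pi>2: "distr \<pi> borel snd = E \<theta>'"
      using \<pi> unfolding couplings_def by blast+
    have [measurable_cong]: "sets \<pi> = sets (borel \<Otimes>\<^sub>M borel)"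
      unfolding borel_prod by (rule \<open>sets \<pi> = sets borel\<close>)
    have [measurable]: "fst \<in> borel_measurable \<pi>" "snd \<in> borel_measurable \<pi>" by measurable
    interpret \<pi>: prob_space \<pi>
      by (rule prob_space_distrD[of fst \<pi> borel]) (use prob_E[OF \<theta>(1)] \<pi>1 in auto)
    have AE1: "AE z in \<pi>. fst z \<in> \<Omega>"
      using AE_support[OF \<theta>(1)] unfolding \<pi>1[symmetric] by (subst (asm) AE_distr_iff) auto
    have AE2: "AE z in \<pi>. snd z \<in> \<Omega>"
      using AE_support[OF \<theta>(2)] unfolding \<pi>2[symmetric] by (subst (asm) AE_distr_iff) auto
    have AE: "AE z in \<pi>. norm (snd z - fst z) \<le> R"
      using AE1 AE2 by eventually_elim (rule R)
    have ints: "integrable \<pi> (\<lambda>z. (norm (snd z - fst z))\<^sup>2)"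
      by (rule \<pi>.integrable_const_bound[where B = "R\<^sup>2"])
        (use AE in \<open>auto elim!: eventually_mono intro: power_mono\<close>)
    define c where "c = (\<integral>z. (norm (snd z - fst z))\<^sup>2 \<partial>\<pi>)"
    have c: "c \<le> W\<^sup>2 + \<delta>"
    proof -
      have "ennreal c = (\<integral>\<^sup>+z. ennreal ((norm (snd z - fst z))\<^sup>2) \<partial>\<pi>)"
        unfolding c_def by (rule nn_integral_eq_integral[symmetric, OF ints]) auto
      then have "ennreal c \<le> ennreal (W\<^sup>2 + \<delta>)" using cost by (simp add: norm_minus_commute)
      then show ?thesis using \<delta> by (subst (asm) ennreal_le_iff) (auto intro: add_nonneg_nonneg)
    qed
    obtain B where B: "\<And>x. x \<in> \<Omega> \<Longrightarrow> norm (\<psi> x) \<le> B" using psi_bounded by blast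
    have "integrable \<pi> (\<lambda>z. \<psi> (fst z))"
      by (rule \<pi>.integrable_const_bound[where B = B]) (use AE1 B in \<open>auto elim!: eventually_mono\<close>)
    moreover have "integrable \<pi> (\<lambda>z. \<psi> (snd z))"
      by (rule \<pi>.integrable_const_bound[where B = B]) (use AE2 B in \<open>auto elim!: eventually_mono\<close>)
    ultimately have int\<psi>: "integrable \<pi> (\<lambda>z. \<psi> (fst z))" "integrable \<pi> (\<lambda>z. \<psi> (snd z))" by blast+
    have intf: "integrable \<pi> (\<lambda>z. (norm (f (fst z)))\<^sup>2)"
      using f_sq_integrable[OF \<theta>(1)] unfolding \<pi>1[symmetric] by (subst (asm) integrable_distr_eq) auto
    have "(\<integral>x. \<psi> x \<partial>E \<theta>') - (\<integral>x. \<psi> x \<partial>E \<theta>) = (\<integral>z. \<psi> (snd z) \<partial>\<pi>) - (\<integral>z. \<psi> (fst z) \<partial>\<pi>)"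
      unfolding \<pi>1[symmetric] \<pi>2[symmetric] by (simp add: integral_distr)
    also have "\<dots> = (\<integral>z. \<psi> (snd z) - \<psi> (fst z) \<partial>\<pi>)" using int\<psi> by simp
    \<comment> \<open>Taylor expansion and Young's inequality for every pair of points. The first
      marginal of \<open>\<pi>\<close> turns the first summand into \<open>w / 2\<close>; absorbing
      it on the left doubles the cost and the error of \<open>psi_gain\<close>.\<close>
    also have "\<dots> \<le> (\<integral>z. (norm (f (fst z)))\<^sup>2 / 2 + (1 / 2 + K * \<epsilon>) * (norm (snd z - fst z))\<^sup>2 \<partial>\<pi>)"
    proof (intro integral_mono_AE AE_I2)
      fix z
      have "f (fst z) \<bullet> (snd z - fst z) \<le> (norm (f (fst z)))\<^sup>2 / 2 + (norm (snd z - fst z))\<^sup>2 / 2"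
      proof -
        have "f (fst z) \<bullet> (snd z - fst z) \<le> norm (f (fst z)) * norm (snd z - fst z)"
          by (rule norm_cauchy_schwarz)
        then show ?thesis
          using sum_squares_bound[of "norm (f (fst z))" "norm (snd z - fst z)"] by linarith
      qed
      then show "\<psi> (snd z) - \<psi> (fst z) \<le> (norm (f (fst z)))\<^sup>2 / 2 + (1 / 2 + K * \<epsilon>) * (norm (snd z - fst z))\<^sup>2"
        using psi_expand[of "snd z" "fst z"] unfolding \<epsilon>_def[symmetric] by (simp add: algebra_simps)
    qed (use int\<psi> ints intf in auto)
    also have "\<dots> = w / 2 + (1 / 2 + K * \<epsilon>) * c"
    proof -
      have "w = (\<integral>z. (norm (f (fst z)))\<^sup>2 \<partial>\<pi>)"
        unfolding w_def \<pi>1[symmetric] by (simp add: integral_distr)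
      then show ?thesis using intf ints by (simp add: c_def)
    qed
    finally have "w - 2 * K ^ 3 * \<epsilon> ^ 3 \<le> w / 2 + (1 / 2 + K * \<epsilon>) * c"
      using psi_gain unfolding w_def \<epsilon>_def by linarith
    then have "w \<le> (1 + 2 * K * \<epsilon>) * c + 4 * K ^ 3 * \<epsilon> ^ 3" by (simp add: algebra_simps)
    also have "(1 + 2 * K * \<epsilon>) * c \<le> (1 + 2 * K * \<epsilon>) * (W\<^sup>2 + \<delta>)"
      using c K1 \<epsilon> by (intro mult_left_mono) auto
    finally show ?thesis by simp
  qed
  have "w \<le> (1 + 2 * K * \<epsilon>) * W\<^sup>2 + 4 * K ^ 3 * \<epsilon> ^ 3"
  proof (rule field_le_epsilon)
    fix e :: real assume e: "0 < e"
    have "0 < 1 + 2 * K * \<epsilon>" using K1 \<epsilon> by (simp add: add_pos_nonneg)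
    then show "w \<le> (1 + 2 * K * \<epsilon>) * W\<^sup>2 + 4 * K ^ 3 * \<epsilon> ^ 3 + e"
      using main[of "e / (1 + 2 * K * \<epsilon>)"] e by (simp add: distrib_left)
  qed
  also have "(1 + 2 * K * \<epsilon>) * W\<^sup>2 = W\<^sup>2 + 2 * K * \<epsilon> * W\<^sup>2" by (simp add: algebra_simps)
  \<comment> \<open>By \<open>W \<le> K * \<epsilon>\<close> this summand is at most
    \<open>2 * K^3 * \<epsilon>^3\<close>, which raises the 4 from the doubled
    \<open>psi_gain\<close> to 6.\<close>
  also have "2 * K * \<epsilon> * W\<^sup>2 \<le> 2 * K * \<epsilon> * (K * \<epsilon>)\<^sup>2"
    using W K1 \<epsilon> by (intro mult_left_mono power_mono) auto
  finally show ?thesis unfolding w_def W_def \<epsilon>_def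
    by (simp add: power2_eq_square power3_eq_cube algebra_simps)
qed

end

lemma set_integral_support:
  fixes h :: "'a \<Rightarrow> real"
  assumes "\<theta> \<in> S" "h \<in> borel_measurable borel"
  shows "(LINT x:\<Omega>|E \<theta>. h x) = (\<integral>x. h x \<partial>E \<theta>)"
  unfolding set_lebesgue_integral_def
proof (rule integral_cong_AE)
  note [measurable] = assms(2)
  show "(\<lambda>x. indicat_real \<Omega> x *\<^sub>R h x) \<in> borel_measurable (E \<theta>)"
    by (rule measurable_E[OF assms(1)]) measurable
  show "h \<in> borel_measurable (E \<theta>)" by (rule measurable_E[OF assms])
  show "AE x in E \<theta>. indicat_real \<Omega> x *\<^sub>R h x = h x"
    using AE_support[OF assms(1)] by eventually_elim simp
qed

text \<open>Makes integrals along the curve measurable in time: for a Lipschitz integrand they are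
  even Lipschitz, by \<open>integral_lipschitz\<close>.\<close>

lemma curve_kernel:
  fixes \<theta> :: "real \<Rightarrow> 'm"
  assumes \<theta>: "\<And>t. \<theta> t \<in> S" and \<Lambda>: "0 \<le> \<Lambda>" and lip: "\<And>s t. d (\<theta> s) (\<theta> t) \<le> \<Lambda> * \<bar>s - t\<bar>"
  shows "(\<lambda>t. E (\<theta> t)) \<in> borel \<rightarrow>\<^sub>M subprob_algebra borel"
proof (rule measurable_subprob_algebra_lipschitz)
  show "prob_space (E (\<theta> t))" "sets (E (\<theta> t)) = sets borel" for t by (rule prob_E sets_E; rule \<theta>)+
  fix g :: "'a \<Rightarrow> real" and M assume M: "0 \<le> M" and g: "\<And>x y. \<bar>g x - g y\<bar> \<le> M * norm (x - y)"
  have "(M * K * \<Lambda>)-lipschitz_on UNIV (\<lambda>t. \<integral>x. g x \<partial>E (\<theta> t))"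
  proof (rule lipschitz_onI)
    fix s t
    have "\<bar>(\<integral>x. g x \<partial>E (\<theta> s)) - (\<integral>x. g x \<partial>E (\<theta> t))\<bar> \<le> M * K * d (\<theta> t) (\<theta> s)"
      by (rule integral_lipschitz[OF \<theta> \<theta> M g])
    also have "\<dots> \<le> M * K * (\<Lambda> * \<bar>t - s\<bar>)" using M K_ge(1) lip by (intro mult_left_mono) auto
    finally show "dist (\<integral>x. g x \<partial>E (\<theta> s)) (\<integral>x. g x \<partial>E (\<theta> t)) \<le> M * K * \<Lambda> * dist s t"
      by (simp add: dist_real_def abs_minus_commute mult.assoc)
  qed (use M K_ge(1) \<Lambda> in simp)
  then show "(\<lambda>t. \<integral>x. g x \<partial>E (\<theta> t)) \<in> borel_measurable borel"
    by (intro borel_measurable_continuous_onI lipschitz_on_continuous_on)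
qed

section \<open>Lower bound: the action of a solution of the continuity equation\<close>

context
  fixes \<theta> :: "real \<Rightarrow> 'm" and \<Lambda> :: real and v :: "real \<Rightarrow> 'a \<Rightarrow> 'a"
  assumes \<theta>_S: "\<theta> t \<in> S" and \<Lambda>: "0 \<le> \<Lambda>" and \<theta>_lip: "d (\<theta> s) (\<theta> t) \<le> \<Lambda> * \<bar>s - t\<bar>"
    and v_meas: "(\<lambda>(t, x). v t x) \<in> borel_measurable borel"
    and v_L2: "t \<in> {0..1} \<Longrightarrow> (\<integral>\<^sup>+x. ennreal ((norm (v t x))\<^sup>2) \<partial>E (\<theta> t)) < \<infinity>"
    and v_weak: "C1_test \<Omega> \<phi> \<phi>t \<phi>x \<Longrightarrow>
        (LINT t:{0..1}|lborel. (LINT x:\<Omega>|E (\<theta> t). \<phi>t (t, x)))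
        + (LINT t:{0..1}|lborel. (LINT x:\<Omega>|E (\<theta> t). \<phi>x (t, x) \<bullet> v t x))
        = (LINT x:\<Omega>|E (\<theta> 1). \<phi> (1, x)) - (LINT x:\<Omega>|E (\<theta> 0). \<phi> (0, x))"
begin

definition kinetic :: "real \<Rightarrow> real" where "kinetic t = (\<integral>x. (norm (v t x))\<^sup>2 \<partial>E (\<theta> t))"

lemma v_joint: "(\<lambda>(t, x). v t x) \<in> borel_measurable (borel \<Otimes>\<^sub>M borel)"
  using v_meas by (simp add: borel_prod)

lemma v_section: "v t \<in> borel_measurable borel"
  using measurable_compose[OF measurable_Pair1' v_joint, of t] by simp

lemma kernel: "(\<lambda>t. E (\<theta> t)) \<in> borel \<rightarrow>\<^sub>M subprob_algebra borel"
  by (rule curve_kernel[OF \<theta>_S \<Lambda> \<theta>_lip])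

lemma v_sq_integrable: "t \<in> {0..1} \<Longrightarrow> integrable (E (\<theta> t)) (\<lambda>x. (norm (v t x))\<^sup>2)"
proof (rule integrableI_bounded)
  note [measurable] = v_section[of t]
  show "(\<lambda>x. (norm (v t x))\<^sup>2) \<in> borel_measurable (E (\<theta> t))" by (rule measurable_E[OF \<theta>_S]) measurable
qed (use v_L2 in simp)

lemma kinetic_nonneg: "0 \<le> kinetic t" unfolding kinetic_def by simp

lemma kinetic_eq: "t \<in> {0..1} \<Longrightarrow> ennreal (kinetic t) = (\<integral>\<^sup>+x. ennreal ((norm (v t x))\<^sup>2) \<partial>E (\<theta> t))"
  unfolding kinetic_def by (rule nn_integral_eq_integral[symmetric, OF v_sq_integrable]) auto

lemma kinetic_measurable: "kinetic \<in> borel_measurable borel"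
proof -
  note [measurable] = v_joint
  show ?thesis unfolding kinetic_def[abs_def]
    by (rule integral_measurable_subprob_algebra2[OF _ kernel]) measurable
qed

context
  fixes a b T f \<psi>
  assumes ab: "0 \<le> a" "a < b" "b \<le> 1" and T: "transport_map (\<theta> a) (\<theta> b) T f \<psi>"
    and kinetic_int: "set_integrable lborel {0..1} kinetic"
begin

text \<open>The weak time derivative of the integral of \<open>\<psi>\<close> along the curve, as
  \<open>g_increment\<close> shows.\<close>

abbreviation "g \<equiv> \<lambda>t. \<integral>x. f x \<bullet> v t x \<partial>E (\<theta> t)"

lemmas fm = f_meas[OF \<theta>_S \<theta>_S T] and psm = psi_meas[OF \<theta>_S \<theta>_S T]
lemmas fsq = f_sq_integrable[OF \<theta>_S \<theta>_S T \<theta>_S]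

text \<open>Scaled so as to be sharp at \<open>f x = h *\<^sub>R v t x\<close>: over a step of
  length \<open>h\<close>, the field \<open>f\<close> is a displacement and \<open>v\<close> a
  velocity.\<close>

lemma fv_young: "0 < h \<Longrightarrow> \<bar>f x \<bullet> v t x\<bar> \<le> (norm (f x))\<^sup>2 / (2 * h) + h / 2 * (norm (v t x))\<^sup>2"
proof -
  assume h: "0 < h"
  have "\<bar>f x \<bullet> v t x\<bar> \<le> norm (f x) * norm (v t x)" by (rule Cauchy_Schwarz_ineq2)
  also have "\<dots> \<le> (norm (f x))\<^sup>2 / (2 * h) + h / 2 * (norm (v t x))\<^sup>2"
  proof -
    have "0 \<le> (norm (f x) - h * norm (v t x))\<^sup>2 / (2 * h)" using h by simp
    also have "\<dots> = (norm (f x))\<^sup>2 / (2 * h) + h / 2 * (norm (v t x))\<^sup>2 - norm (f x) * norm (v t x)"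
      using h by (simp add: field_simps power2_eq_square)
    finally show ?thesis by simp
  qed
  finally show ?thesis .
qed

lemma fv_integrable: "t \<in> {0..1} \<Longrightarrow> integrable (E (\<theta> t)) (\<lambda>x. f x \<bullet> v t x)"
proof (rule Bochner_Integration.integrable_bound[of _ "\<lambda>x. (norm (f x))\<^sup>2 / 2 + 1 / 2 * (norm (v t x))\<^sup>2"])
  note [measurable] = v_section[of t] fm
  assume "t \<in> {0..1}"
  then show "integrable (E (\<theta> t)) (\<lambda>x. (norm (f x))\<^sup>2 / 2 + 1 / 2 * (norm (v t x))\<^sup>2)"
    using fsq v_sq_integrable by auto
  show "(\<lambda>x. f x \<bullet> v t x) \<in> borel_measurable (E (\<theta> t))" by (rule measurable_E[OF \<theta>_S]) measurable
  show "AE x in E (\<theta> t). norm (f x \<bullet> v t x) \<le> norm ((norm (f x))\<^sup>2 / 2 + 1 / 2 * (norm (v t x))\<^sup>2)"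
    using fv_young[of 1 _ t] by (intro AE_I2) simp
qed

lemma g_young:
  assumes "t \<in> {0..1}" "0 < h"
  shows "\<bar>g t\<bar> \<le> (\<integral>x. (norm (f x))\<^sup>2 \<partial>E (\<theta> t)) / (2 * h) + h / 2 * kinetic t"
proof -
  have "\<bar>g t\<bar> \<le> (\<integral>x. \<bar>f x \<bullet> v t x\<bar> \<partial>E (\<theta> t))" by (rule integral_abs_bound)
  also have "\<dots> \<le> (\<integral>x. (norm (f x))\<^sup>2 / (2 * h) + h / 2 * (norm (v t x))\<^sup>2 \<partial>E (\<theta> t))"
    using fv_integrable[OF assms(1)] fsq v_sq_integrable[OF assms(1)] fv_young[OF assms(2)]
    by (intro integral_mono) auto
  also have "\<dots> = (\<integral>x. (norm (f x))\<^sup>2 \<partial>E (\<theta> t)) / (2 * h) + h / 2 * kinetic t"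
    using fsq v_sq_integrable[OF assms(1)] by (simp add: kinetic_def)
  finally show ?thesis .
qed

lemma f_sq_bound: "(\<integral>x. (norm (f x))\<^sup>2 \<partial>E (\<theta> t)) \<le> (K * d (\<theta> a) (\<theta> b))\<^sup>2"
proof -
  interpret prob_space "E (\<theta> t)" by (rule prob_E[OF \<theta>_S])
  have "(\<integral>x. (norm (f x))\<^sup>2 \<partial>E (\<theta> t)) \<le> (\<integral>x. (K * d (\<theta> a) (\<theta> b))\<^sup>2 \<partial>E (\<theta> t))"
    using fsq f_bound[OF \<theta>_S \<theta>_S T] by (intro integral_mono power_mono) auto
  then show ?thesis by (simp add: prob_space)
qed

lemma g_integrable: "set_integrable lborel {0..1} g"
  unfolding set_integrable_def
proof (rule Bochner_Integration.integrable_bound)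
  note [measurable] = fm v_joint
  have "set_integrable lborel {0..1} (\<lambda>t. (K * d (\<theta> a) (\<theta> b))\<^sup>2 / 2 + 1 / 2 * kinetic t)"
    using kinetic_int by (intro set_integral_add set_integrable_mult_right) (auto simp: set_integrable_def)
  then show "integrable lborel (\<lambda>t. indicat_real {0..1} t *\<^sub>R ((K * d (\<theta> a) (\<theta> b))\<^sup>2 / 2 + 1 / 2 * kinetic t))"
    unfolding set_integrable_def .
  have "g \<in> borel_measurable borel"
    by (rule integral_measurable_subprob_algebra2[OF _ kernel]) measurable
  then show "(\<lambda>t. indicat_real {0..1} t *\<^sub>R g t) \<in> borel_measurable lborel" by measurable
  show "AE t in lborel. norm (indicat_real {0..1} t *\<^sub>R g t)
      \<le> norm (indicat_real {0..1} t *\<^sub>R ((K * d (\<theta> a) (\<theta> b))\<^sup>2 / 2 + 1 / 2 * kinetic t))"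
  proof (intro AE_I2)
    fix t
    show "norm (indicat_real {0..1} t *\<^sub>R g t)
      \<le> norm (indicat_real {0..1} t *\<^sub>R ((K * d (\<theta> a) (\<theta> b))\<^sup>2 / 2 + 1 / 2 * kinetic t))"
      using g_young[of t 1] f_sq_bound[of t] kinetic_nonneg[of t] by (cases "t \<in> {0..1}") auto
  qed
qed

text \<open>Test functions of product form \<open>\<zeta> t * \<psi> x\<close> turn the continuity
  equation into a weak derivative in time. Lipschitz continuity of the integral of
  \<open>\<psi>\<close> in time then makes the increment valid for the given \<open>a\<close> and
  \<open>b\<close>, not only for almost all times.\<close>

lemma g_increment:
  "(\<integral>x. \<psi> x \<partial>E (\<theta> b)) - (\<integral>x. \<psi> x \<partial>E (\<theta> a)) = (LINT s:{a<..b}|lborel. g s)"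
proof (rule weak_derivative_increment[where F = "\<lambda>t. \<integral>x. \<psi> x \<partial>E (\<theta> t)"])
  note grad = f_grad[OF \<theta>_S \<theta>_S T, unfolded gderiv_def]
  note [measurable] = fm psm
  have fcont: "continuous_on UNIV f"
    by (rule gradient_measurable(1)[OF f_grad[OF \<theta>_S \<theta>_S T] f_lip[OF \<theta>_S \<theta>_S T]])
  have pscont: "continuous_on UNIV \<psi>"
    using grad has_derivative_continuous by (intro continuous_at_imp_continuous_on) blast
  have Kd: "0 \<le> K * d (\<theta> a) (\<theta> b)" using K_ge(1) d_nonneg[of "\<theta> a" "\<theta> b"] by simp
  show "\<bar>(\<integral>x. \<psi> x \<partial>E (\<theta> s)) - (\<integral>x. \<psi> x \<partial>E (\<theta> t))\<bar> \<le> K * d (\<theta> a) (\<theta> b) * K * \<Lambda> * \<bar>s - t\<bar>" for s t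
  proof -
    have "\<bar>(\<integral>x. \<psi> x \<partial>E (\<theta> s)) - (\<integral>x. \<psi> x \<partial>E (\<theta> t))\<bar> \<le> K * d (\<theta> a) (\<theta> b) * K * d (\<theta> t) (\<theta> s)"
      by (rule integral_lipschitz[OF \<theta>_S \<theta>_S Kd psi_lip[OF \<theta>_S \<theta>_S T]])
    also have "\<dots> \<le> K * d (\<theta> a) (\<theta> b) * K * (\<Lambda> * \<bar>t - s\<bar>)"
      using Kd K_ge(1) \<theta>_lip by (intro mult_left_mono) auto
    finally show ?thesis by (simp add: abs_minus_commute mult.assoc)
  qed
  show "set_integrable lborel {0..1} g" by (rule g_integrable)
  show "(LINT s:{0..1}|lborel. \<zeta>' s * (\<integral>x. \<psi> x \<partial>E (\<theta> s))) + (LINT s:{0..1}|lborel. \<zeta> s * g s)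
      = \<zeta> 1 * (\<integral>x. \<psi> x \<partial>E (\<theta> 1)) - \<zeta> 0 * (\<integral>x. \<psi> x \<partial>E (\<theta> 0))"
    if d\<zeta>: "\<And>s. (\<zeta> has_real_derivative \<zeta>' s) (at s)" and \<zeta>': "continuous_on UNIV \<zeta>'" for \<zeta> \<zeta>'
  proof -
    have \<zeta>: "continuous_on UNIV \<zeta>" using d\<zeta> by (meson DERIV_isCont continuous_at_imp_continuous_on)
    have "C1_test \<Omega> (\<lambda>z. \<zeta> (fst z) * \<psi> (snd z)) (\<lambda>z. \<zeta>' (fst z) * \<psi> (snd z)) (\<lambda>z. \<zeta> (fst z) *\<^sub>R f (snd z))"
      unfolding C1_test_def
    proof (intro conjI ballI)
      show "continuous_on ({0..1} \<times> \<Omega>) (\<lambda>z. \<zeta>' (fst z) * \<psi> (snd z))"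
        by (intro continuous_intros continuous_on_compose2[OF \<zeta>'] continuous_on_compose2[OF pscont]) auto
      show "continuous_on ({0..1} \<times> \<Omega>) (\<lambda>z. \<zeta> (fst z) *\<^sub>R f (snd z))"
        by (intro continuous_intros continuous_on_compose2[OF \<zeta>] continuous_on_compose2[OF fcont]) auto
      fix z :: "real \<times> 'a"
      have 1: "((\<lambda>z. \<zeta> (fst z)) has_derivative (\<lambda>h. \<zeta>' (fst z) * fst h)) (at z)"
        using has_derivative_compose[OF has_derivative_fst[OF has_derivative_ident] d\<zeta>[unfolded has_field_derivative_def]] .
      have 2: "((\<lambda>z. \<psi> (snd z)) has_derivative (\<lambda>h. snd h \<bullet> f (snd z))) (at z)"
        using has_derivative_compose[OF has_derivative_snd[OF has_derivative_ident] grad] .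
      have "((\<lambda>z. \<zeta> (fst z) * \<psi> (snd z)) has_derivative
          (\<lambda>h. \<zeta> (fst z) * (snd h \<bullet> f (snd z)) + \<zeta>' (fst z) * fst h * \<psi> (snd z))) (at z)"
        by (rule has_derivative_mult[OF 1 2])
      moreover have "(\<lambda>h. \<zeta> (fst z) * (snd h \<bullet> f (snd z)) + \<zeta>' (fst z) * fst h * \<psi> (snd z))
          = (\<lambda>(s, y). s * (\<zeta>' (fst z) * \<psi> (snd z)) + (\<zeta> (fst z) *\<^sub>R f (snd z)) \<bullet> y)"
        by (auto simp: fun_eq_iff inner_commute)
      ultimately show "((\<lambda>z. \<zeta> (fst z) * \<psi> (snd z)) has_derivative
          (\<lambda>(s, y). s * (\<zeta>' (fst z) * \<psi> (snd z)) + (\<zeta> (fst z) *\<^sub>R f (snd z)) \<bullet> y)) (at z within {0..1} \<times> \<Omega>)"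
        by (simp only: has_derivative_at_withinI)
    qed
    from v_weak[OF this]
    have eq: "(LINT t:{0..1}|lborel. (LINT x:\<Omega>|E (\<theta> t). \<zeta>' t * \<psi> x))
        + (LINT t:{0..1}|lborel. (LINT x:\<Omega>|E (\<theta> t). (\<zeta> t *\<^sub>R f x) \<bullet> v t x))
        = (LINT x:\<Omega>|E (\<theta> 1). \<zeta> 1 * \<psi> x) - (LINT x:\<Omega>|E (\<theta> 0). \<zeta> 0 * \<psi> x)"
      by simp
    have 3: "(LINT x:\<Omega>|E (\<theta> t). c * \<psi> x) = c * (\<integral>x. \<psi> x \<partial>E (\<theta> t))" for t c
      by (subst set_integral_support[OF \<theta>_S]) auto
    have 4: "(LINT x:\<Omega>|E (\<theta> t). (\<zeta> t *\<^sub>R f x) \<bullet> v t x) = \<zeta> t * g t" for t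
    proof -
      note [measurable] = v_section[of t]
      show ?thesis by (subst set_integral_support[OF \<theta>_S]) auto
    qed
    show ?thesis using eq unfolding 3 4 .
  qed
qed (use ab in auto)

text \<open>With h = b - a, the increment of the integral of \<open>\<psi>\<close> is at least
  \<open>w - 2 * K^3 * \<epsilon>^3\<close> by \<open>psi_gain\<close> and at most
  \<open>w / 2 + K^3 * \<Lambda>^3 * h^3\<close> plus h/2 times the action by
  \<open>g_young\<close>. Solving for \<open>w\<close> leaves errors 4 and 2; passing from
  \<open>f\<close> to the displacement of \<open>T\<close> adds 3, and 4 + 2 + 3 = 9.\<close>

lemma step_cost:
  "(\<integral>\<^sup>+x. ennreal ((norm (T x - x))\<^sup>2) \<partial>E (\<theta> a))
    \<le> ennreal ((b - a) * (LINT s:{a<..b}|lborel. kinetic s) + 9 * K ^ 3 * \<Lambda> ^ 3 * (b - a) ^ 3)"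
proof -
  define h where "h = b - a"
  have h: "0 < h" using ab by (simp add: h_def)
  define \<epsilon> where "\<epsilon> = d (\<theta> a) (\<theta> b)"
  have \<epsilon>: "0 \<le> \<epsilon>" "\<epsilon> \<le> \<Lambda> * h" using d_nonneg \<theta>_lip[of a b] ab by (auto simp: \<epsilon>_def h_def)
  have K1: "1 \<le> K" by (rule K_ge)
  define w where "w = (\<integral>x. (norm (f x))\<^sup>2 \<partial>E (\<theta> a))"
  define M where "M = 2 * (K * \<epsilon>) * (K * \<epsilon>)"
  \<comment> \<open>\<open>f\<close> belongs to the start of the step, but Young's inequality at
    time \<open>t\<close> involves its norm under \<open>E (\<theta> t)\<close>. The Lipschitz
    constant \<open>M\<close> of the squared norm of \<open>f\<close> is O(h^2), so the change over
    the step is O(h^3).\<close>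
  have w_near: "(\<integral>x. (norm (f x))\<^sup>2 \<partial>E (\<theta> t)) \<le> w + 2 * K ^ 3 * \<Lambda> ^ 3 * h ^ 3" if t: "t \<in> {a<..b}" for t
  proof -
    have "\<bar>(\<integral>x. (norm (f x))\<^sup>2 \<partial>E (\<theta> t)) - (\<integral>x. (norm (f x))\<^sup>2 \<partial>E (\<theta> a))\<bar> \<le> M * K * d (\<theta> a) (\<theta> t)"
    proof (rule integral_lipschitz[OF \<theta>_S \<theta>_S])
      show "0 \<le> M" unfolding M_def using K1 \<epsilon> by simp
      fix x y
      have fx: "norm (f x) \<le> K * \<epsilon>" "norm (f y) \<le> K * \<epsilon>" using f_bound[OF \<theta>_S \<theta>_S T] by (auto simp: \<epsilon>_def)
      have "\<bar>(norm (f x))\<^sup>2 - (norm (f y))\<^sup>2\<bar> = (norm (f x) + norm (f y)) * \<bar>norm (f x) - norm (f y)\<bar>"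
        by (simp add: power2_eq_square square_diff_square_factored abs_mult)
      also have "\<dots> \<le> (2 * (K * \<epsilon>)) * (K * \<epsilon> * norm (x - y))"
      proof (rule mult_mono)
        show "\<bar>norm (f x) - norm (f y)\<bar> \<le> K * \<epsilon> * norm (x - y)"
          using norm_triangle_ineq3[of "f x" "f y"] f_lip[OF \<theta>_S \<theta>_S T, of x y] unfolding \<epsilon>_def by linarith
      qed (use fx K1 \<epsilon> in auto)
      finally show "\<bar>(norm (f x))\<^sup>2 - (norm (f y))\<^sup>2\<bar> \<le> M * norm (x - y)" by (simp add: M_def mult.assoc)
    qed
    also have "\<dots> \<le> (2 * (K * (\<Lambda> * h)) * (K * (\<Lambda> * h))) * K * (\<Lambda> * h)"
    proof -
      have "d (\<theta> a) (\<theta> t) \<le> \<Lambda> * h"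
        using \<theta>_lip[of a t] that \<Lambda> mult_left_mono[of "\<bar>a - t\<bar>" h \<Lambda>] by (auto simp: h_def)
      then show ?thesis unfolding M_def using \<epsilon> K1 h \<Lambda> d_nonneg by (intro mult_mono) auto
    qed
    also have "\<dots> = 2 * K ^ 3 * \<Lambda> ^ 3 * h ^ 3" by (simp add: power3_eq_cube mult_ac)
    finally show ?thesis by (simp add: w_def)
  qed
  have sub: "{a<..b} \<subseteq> {0..1}" using ab by auto
  have g_ab: "set_integrable lborel {a<..b} g" "set_integrable lborel {a<..b} kinetic"
    by (rule set_integrable_subset[OF g_integrable] set_integrable_subset[OF kinetic_int]; use sub in auto)+
  have const: "set_integrable lborel {a<..b} (\<lambda>_. c)" "(LINT s:{a<..b}|lborel. c) = h * c" for c :: real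
    using ab by (auto simp: set_integrable_def set_lebesgue_integral_def h_def)
  define c where "c = (w + 2 * K ^ 3 * \<Lambda> ^ 3 * h ^ 3) / (2 * h)"
  have "w - 2 * K ^ 3 * \<epsilon> ^ 3 \<le> (LINT s:{a<..b}|lborel. g s)"
    using psi_gain[OF \<theta>_S \<theta>_S T] g_increment by (simp add: w_def \<epsilon>_def)
  also have "\<dots> \<le> (LINT s:{a<..b}|lborel. c + h / 2 * kinetic s)"
  proof (rule set_integral_mono)
    show "set_integrable lborel {a<..b} (\<lambda>s. c + h / 2 * kinetic s)"
      using g_ab const by (intro set_integral_add set_integrable_mult_right) auto
    fix s assume s: "s \<in> {a<..b}"
    have "g s \<le> (\<integral>x. (norm (f x))\<^sup>2 \<partial>E (\<theta> s)) / (2 * h) + h / 2 * kinetic s"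
      using g_young[of s h] h s sub by (auto dest: abs_le_D1)
    also have "\<dots> \<le> c + h / 2 * kinetic s"
      unfolding c_def using w_near[OF s] h by (intro add_right_mono divide_right_mono) auto
    finally show "g s \<le> c + h / 2 * kinetic s" .
  qed (rule g_ab)
  also have "\<dots> = h * c + h / 2 * (LINT s:{a<..b}|lborel. kinetic s)"
    using g_ab const by (subst set_integral_add(2)) (auto simp: set_integrable_mult_right)
  also have "h * c = (w + 2 * K ^ 3 * \<Lambda> ^ 3 * h ^ 3) / 2" using h by (simp add: c_def)
  finally have "w \<le> h * (LINT s:{a<..b}|lborel. kinetic s) + 2 * K ^ 3 * \<Lambda> ^ 3 * h ^ 3 + 4 * (K ^ 3 * \<epsilon> ^ 3)" by (simp add: field_simps)
  moreover have \<epsilon>3: "K ^ 3 * \<epsilon> ^ 3 \<le> K ^ 3 * \<Lambda> ^ 3 * h ^ 3"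
    using power_mono[OF \<epsilon>(2,1), of 3] K1 by (simp add: power_mult_distrib mult.assoc mult_left_mono)
  ultimately have "w + 3 * K ^ 3 * \<epsilon> ^ 3 \<le> h * (LINT s:{a<..b}|lborel. kinetic s) + 9 * K ^ 3 * \<Lambda> ^ 3 * h ^ 3" by simp
  moreover have "(\<integral>\<^sup>+x. ennreal ((norm (T x - x))\<^sup>2) \<partial>E (\<theta> a)) \<le> ennreal (w + 3 * K ^ 3 * \<epsilon> ^ 3)"
    unfolding w_def \<epsilon>_def
    by (rule nn_integral_square_perturbation[OF \<theta>_S \<theta>_S T]) (rule T_f[OF \<theta>_S \<theta>_S T])
  ultimately show ?thesis unfolding h_def using ennreal_leI order_trans by blast
qed

end

text \<open>For n equal steps, the factor n of \<open>chained_maps_cost\<close> cancels the step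
  length 1/n in front of the action, which therefore appears with constant exactly 1; the errors add
  up to n * n * Q * n^-3 = Q / n.\<close>

lemma W2_sq_le_action:
  "ennreal ((W2 (E (\<theta> 0)) (E (\<theta> 1)))\<^sup>2)
    \<le> (\<integral>\<^sup>+t\<in>{0..1}. (\<integral>\<^sup>+x. ennreal ((norm (v t x))\<^sup>2) \<partial>E (\<theta> t)) \<partial>lborel)"
proof (cases "(\<integral>\<^sup>+t\<in>{0..1}. ennreal (kinetic t) \<partial>lborel) = \<infinity>")
  case True
  moreover have "(\<integral>\<^sup>+t\<in>{0..1}. ennreal (kinetic t) \<partial>lborel)
      = (\<integral>\<^sup>+t\<in>{0..1}. (\<integral>\<^sup>+x. ennreal ((norm (v t x))\<^sup>2) \<partial>E (\<theta> t)) \<partial>lborel)"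
    by (intro nn_integral_cong) (auto simp: kinetic_eq indicator_def)
  ultimately show ?thesis by simp
next
  case False
  note [measurable] = kinetic_measurable
  have eq: "(\<integral>\<^sup>+t\<in>{0..1}. (\<integral>\<^sup>+x. ennreal ((norm (v t x))\<^sup>2) \<partial>E (\<theta> t)) \<partial>lborel)
      = (\<integral>\<^sup>+t\<in>{0..1}. ennreal (kinetic t) \<partial>lborel)"
    by (intro nn_integral_cong) (auto simp: kinetic_eq indicator_def)
  have ind: "ennreal (kinetic t) * indicator {0..1} t = ennreal (indicat_real {0..1} t *\<^sub>R kinetic t)" for t
    by (auto simp: indicator_def)
  have kinetic_int: "set_integrable lborel {0..1} kinetic"
    unfolding set_integrable_def
    by (rule integrableI_nonneg) (use False ind kinetic_nonneg in \<open>auto simp: top.not_eq_extremum\<close>)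
  define I where "I = (LINT t:{0..1}|lborel. kinetic t)"
  have I: "(\<integral>\<^sup>+t\<in>{0..1}. ennreal (kinetic t) \<partial>lborel) = ennreal I"
    unfolding I_def ind set_lebesgue_integral_def
    using kinetic_int kinetic_nonneg by (intro nn_integral_eq_integral) (auto simp: set_integrable_def)
  have i1: "set_integrable lborel {0<..1} kinetic" by (rule set_integrable_subset[OF kinetic_int]) auto
  have I0: "0 \<le> I" unfolding I_def set_lebesgue_integral_def using kinetic_nonneg by (intro integral_nonneg_AE) auto
  define Q where "Q = 9 * K ^ 3 * \<Lambda> ^ 3"
  have Q: "0 \<le> Q" using K_ge(1) \<Lambda> by (simp add: Q_def)
  have bound: "(W2 (E (\<theta> 0)) (E (\<theta> 1)))\<^sup>2 \<le> I + Q / real n" if n: "0 < n" for n :: nat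
  proof -
    define t where "t k = real k / real n" for k
    \<comment> \<open>The cost of \<open>step_cost\<close> for length 1/n. The half-open intervals
      partition \<open>{0<..1}\<close>, so that the actions of the steps add up without
      overlap.\<close>
    define c where "c k = (1 / n) * (LINT s:{t k<..t (Suc k)}|lborel. kinetic s) + Q * (1 / n) ^ 3" for k
    have dt: "t (Suc k) - t k = 1 / n" for k by (simp add: t_def diff_divide_distrib[symmetric])
    have c0: "0 \<le> c k" for k
      unfolding c_def set_lebesgue_integral_def using kinetic_nonneg Q
      by (intro add_nonneg_nonneg mult_nonneg_nonneg integral_nonneg_AE) auto
    have "\<exists>T\<in>borel_measurable borel. E (\<theta> (t n)) = distr (E (\<theta> (t 0))) borel T \<and>
      (\<integral>\<^sup>+x. ennreal ((norm (T x - x))\<^sup>2) \<partial>E (\<theta> (t 0))) \<le> ennreal (real n * (\<Sum>j<n. c j))"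
    proof (rule chained_maps_cost[where \<rho> = "\<lambda>k. E (\<theta> (t k))" and n = n])
      show "sets (E (\<theta> (t k))) = sets borel" for k by (rule sets_E[OF \<theta>_S])
      show "0 \<le> c k" for k by (rule c0)
      fix k assume k: "k < n"
      obtain T f \<psi> where T: "transport_map (\<theta> (t k)) (\<theta> (t (Suc k))) T f \<psi>"
        using transport_map_exists[OF \<theta>_S \<theta>_S] by blast
      have "0 \<le> t k" "t k < t (Suc k)" "t (Suc k) \<le> 1"
        using k n by (auto simp: t_def divide_strict_right_mono)
      from step_cost[OF this T kinetic_int]
      have "(\<integral>\<^sup>+x. ennreal ((norm (T x - x))\<^sup>2) \<partial>E (\<theta> (t k))) \<le> ennreal (c k)"
        unfolding dt c_def Q_def .
      then show "\<exists>T\<in>borel_measurable borel. E (\<theta> (t (Suc k))) = distr (E (\<theta> (t k))) borel T \<and>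
          (\<integral>\<^sup>+x. ennreal ((norm (T x - x))\<^sup>2) \<partial>E (\<theta> (t k))) \<le> ennreal (c k)"
        using T_meas[OF \<theta>_S \<theta>_S T] E_T[OF \<theta>_S \<theta>_S T] by blast
    qed simp
    moreover have t01: "t 0 = 0" "t n = 1" using n by (auto simp: t_def)
    ultimately obtain T where T: "T \<in> borel_measurable borel" "E (\<theta> 1) = distr (E (\<theta> 0)) borel T"
      and cost: "(\<integral>\<^sup>+x. ennreal ((norm (T x - x))\<^sup>2) \<partial>E (\<theta> 0)) \<le> ennreal (real n * (\<Sum>j<n. c j))"
      by auto
    have "(W2 (E (\<theta> 0)) (E (\<theta> 1)))\<^sup>2 \<le> real n * (\<Sum>j<n. c j)"
      unfolding T(2) using c0 by (intro W2_square_le_map[OF sets_E[OF \<theta>_S] T(1) cost] mult_nonneg_nonneg sum_nonneg) auto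
    also have "\<dots> = (\<Sum>j<n. LINT s:{t j<..t (Suc j)}|lborel. kinetic s) + Q / real n"
    proof -
      have "(\<Sum>j<n. c j) = (1 / n) * (\<Sum>j<n. LINT s:{t j<..t (Suc j)}|lborel. kinetic s) + n * (Q * (1 / n) ^ 3)"
        by (simp add: c_def sum.distrib sum_distrib_left)
      then show ?thesis using n by (simp add: field_simps power3_eq_cube)
    qed
    also have "(\<Sum>j<k. LINT s:{t j<..t (Suc j)}|lborel. kinetic s) = (LINT s:{0<..t k}|lborel. kinetic s)" if "k \<le> n" for k
      using that
    proof (induction k)
      case 0 then show ?case by (simp add: t_def set_lebesgue_integral_def)
    next
      case (Suc k)
      have *: "0 \<le> t k" "t k \<le> t (Suc k)" "t (Suc k) \<le> 1"
        using Suc.prems n by (auto simp: t_def divide_right_mono)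
      have "(LINT s:{0<..t k} \<union> {t k<..t (Suc k)}|lborel. kinetic s)
          = (LINT s:{0<..t k}|lborel. kinetic s) + (LINT s:{t k<..t (Suc k)}|lborel. kinetic s)"
        by (rule set_integral_Un) (use * in \<open>auto intro!: set_integrable_subset[OF kinetic_int]\<close>)
      moreover have "{0<..t k} \<union> {t k<..t (Suc k)} = {0<..t (Suc k)}" using * by auto
      ultimately show ?case using Suc by simp
    qed
    then have "(\<Sum>j<n. LINT s:{t j<..t (Suc j)}|lborel. kinetic s) = (LINT s:{0<..1}|lborel. kinetic s)" using t01 by simp
    also have "(LINT s:{0<..1}|lborel. kinetic s) \<le> I"
      unfolding I_def set_lebesgue_integral_def
      using kinetic_int i1 kinetic_nonneg
      by (intro integral_mono) (auto simp: set_integrable_def indicator_def)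
    finally show ?thesis by simp
  qed
  have "(\<lambda>n. I + Q / real n) \<longlonglongrightarrow> I + 0"
    by (intro tendsto_add tendsto_const lim_const_over_n)
  then have "(W2 (E (\<theta> 0)) (E (\<theta> 1)))\<^sup>2 \<le> I"
    using bound by (intro LIMSEQ_le_const[of "\<lambda>n. I + Q / real n"]) (auto intro!: exI[of _ 1])
  then show ?thesis unfolding eq I by (rule ennreal_leI)
qed

end

text \<open>Preimages in \<open>S\<close> may be chosen time by time: \<open>d_le_LW2\<close> makes
  every such choice Lipschitz. The action bound holds for each competing field separately, hence for
  the infimum over the fields and then over the curves.\<close>

lemma W2_le_W2_restr:
  assumes "\<mu> \<in> E ` S" "\<nu> \<in> E ` S"
  shows "ereal (W2 \<mu> \<nu>) \<le> W2_restr \<Omega> (E ` S) \<mu> \<nu>"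
  unfolding W2_restr_def
proof (rule INF_greatest)
  fix \<rho> assume "\<rho> \<in> {\<rho> \<in> lipschitz_curves (E ` S). \<rho> 0 = \<mu> \<and> \<rho> 1 = \<nu>}"
  then have \<rho>_in: "\<And>t. t \<in> {0..1} \<Longrightarrow> \<rho> t \<in> E ` S" and ends: "\<rho> 0 = \<mu>" "\<rho> 1 = \<nu>"
    and "\<exists>L'. \<forall>s\<in>{0..1}. \<forall>t\<in>{0..1}. W2 (\<rho> s) (\<rho> t) \<le> L' * \<bar>s - t\<bar>"
    unfolding lipschitz_curves_def by blast+
  then obtain L' where L': "\<And>s t. s \<in> {0..1} \<Longrightarrow> t \<in> {0..1} \<Longrightarrow> W2 (\<rho> s) (\<rho> t) \<le> L' * \<bar>s - t\<bar>" by blast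
  \<comment> \<open>Freezing the curve outside of the unit interval gives a curve for all real times
    without a larger Lipschitz constant, as the bound on the action expects.\<close>
  define cl where "cl t = max 0 (min 1 t)" for t :: real
  have cl: "cl t \<in> {0..1}" "\<bar>cl s - cl t\<bar> \<le> \<bar>s - t\<bar>" "t \<in> {0..1} \<Longrightarrow> cl t = t" for s t
    by (auto simp: cl_def)
  have "\<forall>t. \<exists>\<theta>\<in>S. E \<theta> = \<rho> (cl t)" using \<rho>_in[OF cl(1)] by (metis imageE)
  then obtain \<tau> where \<tau>: "\<And>t. \<tau> t \<in> S" "\<And>t. E (\<tau> t) = \<rho> (cl t)" by metis
  have \<tau>_lip: "d (\<tau> s) (\<tau> t) \<le> (L * \<bar>L'\<bar>) * \<bar>s - t\<bar>" for s t
  proof -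
    have "d (\<tau> s) (\<tau> t) \<le> L * W2 (\<rho> (cl s)) (\<rho> (cl t))" using d_le_LW2[OF \<tau>(1,1)] \<tau>(2) by simp
    also have "\<dots> \<le> L * (L' * \<bar>cl s - cl t\<bar>)" using L' cl(1) L_nonneg by (intro mult_left_mono) auto
    also have "\<dots> \<le> L * (\<bar>L'\<bar> * \<bar>s - t\<bar>)" using cl(2) L_nonneg by (intro mult_left_mono mult_mono) auto
    finally show ?thesis by (simp add: mult.assoc)
  qed
  have \<tau>_\<rho>: "E (\<tau> t) = \<rho> t" if "t \<in> {0..1}" for t using \<tau>(2) cl(3)[OF that] by simp
  have "ennreal ((W2 \<mu> \<nu>)\<^sup>2) \<le> energy \<Omega> \<rho>"
    unfolding energy_def
  proof (rule INF_greatest)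
    fix v assume v: "v \<in> CE \<Omega> \<rho>"
    have "ennreal ((W2 (E (\<tau> 0)) (E (\<tau> 1)))\<^sup>2)
      \<le> (\<integral>\<^sup>+t\<in>{0..1}. (\<integral>\<^sup>+x. ennreal ((norm (v t x))\<^sup>2) \<partial>E (\<tau> t)) \<partial>lborel)"
    proof (rule W2_sq_le_action[OF \<tau>(1) _ \<tau>_lip])
      show "0 \<le> L * \<bar>L'\<bar>" using L_nonneg by simp
      show "(\<lambda>(t, x). v t x) \<in> borel_measurable borel" using v unfolding CE_def by blast
      show "(\<integral>\<^sup>+x. ennreal ((norm (v t x))\<^sup>2) \<partial>E (\<tau> t)) < \<infinity>" if "t \<in> {0..1}" for t
        using v that \<tau>_\<rho>[OF that] unfolding CE_def by auto
      fix \<phi> \<phi>t \<phi>x assume test: "C1_test \<Omega> \<phi> \<phi>t \<phi>x"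
      have "(LINT t:{0..1}|lborel. (LINT x:\<Omega>|\<rho> t. \<phi>t (t, x)))
        + (LINT t:{0..1}|lborel. (LINT x:\<Omega>|\<rho> t. \<phi>x (t, x) \<bullet> v t x))
        = (LINT x:\<Omega>|\<rho> 1. \<phi> (1, x)) - (LINT x:\<Omega>|\<rho> 0. \<phi> (0, x))"
        using v test unfolding CE_def by blast
      moreover have "(LINT t:{0..1}|lborel. (LINT x:\<Omega>|E (\<tau> t). \<phi>t (t, x))) = (LINT t:{0..1}|lborel. (LINT x:\<Omega>|\<rho> t. \<phi>t (t, x)))"
        by (intro set_lebesgue_integral_cong) (auto simp: \<tau>_\<rho>)
      moreover have "(LINT t:{0..1}|lborel. (LINT x:\<Omega>|E (\<tau> t). \<phi>x (t, x) \<bullet> v t x)) = (LINT t:{0..1}|lborel. (LINT x:\<Omega>|\<rho> t. \<phi>x (t, x) \<bullet> v t x))"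
        by (intro set_lebesgue_integral_cong) (auto simp: \<tau>_\<rho>)
      ultimately show "(LINT t:{0..1}|lborel. (LINT x:\<Omega>|E (\<tau> t). \<phi>t (t, x)))
        + (LINT t:{0..1}|lborel. (LINT x:\<Omega>|E (\<tau> t). \<phi>x (t, x) \<bullet> v t x))
        = (LINT x:\<Omega>|E (\<tau> 1). \<phi> (1, x)) - (LINT x:\<Omega>|E (\<tau> 0). \<phi> (0, x))"
        using \<tau>_\<rho>[of 0] \<tau>_\<rho>[of 1] by simp
    qed
    also have "\<dots> = (\<integral>\<^sup>+t\<in>{0..1}. (\<integral>\<^sup>+x. ennreal ((norm (v t x))\<^sup>2) \<partial>\<rho> t) \<partial>lborel)"
      by (intro nn_integral_cong) (auto simp: \<tau>_\<rho> indicator_def)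
    finally show "ennreal ((W2 \<mu> \<nu>)\<^sup>2) \<le> (\<integral>\<^sup>+t\<in>{0..1}. (\<integral>\<^sup>+x. ennreal ((norm (v t x))\<^sup>2) \<partial>\<rho> t) \<partial>lborel)"
      using \<tau>_\<rho>[of 0] \<tau>_\<rho>[of 1] ends by simp
  qed
  then show "ereal (W2 \<mu> \<nu>) \<le> esqrt (energy \<Omega> \<rho>)" by (rule le_esqrt)
qed

section \<open>Upper bound: the energy of the flow between two points\<close>

context
  fixes \<theta> \<theta>' \<gamma> v X f \<psi>
  assumes \<theta>: "\<theta> \<in> S" "\<theta>' \<in> S" and flow: "transport_flow \<Omega> S d E C \<theta> \<theta>' \<gamma> v X f \<psi>"
begin

lemma flow_facts:
  shows \<gamma>_ends: "\<gamma> 0 = \<theta>" "\<gamma> 1 = \<theta>'"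
    and \<gamma>_S: "t \<in> {0..1} \<Longrightarrow> \<gamma> t \<in> S"
    and \<gamma>_d: "s \<in> {0..1} \<Longrightarrow> t \<in> {0..1} \<Longrightarrow> d (\<gamma> s) (\<gamma> t) = \<bar>s - t\<bar> * d \<theta> \<theta>'"
    and v_cont: "continuous_on UNIV (\<lambda>(t, x). v t x)"
    and X_0: "X 0 x = x" and X_cont: "continuous_on {0..1} (\<lambda>t. X t x)"
    and X_deriv: "x \<in> \<Omega> \<Longrightarrow> t \<in> {0..1} \<Longrightarrow> ((\<lambda>s. X s x) has_vector_derivative v t (X t x)) (at t within {0..1})"
    and X_meas: "t \<in> {0..1} \<Longrightarrow> X t \<in> borel_measurable borel"
    and E_X: "t \<in> {0..1} \<Longrightarrow> E (\<gamma> t) = distr (E \<theta>) borel (X t)"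
  using flow unfolding transport_flow_def by blast+

text \<open>At a fixed time almost every trajectory lies in \<Omega>, because
  \<open>E (\<gamma> t)\<close> lives there, but the null set depends on the time. Rational times
  leave a single null set; continuity of the trajectories and closedness of \<Omega> give the other
  times. Test functions are controlled on \<Omega> only, so whole trajectories must stay
  there.\<close>

lemma AE_flow_support: "AE x in E \<theta>. x \<in> \<Omega> \<and> (\<forall>t\<in>{0..1}. X t x \<in> \<Omega>)"
proof -
  have "AE x in E \<theta>. \<forall>q\<in>\<rat> \<inter> {0..1}. X q x \<in> \<Omega>"
    by (subst AE_ball_countable)
      (auto intro!: AE_map_support[OF \<theta>(1) \<gamma>_S E_X X_meas] countable_Int1 countable_rat)
  with AE_support[OF \<theta>(1)] show ?thesis
  proof eventually_elim
    fix x assume x: "x \<in> \<Omega>" and q: "\<forall>q\<in>\<rat> \<inter> {0..1}. X q x \<in> \<Omega>"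
    have closure: "closure ({0<..<1} \<inter> \<rat>) = {0..1::real}"
      by (subst closure_open_Int_superset) (auto simp: Rats_closure_real)
    have "(\<lambda>t. X t x) ` closure ({0<..<1} \<inter> \<rat>) \<subseteq> \<Omega>"
      by (rule image_closure_subset[OF _ closed_support]) (use q X_cont in \<open>auto simp: closure\<close>)
    then have "\<forall>t\<in>{0..1}. X t x \<in> \<Omega>" unfolding closure by blast
    then show "x \<in> \<Omega> \<and> (\<forall>t\<in>{0..1}. X t x \<in> \<Omega>)" using x by blast
  qed
qed

text \<open>Fubini after pulling \<open>E (\<gamma> t)\<close> back to \<open>E \<theta>\<close>.
  \<open>J\<close> is only asserted to exist because it is the time integral of \<open>h\<close>
  along those trajectories alone that stay in \<Omega>; off \<Omega>, \<open>h\<close> is replaced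
  by 0.\<close>

lemma flow_fubini:
  fixes h :: "real \<times> 'a \<Rightarrow> real"
  assumes h: "continuous_on ({0..1} \<times> \<Omega>) h"
  shows "\<exists>J. integrable (E \<theta>) J \<and>
    (LINT t:{0..1}|lborel. (LINT x:\<Omega>|E (\<gamma> t). h (t, x))) = (\<integral>x. J x \<partial>E \<theta>) \<and>
    (\<forall>x\<in>\<Omega>. (\<forall>t\<in>{0..1}. X t x \<in> \<Omega>) \<longrightarrow> J x = (LINT t:{0..1}|lborel. h (t, X t x)))"
proof -
  define h' where "h' z = indicat_real ({0..1} \<times> \<Omega>) z *\<^sub>R h z" for z
  have comp: "compact ({0..1::real} \<times> \<Omega>)" by (intro compact_Times compact_Icc compact_support)
  then have h'm: "h' \<in> borel_measurable borel"
    unfolding h'_def[abs_def]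
    by (intro borel_measurable_continuous_on_indicator h borel_compact)
  then have [measurable]: "h' \<in> borel_measurable (borel \<Otimes>\<^sub>M borel)" by (simp add: borel_prod)
  obtain B where B: "0 \<le> B" "\<And>z. z \<in> {0..1} \<times> \<Omega> \<Longrightarrow> norm (h z) \<le> B"
  proof -
    have "bounded (h ` ({0..1} \<times> \<Omega>))"
      by (intro compact_imp_bounded compact_continuous_image h comp)
    then obtain b where b: "\<And>z. z \<in> {0..1} \<times> \<Omega> \<Longrightarrow> norm (h z) \<le> b" unfolding bounded_iff by blast
    show thesis by (rule that[of "max 0 b"]) (use b in \<open>auto simp: le_max_iff_disj\<close>)
  qed
  have h'B: "norm (h' z) \<le> B" for z using B by (auto simp: h'_def indicator_def)
  \<comment> \<open>Clamping the time gives continuity on the whole line, as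
    \<open>borel_measurable_caratheodory\<close> expects. This yields joint measurability of a flow
    whose measurability was known at each time separately.\<close>
  define Y where "Y t = X (max 0 (min 1 t))" for t
  have Ym: "Y t \<in> borel_measurable borel" for t unfolding Y_def by (rule X_meas) auto
  have Yc: "continuous_on UNIV (\<lambda>t. Y t x)" for x
    unfolding Y_def by (intro continuous_on_compose2[OF X_cont] continuous_intros) auto
  have [measurable]: "(\<lambda>(t, x). Y t x) \<in> borel_measurable (borel \<Otimes>\<^sub>M borel)"
    by (rule borel_measurable_caratheodory[OF Ym Yc])
  have Y_X: "Y t = X t" if "t \<in> {0..1}" for t using that by (auto simp: Y_def)
  interpret E: prob_space "E \<theta>" by (rule prob_E[OF \<theta>(1)])
  interpret P: pair_sigma_finite lborel "E \<theta>" by unfold_locales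
  note [measurable_cong] = sets_E[OF \<theta>(1)]
  define H where "H t x = indicat_real {0..1} t *\<^sub>R h' (t, Y t x)" for t x
  have Hm: "case_prod H \<in> borel_measurable (lborel \<Otimes>\<^sub>M E \<theta>)"
    unfolding H_def[abs_def] by measurable
  have Hi: "integrable (lborel \<Otimes>\<^sub>M E \<theta>) (case_prod H)"
  proof (rule integrableI_bounded_set[where A = "{0..1::real} \<times> space (E \<theta>)" and B = B])
    show "{0..1::real} \<times> space (E \<theta>) \<in> sets (lborel \<Otimes>\<^sub>M E \<theta>)" by (intro pair_measureI) auto
    show "emeasure (lborel \<Otimes>\<^sub>M E \<theta>) ({0..1::real} \<times> space (E \<theta>)) < \<infinity>"
      by (subst E.emeasure_pair_measure_Times) (auto simp: E.emeasure_space_1)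
  qed (use Hm h'B B(1) in \<open>auto simp: H_def indicator_def space_pair_measure\<close>)
  define J where "J x = (\<integral>t. H t x \<partial>lborel)" for x
  have "integrable (E \<theta>) J" unfolding J_def by (rule P.integrable_snd[OF Hi])
  moreover have "(LINT t:{0..1}|lborel. (LINT x:\<Omega>|E (\<gamma> t). h (t, x))) = (\<integral>x. J x \<partial>E \<theta>)"
  proof -
    have "(LINT x:\<Omega>|E (\<gamma> t). h (t, x)) = (\<integral>x. h' (t, Y t x) \<partial>E \<theta>)" if t: "t \<in> {0..1}" for t
    proof -
      have "(LINT x:\<Omega>|E (\<gamma> t). h (t, x)) = (\<integral>x. h' (t, x) \<partial>E (\<gamma> t))"
        unfolding set_lebesgue_integral_def h'_def using t
        by (intro Bochner_Integration.integral_cong) (auto simp: indicator_def)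
      also have "\<dots> = (\<integral>x. h' (t, X t x) \<partial>E \<theta>)"
        by (rule integral_distr_E[OF \<theta>(1) E_X[OF t] X_meas[OF t]]) measurable
      finally show ?thesis by (simp add: Y_X[OF t])
    qed
    then have "(LINT t:{0..1}|lborel. (LINT x:\<Omega>|E (\<gamma> t). h (t, x))) = (LINT t:{0..1}|lborel. (\<integral>x. h' (t, Y t x) \<partial>E \<theta>))"
      by (intro set_lebesgue_integral_cong) auto
    also have "\<dots> = (\<integral>t. (\<integral>x. H t x \<partial>E \<theta>) \<partial>lborel)"
      unfolding set_lebesgue_integral_def H_def by simp
    also have "\<dots> = (\<integral>x. J x \<partial>E \<theta>)" unfolding J_def by (rule P.Fubini_integral[OF Hi, symmetric])
    finally show ?thesis .
  qed
  moreover have "J x = (LINT t:{0..1}|lborel. h (t, X t x))" if "x \<in> \<Omega>" "\<forall>t\<in>{0..1}. X t x \<in> \<Omega>" for x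
    unfolding J_def set_lebesgue_integral_def
    by (intro Bochner_Integration.integral_cong) (use that in \<open>auto simp: H_def h'_def Y_X indicator_def\<close>)
  ultimately show ?thesis by blast
qed

text \<open>The chain rule: \<open>\<phi> (t, X t x)\<close> has time derivative
  \<open>\<phi>t + \<phi>x \<bullet> v\<close> along a trajectory. This is integrated in time for
  trajectories that stay in \<Omega>, then over the starting points, almost all of which have such
  trajectories.\<close>

lemma flow_CE: "v \<in> CE \<Omega> (\<lambda>t. E (\<gamma> t))"
  unfolding CE_def
proof (intro CollectI conjI ballI allI impI)
  show "(\<lambda>(t, x). v t x) \<in> borel_measurable borel"
    by (rule borel_measurable_continuous_onI[OF v_cont])
  show "(\<integral>\<^sup>+x. ennreal ((norm (v t x))\<^sup>2) \<partial>E (\<gamma> t)) < \<infinity>" if t: "t \<in> {0..1}" for t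
  proof -
    interpret prob_space "E (\<gamma> t)" by (rule prob_E[OF \<gamma>_S[OF t]])
    have "(\<integral>\<^sup>+x. ennreal ((norm (v t x))\<^sup>2) \<partial>E (\<gamma> t)) \<le> (\<integral>\<^sup>+x. ennreal ((K * d \<theta> \<theta>')\<^sup>2) \<partial>E (\<gamma> t))"
      by (intro nn_integral_mono ennreal_leI power_mono flow_estimates(2)[OF \<theta> flow t]) auto
    also have "\<dots> < \<infinity>" by (simp add: emeasure_space_1)
    finally show ?thesis .
  qed
  fix \<phi> \<phi>t \<phi>x assume test: "C1_test \<Omega> \<phi> \<phi>t \<phi>x"
  have \<phi>t: "continuous_on ({0..1} \<times> \<Omega>) \<phi>t" and \<phi>x: "continuous_on ({0..1} \<times> \<Omega>) \<phi>x"
    and d\<phi>: "\<And>z. z \<in> {0..1} \<times> \<Omega> \<Longrightarrow>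
      (\<phi> has_derivative (\<lambda>(s, y). s * \<phi>t z + \<phi>x z \<bullet> y)) (at z within {0..1} \<times> \<Omega>)"
    using test unfolding C1_test_def by blast+
  have \<phi>: "continuous_on ({0..1} \<times> \<Omega>) \<phi>"
    using d\<phi> has_derivative_continuous continuous_on_eq_continuous_within by blast
  have \<phi>v: "continuous_on ({0..1} \<times> \<Omega>) (\<lambda>z. \<phi>x z \<bullet> v (fst z) (snd z))"
    using continuous_on_subset[OF v_cont, of "{0..1} \<times> \<Omega>"]
    by (intro continuous_on_inner \<phi>x) (simp add: case_prod_unfold)
  obtain J1 where J1: "integrable (E \<theta>) J1"
    "(LINT t:{0..1}|lborel. (LINT x:\<Omega>|E (\<gamma> t). \<phi>t (t, x))) = (\<integral>x. J1 x \<partial>E \<theta>)"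
    "\<And>x. x \<in> \<Omega> \<Longrightarrow> (\<forall>t\<in>{0..1}. X t x \<in> \<Omega>) \<Longrightarrow> J1 x = (LINT t:{0..1}|lborel. \<phi>t (t, X t x))"
    using flow_fubini[OF \<phi>t] by blast
  obtain J2 where J2: "integrable (E \<theta>) J2"
    "(LINT t:{0..1}|lborel. (LINT x:\<Omega>|E (\<gamma> t). \<phi>x (t, x) \<bullet> v t x)) = (\<integral>x. J2 x \<partial>E \<theta>)"
    "\<And>x. x \<in> \<Omega> \<Longrightarrow> (\<forall>t\<in>{0..1}. X t x \<in> \<Omega>) \<Longrightarrow>
      J2 x = (LINT t:{0..1}|lborel. \<phi>x (t, X t x) \<bullet> v t (X t x))"
    using flow_fubini[OF \<phi>v] unfolding fst_conv snd_conv by blast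
  have sect: "(\<lambda>x. indicat_real \<Omega> x *\<^sub>R \<phi> (t, x)) \<in> borel_measurable borel" if "t \<in> {0..1}" for t
    using that by (intro borel_measurable_continuous_on_indicator continuous_on_compose2[OF \<phi>])
      (auto intro!: continuous_intros)
  have slice: "(LINT x:\<Omega>|E (\<gamma> t). \<phi> (t, x)) = (\<integral>x. indicat_real \<Omega> (X t x) *\<^sub>R \<phi> (t, X t x) \<partial>E \<theta>)"
    if t: "t \<in> {0..1}" for t
    unfolding set_lebesgue_integral_def
    by (rule integral_distr_E[OF \<theta>(1) E_X[OF t] X_meas[OF t] sect[OF t]])
  obtain B where B: "\<And>z. z \<in> {0..1} \<times> \<Omega> \<Longrightarrow> norm (\<phi> z) \<le> B"
  proof -
    have "bounded (\<phi> ` ({0..1} \<times> \<Omega>))"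
      by (intro compact_imp_bounded compact_continuous_image \<phi> compact_Times compact_Icc compact_support)
    then show thesis using that unfolding bounded_iff by blast
  qed
  have slice_int: "integrable (E \<theta>) (\<lambda>x. indicat_real \<Omega> (X t x) *\<^sub>R \<phi> (t, X t x))" if t: "t \<in> {0..1}" for t
  proof (rule integrable_E[OF \<theta>(1), where B = "\<bar>B\<bar>"])
    show "(\<lambda>x. indicat_real \<Omega> (X t x) *\<^sub>R \<phi> (t, X t x)) \<in> borel_measurable borel"
      using measurable_compose[OF X_meas[OF t] sect[OF t]] .
    show "norm (indicat_real \<Omega> (X t x) *\<^sub>R \<phi> (t, X t x)) \<le> \<bar>B\<bar>" for x
      using B[of "(t, X t x)"] t by (auto simp: indicator_def)
  qed
  have newton: "J1 x + J2 x = \<phi> (1, X 1 x) - \<phi> (0, X 0 x)" if x: "x \<in> \<Omega>" and Xx: "\<forall>t\<in>{0..1}. X t x \<in> \<Omega>" for x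
  proof -
    have c: "continuous_on {0..1} (\<lambda>t. (t, X t x))" by (rule continuous_on_Pair[OF continuous_on_id X_cont])
    have c1: "continuous_on {0..1} (\<lambda>t. \<phi>t (t, X t x))"
      by (rule continuous_on_compose2[OF \<phi>t c]) (use Xx in auto)
    have c2: "continuous_on {0..1} (\<lambda>t. \<phi>x (t, X t x) \<bullet> v t (X t x))"
      using continuous_on_compose2[OF \<phi>v c] Xx by auto
    note i1 = borel_integrable_atLeastAtMost'[OF c1] and i2 = borel_integrable_atLeastAtMost'[OF c2]
    have "J1 x + J2 x = (LINT t:{0..1}|lborel. \<phi>t (t, X t x) + \<phi>x (t, X t x) \<bullet> v t (X t x))"
      using J1(3)[OF x Xx] J2(3)[OF x Xx] set_integral_add(2)[OF i1 i2] by simp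
    also have "\<dots> = integral {0..1} (\<lambda>t. \<phi>t (t, X t x) + \<phi>x (t, X t x) \<bullet> v t (X t x))"
      by (rule set_borel_integral_eq_integral(2)[OF set_integral_add(1)[OF i1 i2]])
    also have "\<dots> = \<phi> (1, X 1 x) - \<phi> (0, X 0 x)"
    proof (rule integral_unique, rule fundamental_theorem_of_calculus)
      fix t :: real assume t: "t \<in> {0..1}"
      have "((\<lambda>s. (s, X s x)) has_derivative (\<lambda>h. (h, h *\<^sub>R v t (X t x)))) (at t within {0..1})"
        using X_deriv[OF x t] by (intro has_derivative_Pair has_derivative_ident) (simp add: has_vector_derivative_def)
      \<comment> \<open>\<open>C1_test\<close> gives a derivative relative to
        \<open>{0..1} \<times> \<Omega>\<close> only. It may be restricted to the graph of the
        trajectory because that graph is contained in this set.\<close>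
      moreover have "(\<phi> has_derivative (\<lambda>(s, y). s * \<phi>t (t, X t x) + \<phi>x (t, X t x) \<bullet> y))
          (at (t, X t x) within (\<lambda>s. (s, X s x)) ` {0..1})"
        by (rule has_derivative_subset[OF d\<phi>]) (use t Xx in auto)
      ultimately have "((\<lambda>s. \<phi> (s, X s x)) has_derivative
          (\<lambda>h. (\<lambda>(s, y). s * \<phi>t (t, X t x) + \<phi>x (t, X t x) \<bullet> y) (h, h *\<^sub>R v t (X t x)))) (at t within {0..1})"
        by (rule has_derivative_in_compose)
      then show "((\<lambda>s. \<phi> (s, X s x)) has_vector_derivative \<phi>t (t, X t x) + \<phi>x (t, X t x) \<bullet> v t (X t x)) (at t within {0..1})"
        by (simp add: has_vector_derivative_def algebra_simps)
    qed simp
    finally show ?thesis .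
  qed
  have "(\<integral>x. J1 x + J2 x \<partial>E \<theta>)
      = (\<integral>x. indicat_real \<Omega> (X 1 x) *\<^sub>R \<phi> (1, X 1 x) - indicat_real \<Omega> (X 0 x) *\<^sub>R \<phi> (0, X 0 x) \<partial>E \<theta>)"
  proof (rule integral_cong_AE)
    show "AE x in E \<theta>. J1 x + J2 x = indicat_real \<Omega> (X 1 x) *\<^sub>R \<phi> (1, X 1 x) - indicat_real \<Omega> (X 0 x) *\<^sub>R \<phi> (0, X 0 x)"
      using AE_flow_support by eventually_elim (simp add: newton)
  qed (use J1(1) J2(1) slice_int[of 0] slice_int[of 1] in auto)
  then show "(LINT t:{0..1}|lborel. (LINT x:\<Omega>|E (\<gamma> t). \<phi>t (t, x)))
        + (LINT t:{0..1}|lborel. (LINT x:\<Omega>|E (\<gamma> t). \<phi>x (t, x) \<bullet> v t x))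
        = (LINT x:\<Omega>|E (\<gamma> 1). \<phi> (1, x)) - (LINT x:\<Omega>|E (\<gamma> 0). \<phi> (0, x))"
    using J1(1,2) J2(1,2) slice[of 0] slice[of 1] slice_int[of 0] slice_int[of 1] by simp
qed

text \<open>The bound holds at every single time: replacing the velocity along trajectories by
  \<open>f\<close> costs 3, and comparing \<open>f\<close> with \<open>W2\<close> in
  \<open>f_sq_le_W2\<close> costs 6, which makes 9.\<close>

lemma flow_energy:
  "energy \<Omega> (\<lambda>t. E (\<gamma> t)) \<le> ennreal ((W2 (E \<theta>) (E \<theta>'))\<^sup>2 + 9 * K ^ 3 * (d \<theta> \<theta>') ^ 3)"
proof -
  note T = flow_estimates(1)[OF \<theta> flow]
  define c where "c = (W2 (E \<theta>) (E \<theta>'))\<^sup>2 + 9 * K ^ 3 * (d \<theta> \<theta>') ^ 3"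
  have slice: "(\<integral>\<^sup>+x. ennreal ((norm (v t x))\<^sup>2) \<partial>E (\<gamma> t)) \<le> ennreal c" if t: "t \<in> {0..1}" for t
  proof -
    have "continuous_on UNIV (v t)"
      using continuous_on_compose2[OF v_cont continuous_on_Pair[OF continuous_on_const continuous_on_id]] by simp
    then have [measurable]: "v t \<in> borel_measurable borel" by (rule borel_measurable_continuous_onI)
    have [measurable]: "X t \<in> borel_measurable (E \<theta>)" by (rule measurable_E[OF \<theta>(1) X_meas[OF t]])
    have "(\<integral>\<^sup>+x. ennreal ((norm (v t x))\<^sup>2) \<partial>E (\<gamma> t)) = (\<integral>\<^sup>+x. ennreal ((norm (v t (X t x)))\<^sup>2) \<partial>E \<theta>)"
      unfolding E_X[OF t] by (rule nn_integral_distr) measurable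
    also have "\<dots> \<le> ennreal ((\<integral>x. (norm (f x))\<^sup>2 \<partial>E \<theta>) + 3 * K ^ 3 * (d \<theta> \<theta>') ^ 3)"
      by (rule nn_integral_square_perturbation[OF \<theta> T]) (rule flow_estimates(3)[OF \<theta> flow _ t])
    also have "\<dots> \<le> ennreal c"
      using f_sq_le_W2[OF \<theta> T] unfolding c_def by (intro ennreal_leI) linarith
    finally show ?thesis .
  qed
  have "energy \<Omega> (\<lambda>t. E (\<gamma> t)) \<le> (\<integral>\<^sup>+t\<in>{0..1}. (\<integral>\<^sup>+x. ennreal ((norm (v t x))\<^sup>2) \<partial>E (\<gamma> t)) \<partial>lborel)"
    unfolding energy_def by (rule INF_lower[OF flow_CE])
  also have "\<dots> \<le> (\<integral>\<^sup>+t\<in>{0..1::real}. ennreal c \<partial>lborel)"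
    by (intro nn_integral_mono) (auto simp: indicator_def slice)
  also have "\<dots> = ennreal c" by (simp add: nn_integral_cmult_indicator)
  finally show ?thesis unfolding c_def .
qed

lemma flow_lipschitz_curve: "(\<lambda>t. E (\<gamma> t)) \<in> lipschitz_curves (E ` S)"
  unfolding lipschitz_curves_def
proof (intro CollectI conjI ballI exI)
  show "E (\<gamma> t) \<in> E ` S" if "t \<in> {0..1}" for t using \<gamma>_S[OF that] by blast
  show "W2 (E (\<gamma> s)) (E (\<gamma> t)) \<le> (L * d \<theta> \<theta>') * \<bar>s - t\<bar>" if "s \<in> {0..1}" "t \<in> {0..1}" for s t
    using W2_le_Ld[OF \<gamma>_S[OF that(1)] \<gamma>_S[OF that(2)]] \<gamma>_d[OF that] by (simp add: mult_ac)
qed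

end

lemma W2_restr_le:
  assumes \<theta>: "\<theta> \<in> S" "\<theta>' \<in> S"
  shows "W2_restr \<Omega> (E ` S) (E \<theta>) (E \<theta>') \<le> ereal (W2 (E \<theta>) (E \<theta>') + 5 * K ^ 6 * (W2 (E \<theta>) (E \<theta>'))\<^sup>2)"
proof -
  obtain \<gamma> v X f \<psi> where flow: "transport_flow \<Omega> S d E C \<theta> \<theta>' \<gamma> v X f \<psi>" using flow_exists[OF \<theta>] by blast
  define W where "W = W2 (E \<theta>) (E \<theta>')"
  define \<epsilon> where "\<epsilon> = d \<theta> \<theta>'"
  have W: "0 \<le> W" unfolding W_def W2_def by simp
  have "\<epsilon> \<le> K * W" using d_le_LW2[OF \<theta>] mult_right_mono[OF K_ge(3) W] by (simp add: W_def \<epsilon>_def)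
  then have "K ^ 3 * \<epsilon> ^ 3 \<le> K ^ 3 * (K * W) ^ 3"
    using d_nonneg K_ge(1) by (intro mult_left_mono power_mono) (auto simp: \<epsilon>_def)
  also have "\<dots> = K ^ 6 * W ^ 3" by (simp add: power_mult_distrib flip: power_add)
  finally have "K ^ 3 * \<epsilon> ^ 3 \<le> K ^ 6 * W ^ 3" .
  moreover have "0 \<le> K ^ 6 * W ^ 3" using W by simp
  \<comment> \<open>Completing the square: 9 is rounded up to 10 = 2 * 5, so that the cubic term is
    the cross term of the square below. The power \<open>K^6\<close> collects \<open>K^3\<close>
    from the error and \<open>K^3\<close> from \<open>\<epsilon> \<le> K * W\<close>.\<close>
  ultimately have "W\<^sup>2 + 9 * K ^ 3 * \<epsilon> ^ 3 \<le> W\<^sup>2 + 10 * (K ^ 6 * W ^ 3) + (5 * K ^ 6 * W\<^sup>2)\<^sup>2"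
    using zero_le_power2[of "5 * K ^ 6 * W\<^sup>2"] by linarith
  also have "\<dots> = (W + 5 * K ^ 6 * W\<^sup>2)\<^sup>2"
    by (simp add: power2_sum power2_eq_square power3_eq_cube algebra_simps)
  finally have *: "W\<^sup>2 + 9 * K ^ 3 * \<epsilon> ^ 3 \<le> (W + 5 * K ^ 6 * W\<^sup>2)\<^sup>2" .
  have "W2_restr \<Omega> (E ` S) (E \<theta>) (E \<theta>') \<le> esqrt (energy \<Omega> (\<lambda>t. E (\<gamma> t)))"
    unfolding W2_restr_def
    by (rule INF_lower) (simp add: flow_lipschitz_curve[OF \<theta> flow] \<gamma>_ends[OF \<theta> flow])
  also have "\<dots> \<le> ereal (W + 5 * K ^ 6 * W\<^sup>2)"
  proof (rule esqrt_le)
    show "energy \<Omega> (\<lambda>t. E (\<gamma> t)) \<le> ennreal ((W + 5 * K ^ 6 * W\<^sup>2)\<^sup>2)"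
      using flow_energy[OF \<theta> flow, folded W_def \<epsilon>_def] ennreal_leI[OF *] by (rule order_trans)
  qed (use W K_ge(1) in simp)
  finally show ?thesis by (simp add: W_def)
qed

lemma W2_restr_deviation:
  "\<exists>C::real. 0 < C \<and> (\<forall>\<mu>\<in>E ` S. \<forall>\<nu>\<in>E ` S. \<mu> \<noteq> \<nu> \<longrightarrow>
    0 \<le> (W2_restr \<Omega> (E ` S) \<mu> \<nu> - ereal (W2 \<mu> \<nu>)) / ereal ((W2 \<mu> \<nu>)\<^sup>2) \<and>
    (W2_restr \<Omega> (E ` S) \<mu> \<nu> - ereal (W2 \<mu> \<nu>)) / ereal ((W2 \<mu> \<nu>)\<^sup>2) \<le> ereal C)"
proof (intro exI conjI ballI impI)
  show "0 < 5 * K ^ 6" using K_ge(1) by simp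
  fix \<mu> \<nu> assume \<mu>: "\<mu> \<in> E ` S" and \<nu>: "\<nu> \<in> E ` S"
  define W where "W = W2 \<mu> \<nu>"
  have W: "0 \<le> W" unfolding W_def W2_def by simp
  have lower: "ereal W \<le> W2_restr \<Omega> (E ` S) \<mu> \<nu>" unfolding W_def by (rule W2_le_W2_restr[OF \<mu> \<nu>])
  have upper: "W2_restr \<Omega> (E ` S) \<mu> \<nu> \<le> ereal (W + 5 * K ^ 6 * W\<^sup>2)"
    using \<mu> \<nu> W2_restr_le unfolding W_def by blast
  obtain r where r: "W2_restr \<Omega> (E ` S) \<mu> \<nu> = ereal r"
    using lower upper by (cases "W2_restr \<Omega> (E ` S) \<mu> \<nu>") auto
  have rW: "0 \<le> r - W" "r - W \<le> 5 * K ^ 6 * W\<^sup>2" using lower upper unfolding r by auto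
  have "0 \<le> (ereal r - ereal W) / ereal (W\<^sup>2) \<and> (ereal r - ereal W) / ereal (W\<^sup>2) \<le> ereal (5 * K ^ 6)"
  proof (cases "W = 0")
    \<comment> \<open>Here the two bounds force the numerator to be 0, and the quotient is 0 *
      \<infinity> = 0 in the extended reals.\<close>
    case True
    then have "r = 0" using rW by simp
    then show ?thesis using True K_ge(1) by (simp add: divide_ereal_def)
  next
    case False
    then show ?thesis using rW W by (simp add: pos_divide_le_eq)
  qed
  then show "0 \<le> (W2_restr \<Omega> (E ` S) \<mu> \<nu> - ereal (W2 \<mu> \<nu>)) / ereal ((W2 \<mu> \<nu>)\<^sup>2)"
    "(W2_restr \<Omega> (E ` S) \<mu> \<nu> - ereal (W2 \<mu> \<nu>)) / ereal ((W2 \<mu> \<nu>)\<^sup>2) \<le> ereal (5 * K ^ 6)"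
    unfolding r W_def[symmetric] by blast+
qed

end

section \<open>The parameter manifold\<close>

text \<open>The chain rule for the change of charts. The regularity of \<open>B\<close> is assumed
  for tangent vectors only; this makes it available for the velocities at all times of a
  geodesic.\<close>

lemma velocity_in_tangent_space:
  assumes atlas: "smooth_atlas A" and t: "t \<in> {0..1}" and diff: "curve_differentiable_at A \<gamma> t"
  shows "velocity A \<gamma> t \<in> tangent_space A (\<gamma> t)"
  unfolding tangent_space_def
proof (intro CollectI conjI ballI impI allI)
  show "velocity A \<gamma> t c = 0" if "\<not> (c \<in> A \<and> \<gamma> t \<in> fst c)" for c
    using that by (auto simp: velocity_def)
  fix c c' assume c: "c \<in> A" "c' \<in> A" "\<gamma> t \<in> fst c" "\<gamma> t \<in> fst c'"
  define F where "F = snd c' \<circ> chart_inv c"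
  define F' where "F' = frechet_derivative F (at (snd c (\<gamma> t)))"
  have op: "open (fst c)" and inv: "\<And>p. p \<in> fst c \<Longrightarrow> chart_inv c (snd c p) = p"
    using atlas c unfolding smooth_atlas_def homeomorphism_def by blast+
  have "smooth_on (snd c ` (fst c \<inter> fst c')) F"
    using atlas c unfolding smooth_atlas_def F_def by blast
  then have "Ck_on (Suc 0) (snd c ` (fst c \<inter> fst c')) F" unfolding smooth_on_def by blast
  then have "F differentiable (at (snd c (\<gamma> t)))" using c by auto
  then have F': "(F has_derivative F') (at (snd c (\<gamma> t)))" unfolding F'_def by (rule frechet_derivative_works[THEN iffD1])
  have vel: "((snd c \<circ> \<gamma>) has_vector_derivative velocity A \<gamma> t c) (at t within {0..1})"
    using diff c vector_derivative_works by (auto simp: curve_differentiable_at_def velocity_def)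
  have lin: "linear F'" using F' has_derivative_linear by blast
  have "((\<lambda>s. F ((snd c \<circ> \<gamma>) s)) has_derivative (\<lambda>h. F' (h *\<^sub>R velocity A \<gamma> t c))) (at t within {0..1})"
    by (rule has_derivative_in_compose[OF vel[unfolded has_vector_derivative_def]])
      (use F' in \<open>auto intro: has_derivative_at_withinI\<close>)
  \<comment> \<open>Off its chart a coordinate map is arbitrary, so \<open>F\<close> carries one
    coordinate expression of the curve to the other only while the curve is in \<open>fst c\<close>.
    Continuity of the curve ensures this near \<open>t\<close>, which is enough for the
    derivative.\<close>
  moreover have "\<forall>\<^sub>F s in at t within {0..1}. F ((snd c \<circ> \<gamma>) s) = (snd c' \<circ> \<gamma>) s"
  proof -
    have "(\<gamma> \<longlongrightarrow> \<gamma> t) (at t within {0..1})"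
      using diff unfolding curve_differentiable_at_def continuous_within by blast
    then have "\<forall>\<^sub>F s in at t within {0..1}. \<gamma> s \<in> fst c" using op c(3) by (rule topological_tendstoD)
    then show ?thesis by eventually_elim (simp add: F_def inv)
  qed
  moreover have "F ((snd c \<circ> \<gamma>) t) = (snd c' \<circ> \<gamma>) t" using c by (simp add: F_def inv)
  ultimately have "((snd c' \<circ> \<gamma>) has_derivative (\<lambda>h. F' (h *\<^sub>R velocity A \<gamma> t c))) (at t within {0..1})"
    using t by (rule has_derivative_transform_eventually)
  then have "((snd c' \<circ> \<gamma>) has_vector_derivative F' (velocity A \<gamma> t c)) (at t within {0..1})"
    unfolding has_vector_derivative_def by (simp add: linear_scale[OF lin])
  then have "vector_derivative (snd c' \<circ> \<gamma>) (at t within {0..1}) = F' (velocity A \<gamma> t c)"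
    by (rule vector_derivative_within_closed_interval[OF _ t, rotated]) simp
  then show "velocity A \<gamma> t c' = frechet_derivative (snd c' \<circ> chart_inv c) (at (snd c (\<gamma> t))) (velocity A \<gamma> t c)"
    using c by (simp add: velocity_def F'_def F_def)
qed

text \<open>The Lipschitz bound in time is uniform in space, so moving \<open>s\<close> to
  \<open>t\<close> first leaves only the spatial continuity at the fixed time
  \<open>t\<close>.\<close>

lemma continuous_on_pair_lipschitz:
  fixes v :: "real \<Rightarrow> 'a::metric_space \<Rightarrow> 'b::real_normed_vector"
  assumes lip: "\<And>s t x. norm (v s x - v t x) \<le> M * \<bar>s - t\<bar>" and cont: "\<And>t. continuous_on UNIV (v t)"
  shows "continuous_on UNIV (\<lambda>(t, x). v t x)"
  unfolding continuous_on_def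
proof
  fix z :: "real \<times> 'a"
  obtain t x where z: "z = (t, x)" by (cases z) blast
  have 1: "((\<lambda>w. v t (snd w) - v t x) \<longlongrightarrow> 0) (at z)"
  proof -
    have "isCont (v t) x" using cont by (simp add: continuous_on_eq_continuous_at)
    moreover have "((\<lambda>w. snd w) \<longlongrightarrow> x) (at z)" using tendsto_snd[OF tendsto_ident_at, of z] by (simp add: z)
    ultimately have "((\<lambda>w. v t (snd w)) \<longlongrightarrow> v t x) (at z)" by (rule isCont_tendsto_compose)
    then show ?thesis by (rule LIM_zero)
  qed
  have 2: "((\<lambda>w. v (fst w) (snd w) - v t (snd w)) \<longlongrightarrow> 0) (at z)"
  proof (rule Lim_null_comparison[OF always_eventually])
    show "\<forall>w. norm (v (fst w) (snd w) - v t (snd w)) \<le> M * \<bar>fst w - t\<bar>" using lip by blast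
    have "((\<lambda>w. fst w) \<longlongrightarrow> t) (at z)" using tendsto_fst[OF tendsto_ident_at, of z] by (simp add: z)
    then have "((\<lambda>w. \<bar>fst w - t\<bar>) \<longlongrightarrow> 0) (at z)"
      using LIM_zero tendsto_rabs_zero by blast
    then show "((\<lambda>w. M * \<bar>fst w - t\<bar>) \<longlongrightarrow> 0) (at z)" by (rule tendsto_mult_right_zero)
  qed
  have "((\<lambda>w. v (fst w) (snd w) - v t x) \<longlongrightarrow> 0) (at z)"
    using tendsto_add[OF 2 1] by simp
  then have "((\<lambda>w. v (fst w) (snd w)) \<longlongrightarrow> v t x) (at z)" by (rule LIM_zero_cancel)
  then show "((\<lambda>(t, x). v t x) \<longlongrightarrow> (case z of (t, x) \<Rightarrow> v t x)) (at z)"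
    by (simp add: z case_prod_unfold)
qed

lemma C1_norm_bounds:
  fixes f :: "'a::euclidean_space \<Rightarrow> 'a"
  assumes norm: "C1_norm f \<le> ennreal M" and M: "0 \<le> M" and diff: "\<And>x. f differentiable (at x)"
  shows "norm (f x) \<le> M" and "norm (f x - f y) \<le> M * norm (x - y)"
proof -
  have "ennreal (norm (f x)) \<le> C1_norm f" for x
    unfolding C1_norm_def by (intro max.coboundedI1 SUP_upper) simp
  then have "ennreal (norm (f x)) \<le> ennreal M" for x using norm order_trans by blast
  then show "norm (f x) \<le> M" using M by simp
  have "ennreal (onorm (frechet_derivative f (at x))) \<le> C1_norm f" for x
    unfolding C1_norm_def by (intro max.coboundedI2 SUP_upper) simp
  then have "ennreal (onorm (frechet_derivative f (at x))) \<le> ennreal M" for x using norm order_trans by blast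
  then have "onorm (frechet_derivative f (at x)) \<le> M" for x using M by simp
  then show "norm (f x - f y) \<le> M * norm (x - y)"
    by (intro differentiable_bound[of UNIV f "\<lambda>x. frechet_derivative f (at x)"])
      (use diff frechet_derivative_works in auto)
qed

lemma lipschitz_absolutely_continuous_curve:
  fixes u :: "real \<Rightarrow> 'a::metric_space"
  assumes M: "0 \<le> M" and lip: "\<And>s t. s \<in> {0..1} \<Longrightarrow> t \<in> {0..1} \<Longrightarrow> dist (u s) (u t) \<le> M * \<bar>s - t\<bar>"
  shows "absolutely_continuous_curve u"
  unfolding absolutely_continuous_curve_def
proof (intro allI impI)
  fix e :: real assume e: "0 < e"
  show "\<exists>\<delta>>0. \<forall>(n::nat) a b. (\<forall>i<n. 0 \<le> a i \<and> a i \<le> b i \<and> b i \<le> 1) \<and>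
     (\<forall>i<n. \<forall>j<n. i \<noteq> j \<longrightarrow> {a i<..<b i} \<inter> {a j<..<b j} = {}) \<and>
     (\<Sum>i<n. b i - a i) < \<delta> \<longrightarrow> (\<Sum>i<n. dist (u (a i)) (u (b i))) < e"
  proof (intro exI conjI allI impI)
    show "0 < e / (M + 1)" using e M by simp
    fix n :: nat and a b :: "nat \<Rightarrow> real"
    assume *: "(\<forall>i<n. 0 \<le> a i \<and> a i \<le> b i \<and> b i \<le> 1) \<and>
      (\<forall>i<n. \<forall>j<n. i \<noteq> j \<longrightarrow> {a i<..<b i} \<inter> {a j<..<b j} = {}) \<and>
      (\<Sum>i<n. b i - a i) < e / (M + 1)"
    have ab: "\<And>i. i < n \<Longrightarrow> 0 \<le> a i \<and> a i \<le> b i \<and> b i \<le> 1"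
      and small: "(\<Sum>i<n. b i - a i) < e / (M + 1)" using * by blast+
    have "dist (u (a i)) (u (b i)) \<le> M * (b i - a i)" if "i < n" for i
      using lip[of "a i" "b i"] ab that by fastforce
    then have "(\<Sum>i<n. dist (u (a i)) (u (b i))) \<le> (\<Sum>i<n. M * (b i - a i))"
      by (intro sum_mono) simp
    also have "\<dots> = M * (\<Sum>i<n. b i - a i)" by (simp add: sum_distrib_left)
    also have "\<dots> \<le> (M + 1) * (\<Sum>i<n. b i - a i)"
      using ab by (intro mult_right_mono sum_nonneg) auto
    also have "\<dots> < e" using small M by (simp add: pos_less_divide_eq mult.commute)
    finally show "(\<Sum>i<n. dist (u (a i)) (u (b i))) < e" .
  qed
qed

text \<open>\<open>flow_compatible\<close> pushes forward the restriction to \<Omega>, whereas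
  \<open>transport_flow\<close> uses the full measure. Since \<open>X\<close> is the identity off
  \<Omega>, it is Borel on the whole space, and the null set off \<Omega> does not change the
  push-forward.\<close>

lemma distr_restrict_space_full:
  fixes \<mu> :: "'a::euclidean_space measure"
  assumes sets: "sets \<mu> = sets borel" and \<Omega>: "\<Omega> \<in> sets borel" and full: "AE x in \<mu>. x \<in> \<Omega>"
    and X: "X \<in> restrict_space \<mu> \<Omega> \<rightarrow>\<^sub>M (borel :: 'a measure)" and outside: "\<And>x. x \<notin> \<Omega> \<Longrightarrow> X x = x"
  shows "X \<in> borel_measurable borel" and "distr (restrict_space \<mu> \<Omega>) borel X = distr \<mu> borel X"
proof -
  have sp: "space \<mu> = UNIV" using sets_eq_imp_space_eq[OF sets] by simp
  have "(\<lambda>x. indicator \<Omega> x *\<^sub>R X x) \<in> borel_measurable \<mu>"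
    using X \<Omega> sets by (subst borel_measurable_restrict_space_iff[symmetric]) (auto simp: sp)
  then have "(\<lambda>x. indicator \<Omega> x *\<^sub>R X x) \<in> borel_measurable borel"
    using measurable_cong_sets[OF sets refl] by blast
  moreover have "(\<lambda>x. indicator (- \<Omega>) x *\<^sub>R x) \<in> borel_measurable (borel :: 'a measure)"
    using \<Omega> by (intro borel_measurable_scaleR borel_measurable_indicator) auto
  ultimately have "(\<lambda>x. indicator \<Omega> x *\<^sub>R X x + indicator (- \<Omega>) x *\<^sub>R x) \<in> borel_measurable borel"
    by (rule borel_measurable_add)
  moreover have "(\<lambda>x. indicator \<Omega> x *\<^sub>R X x + indicator (- \<Omega>) x *\<^sub>R x) = X"
    using outside by (auto simp: fun_eq_iff indicator_def)
  ultimately show Xb: "X \<in> borel_measurable borel" by simp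
  then have X\<mu>: "X \<in> borel_measurable \<mu>" using measurable_cong_sets[OF sets refl] by blast
  show "distr (restrict_space \<mu> \<Omega>) borel X = distr \<mu> borel X"
  proof (rule measure_eqI)
    fix B :: "'a set" assume "B \<in> sets (distr (restrict_space \<mu> \<Omega>) borel X)"
    then have B: "B \<in> sets borel" by simp
    have XB: "X -` B \<inter> space \<mu> \<in> sets \<mu>" using X\<mu> B by (rule measurable_sets)
    have "emeasure (distr (restrict_space \<mu> \<Omega>) borel X) B = emeasure (restrict_space \<mu> \<Omega>) (X -` B \<inter> \<Omega>)"
      by (subst emeasure_distr[OF X B]) (simp add: space_restrict_space sp)
    also have "\<dots> = emeasure \<mu> (X -` B \<inter> \<Omega>)"
      using \<Omega> sets by (intro emeasure_restrict_space) (auto simp: sp)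
    also have "\<dots> = emeasure \<mu> (X -` B)"
      by (rule emeasure_eq_AE) (use full XB \<Omega> sets sp in \<open>auto elim!: eventually_mono\<close>)
    also have "\<dots> = emeasure (distr \<mu> borel X) B"
      by (subst emeasure_distr[OF X\<mu> B]) (simp add: sp)
    finally show "emeasure (distr (restrict_space \<mu> \<Omega>) borel X) B = emeasure (distr \<mu> borel X) B" .
  qed simp
qed

text \<open>The initial tangent vector has norm \<epsilon>, the distance of the end points. So
  \<open>f\<close> has C^1 norm at most \<open>C0 * \<epsilon>\<close>, and the bound
  \<open>C0 * \<epsilon>^2\<close> on the time derivative of the field gives \<open>v - f\<close> =
  O(\<epsilon>^2) by the mean value inequality in time.\<close>

lemma exponential_transport_flow:
  fixes \<Omega> :: "'a::euclidean_space set"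
    and A :: "('m::{t2_space,second_countable_topology}, 'e::euclidean_space) chart set"
  assumes \<Omega>: "compact \<Omega>" and pm: "parameter_manifold A G S D"
    and probs: "\<And>\<theta>. \<theta> \<in> S \<Longrightarrow> E \<theta> \<in> probs_on \<Omega>"
    and fc: "flow_compatible \<Omega> A G S E B"
    and C1: "\<And>\<theta> \<eta>. \<theta> \<in> S \<Longrightarrow> \<eta> \<in> tangent_space A \<theta> \<Longrightarrow>
      Ck_on 1 UNIV (B \<theta> \<eta>) \<and> (\<exists>\<psi>. \<forall>x. GDERIV \<psi> x :> B \<theta> \<eta> x)"
    and C0: "0 \<le> C0"
    and norm: "\<And>\<theta> \<eta>. (\<theta>, \<eta>) \<in> D \<Longrightarrow> C1_norm (B \<theta> \<eta>) \<le> ennreal (C0 * tnorm A G \<theta> \<eta>)"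
    and dt: "\<And>\<theta> \<eta> x t. (\<theta>, \<eta>) \<in> D \<Longrightarrow> t \<in> {0..1} \<Longrightarrow>
      \<exists>w. ((\<lambda>s. B (rexp A G \<theta> (tscale s \<eta>)) (velocity A (\<lambda>t. rexp A G \<theta> (tscale t \<eta>)) s) x)
          has_vector_derivative w) (at t within {0..1}) \<and> norm w \<le> C0 * (tnorm A G \<theta> \<eta>)\<^sup>2"
    and \<theta>: "\<theta> \<in> S" "\<theta>' \<in> S"
  shows "\<exists>\<gamma> v X f \<psi>. transport_flow \<Omega> S (rdist A G S) E C0 \<theta> \<theta>' \<gamma> v X f \<psi>"
proof -
  note pm' = pm[unfolded parameter_manifold_def Let_def]
  note D_spec = pm'[THEN conjunct2, THEN conjunct2, THEN conjunct2, THEN conjunct2, THEN conjunct2, THEN conjunct1]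
  note D_surj = pm'[THEN conjunct2, THEN conjunct2, THEN conjunct2, THEN conjunct2, THEN conjunct2, THEN conjunct2]
  have atlas: "smooth_atlas A" using pm' unfolding riemannian_manifold_def by blast
  obtain \<eta> where \<eta>: "(\<theta>, \<eta>) \<in> D" "rexp A G \<theta> \<eta> = \<theta>'" using D_surj \<theta> by blast
  note spec = D_spec[THEN bspec, OF \<eta>(1), unfolded prod.case]
  define \<gamma> where "\<gamma> t = rexp A G \<theta> (tscale t \<eta>)" for t
  define \<epsilon> where "\<epsilon> = rdist A G S \<theta> \<theta>'"
  have \<epsilon>: "0 \<le> \<epsilon>" by (simp add: \<epsilon>_def rdist_def)
  have tn: "tnorm A G \<theta> \<eta> = \<epsilon>" using spec \<eta>(2) unfolding \<epsilon>_def by blast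
  have \<eta>_T: "\<eta> \<in> tangent_space A \<theta>" using spec by blast
  have \<gamma>_S: "\<gamma> ` {0..1} \<subseteq> S" using spec unfolding \<gamma>_def[abs_def] by blast
  have geo: "geodesic_from A G \<theta> \<eta> \<gamma>" using spec unfolding \<gamma>_def[abs_def] by blast
  have \<gamma>_d: "rdist A G S (\<gamma> s) (\<gamma> t) = \<bar>s - t\<bar> * \<epsilon>" if "s \<in> {0..1}" "t \<in> {0..1}" for s t
    using spec that \<eta>(2) unfolding \<gamma>_def \<epsilon>_def by blast
  have \<gamma>0: "\<gamma> 0 = \<theta>" and vel0: "velocity A \<gamma> 0 = \<eta>" using geo unfolding geodesic_from_def by blast+
  have \<gamma>1: "\<gamma> 1 = \<theta>'" using \<eta>(2) by (simp add: \<gamma>_def tscale_def)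
  have diff: "curve_differentiable_at A \<gamma> t" if "t \<in> {0..1}" for t
    using geo that unfolding geodesic_from_def is_geodesic_def by blast
  define f where "f = B \<theta> \<eta>"
  have "Ck_on (Suc 0) UNIV f" using C1[OF \<theta>(1) \<eta>_T] by (simp add: f_def)
  then have f_diff: "f differentiable (at x)" for x by simp
  have f_bounds: "norm (f x) \<le> C0 * \<epsilon>" "norm (f x - f y) \<le> C0 * \<epsilon> * norm (x - y)" for x y
    using C1_norm_bounds[OF norm[OF \<eta>(1)] _ f_diff[unfolded f_def]] C0 \<epsilon> unfolding tn f_def by auto
  obtain \<psi> where \<psi>: "\<And>x. GDERIV \<psi> x :> f x" using C1[OF \<theta>(1) \<eta>_T] unfolding f_def by blast
  define V where "V t x = B (\<gamma> t) (velocity A \<gamma> t) x" for t x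
  have V0: "V 0 x = f x" for x by (simp add: V_def \<gamma>0 vel0 f_def)
  have V_cont: "continuous_on UNIV (V t)" if t: "t \<in> {0..1}" for t
  proof -
    have "\<gamma> t \<in> S" using \<gamma>_S t by blast
    then have "Ck_on (Suc 0) UNIV (B (\<gamma> t) (velocity A \<gamma> t))"
      using C1 velocity_in_tangent_space[OF atlas t diff[OF t]] by simp
    then have "V t differentiable (at x)" for x unfolding V_def[abs_def] by simp
    then show ?thesis
      using differentiable_imp_continuous_within by (intro continuous_at_imp_continuous_on) blast
  qed
  have V_lip: "norm (V s x - V t x) \<le> C0 * \<epsilon>\<^sup>2 * \<bar>s - t\<bar>" if "s \<in> {0..1}" "t \<in> {0..1}" for s t x
  proof -
    have "\<forall>t\<in>{0..1}. \<exists>w. ((\<lambda>s. V s x) has_vector_derivative w) (at t within {0..1}) \<and> norm w \<le> C0 * \<epsilon>\<^sup>2"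
      using dt[OF \<eta>(1)] unfolding V_def \<gamma>_def[abs_def] tn by blast
    then obtain w where w: "\<And>t. t \<in> {0..1} \<Longrightarrow> ((\<lambda>s. V s x) has_vector_derivative w t) (at t within {0..1})"
      "\<And>t. t \<in> {0..1} \<Longrightarrow> norm (w t) \<le> C0 * \<epsilon>\<^sup>2" by metis
    have "norm (V s x - V t x) \<le> C0 * \<epsilon>\<^sup>2 * norm (s - t)"
    proof (rule differentiable_bound[of "{0..1}" _ "\<lambda>t h. h *\<^sub>R w t"])
      show "((\<lambda>s. V s x) has_derivative (\<lambda>h. h *\<^sub>R w t)) (at t within {0..1})" if "t \<in> {0..1}" for t
        using w(1)[OF that] by (simp add: has_vector_derivative_def)
      show "onorm (\<lambda>h. h *\<^sub>R w t) \<le> C0 * \<epsilon>\<^sup>2" if "t \<in> {0..1}" for t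
        using w(2)[OF that] by (intro onorm_le) (simp add: mult.commute mult_left_mono)
    qed (use that in auto)
    then show ?thesis by simp
  qed
  \<comment> \<open>Freezing the field outside of the unit interval makes it continuous and bounded
    on the whole space-time, as \<open>peano_existence\<close> requires.\<close>
  define v where "v t = V (max 0 (min 1 t))" for t
  have v_V: "v t = V t" if "t \<in> {0..1}" for t using that by (simp add: v_def)
  have v_lip: "norm (v s x - v t x) \<le> C0 * \<epsilon>\<^sup>2 * \<bar>s - t\<bar>" for s t x
  proof -
    have "norm (v s x - v t x) \<le> C0 * \<epsilon>\<^sup>2 * \<bar>max 0 (min 1 s) - max 0 (min 1 t)\<bar>"
      unfolding v_def by (rule V_lip) auto
    also have "\<dots> \<le> C0 * \<epsilon>\<^sup>2 * \<bar>s - t\<bar>" using C0 by (intro mult_left_mono) auto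
    finally show ?thesis .
  qed
  have v_cont: "continuous_on UNIV (\<lambda>(t, x). v t x)"
    by (rule continuous_on_pair_lipschitz[OF v_lip]) (auto simp: v_def intro!: V_cont)
  have V_f: "norm (V t x - f x) \<le> C0 * \<epsilon>\<^sup>2" if t: "t \<in> {0..1}" for t x
  proof -
    have "norm (V t x - f x) \<le> C0 * \<epsilon>\<^sup>2 * \<bar>t - 0\<bar>" using V_lip[OF t, of 0 x] by (simp add: V0)
    also have "\<dots> \<le> C0 * \<epsilon>\<^sup>2 * 1" using C0 t by (intro mult_left_mono) auto
    finally show ?thesis by simp
  qed
  define M where "M = C0 * \<epsilon> + C0 * \<epsilon>\<^sup>2"
  have M: "0 \<le> M" using C0 \<epsilon> by (simp add: M_def)
  have v_bnd: "norm (v t x) \<le> M" for t x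
    using V_f[of "max 0 (min 1 t)" x] f_bounds(1)[of x] norm_triangle_sub[of "v t x" "f x"]
    unfolding v_def M_def by auto
  have "\<forall>x. \<exists>u. u 0 = x \<and> (\<forall>t\<in>{0..1}. (u has_vector_derivative v t (u t)) (at t within {0..1}))"
    using peano_existence[OF v_cont v_bnd] by blast
  then obtain u where u0: "\<And>x. u x 0 = x"
    and du: "\<And>x t. t \<in> {0..1} \<Longrightarrow> (u x has_vector_derivative v t (u x t)) (at t within {0..1})" by metis
  define X where "X t x = (if x \<in> \<Omega> then u x t else x)" for t x
  have dX: "((\<lambda>s. X s x) has_vector_derivative v t (X t x)) (at t within {0..1})" if "x \<in> \<Omega>" "t \<in> {0..1}" for x t
    using du[OF that(2)] that(1) by (simp add: X_def)
  have X0: "X 0 x = x" for x by (simp add: X_def u0)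
  have X_cont: "continuous_on {0..1} (\<lambda>t. X t x)" for x
  proof (cases "x \<in> \<Omega>")
    case True
    then show ?thesis using dX has_vector_derivative_continuous continuous_on_eq_continuous_within by blast
  qed (simp add: X_def)
  have "is_flow \<Omega> A B \<gamma> X"
    unfolding is_flow_def
  proof (intro conjI ballI AE_I2 impI)
    fix x assume x: "x \<in> \<Omega>"
    show "X 0 x = x" by (rule X0)
    show "absolutely_continuous_curve (\<lambda>t. X t x)"
    proof (rule lipschitz_absolutely_continuous_curve[OF M])
      fix s t :: real assume st: "s \<in> {0..1}" "t \<in> {0..1}"
      have "norm (X s x - X t x) \<le> M * norm (s - t)"
      proof (rule differentiable_bound[of "{0..1}" _ "\<lambda>t h. h *\<^sub>R v t (X t x)"])
        show "((\<lambda>s. X s x) has_derivative (\<lambda>h. h *\<^sub>R v t (X t x))) (at t within {0..1})" if "t \<in> {0..1}" for t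
          using dX[OF x that] by (simp add: has_vector_derivative_def)
        show "onorm (\<lambda>h. h *\<^sub>R v t (X t x)) \<le> M" for t
          using v_bnd[of t "X t x"] by (intro onorm_le) (simp add: mult.commute[of M] mult_left_mono)
      qed (use st in auto)
      then show "dist (X s x) (X t x) \<le> M * \<bar>s - t\<bar>" by (simp add: dist_norm)
    qed
  next
    fix t :: real assume t: "t \<in> {0..1}"
    show "curve_differentiable_at A \<gamma> t" by (rule diff[OF t])
    fix x assume x: "x \<in> \<Omega>"
    show "((\<lambda>s. X s x) has_vector_derivative B (\<gamma> t) (velocity A \<gamma> t) (X t x)) (at t within {0..1})"
      using dX[OF x t] by (simp add: v_V[OF t] V_def)
  qed
  moreover have "\<exists>L. \<forall>s\<in>{0..1}. \<forall>t\<in>{0..1}. rdist A G S (\<gamma> s) (\<gamma> t) \<le> L * \<bar>s - t\<bar>"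
    using \<gamma>_d by (intro exI[of _ \<epsilon>]) (simp add: mult.commute)
  \<comment> \<open>The trajectories were chosen point by point, possibly among several, so their
    construction says nothing about measurability in space. \<open>flow_compatible\<close> speaks of
    every flow of the curve, hence of this choice, and supplies both measurability and the
    push-forward.\<close>
  ultimately have push: "X t \<in> restrict_space (E \<theta>) \<Omega> \<rightarrow>\<^sub>M borel"
    "E (\<gamma> t) = distr (restrict_space (E \<theta>) \<Omega>) borel (X t)" if "t \<in> {0..1}" for t
    using fc \<gamma>_S that unfolding flow_compatible_def \<gamma>0[symmetric] by blast+
  have sets: "sets (E \<theta>) = sets borel" and prob: "prob_space (E \<theta>)" and full: "emeasure (E \<theta>) \<Omega> = 1"
    using probs[OF \<theta>(1)] unfolding probs_on_def by blast+
  have \<Omega>_sets: "\<Omega> \<in> sets borel" using \<Omega> by (rule borel_compact)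
  have AE: "AE x in E \<theta>. x \<in> \<Omega>"
  proof -
    interpret prob_space "E \<theta>" by (rule prob)
    show ?thesis using full \<Omega>_sets sets by (intro AE_in_set_eq_1[THEN iffD2]) (auto simp: measure_def)
  qed
  have X_meas: "X t \<in> borel_measurable borel" and E_X: "E (\<gamma> t) = distr (E \<theta>) borel (X t)" if t: "t \<in> {0..1}" for t
  proof -
    have outside: "X t x = x" if "x \<notin> \<Omega>" for x using that by (simp add: X_def)
    note full = distr_restrict_space_full[OF sets \<Omega>_sets AE push(1)[OF t] outside]
    show "X t \<in> borel_measurable borel" by (rule full(1))
    show "E (\<gamma> t) = distr (E \<theta>) borel (X t)" using push(2)[OF t] full(2) by (rule trans)
  qed
  have "transport_flow \<Omega> S (rdist A G S) E C0 \<theta> \<theta>' \<gamma> v X f \<psi>"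
    unfolding transport_flow_def \<epsilon>_def[symmetric]
    by (intro conjI ballI allI; fact?)
      (use \<gamma>0 \<gamma>1 \<gamma>_S \<gamma>_d v_cont f_bounds \<psi> X0 X_cont dX X_meas E_X V_f v_V in simp_all)
  then show ?thesis by blast
qed

theorem proposition2p13:
  fixes \<Omega> :: "(real ^ 'd) set"
    and A :: "('m::{t2_space,second_countable_topology}, 'e::euclidean_space) chart set"
    and G :: "('m, 'e) metric_tensor"
    and S :: "'m set"
    and D :: "('m \<times> ('m, 'e) tangent) set"
    and E :: "'m \<Rightarrow> (real ^ 'd) measure"
    and B :: "'m \<Rightarrow> ('m, 'e) tangent \<Rightarrow> real ^ 'd \<Rightarrow> real ^ 'd"
  assumes "compact \<Omega>" and "convex \<Omega>"
    and "parameter_manifold A G S D"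
    and "bilipschitz_parametrization \<Omega> A G S E"
    and "velocity_field_map A G S D E B"
    and "flow_compatible \<Omega> A G S E B"
  shows "\<exists>C::real. 0 < C \<and> (\<forall>\<mu>\<in>E ` S. \<forall>\<nu>\<in>E ` S. \<mu> \<noteq> \<nu> \<longrightarrow>
    0 \<le> (W2_restr \<Omega> (E ` S) \<mu> \<nu> - ereal (W2 \<mu> \<nu>)) / ereal ((W2 \<mu> \<nu>)\<^sup>2) \<and>
    (W2_restr \<Omega> (E ` S) \<mu> \<nu> - ereal (W2 \<mu> \<nu>)) / ereal ((W2 \<mu> \<nu>)\<^sup>2) \<le> ereal C)"
proof -
  obtain L where L: "0 < L" and lower: "\<And>\<theta> \<theta>'. \<theta> \<in> S \<Longrightarrow> \<theta>' \<in> S \<Longrightarrow> rdist A G S \<theta> \<theta>' / L \<le> W2 (E \<theta>) (E \<theta>')"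
    and upper: "\<And>\<theta> \<theta>'. \<theta> \<in> S \<Longrightarrow> \<theta>' \<in> S \<Longrightarrow> W2 (E \<theta>) (E \<theta>') \<le> L * rdist A G S \<theta> \<theta>'"
    using assms(4) unfolding bilipschitz_parametrization_def by blast
  have probs: "E \<theta> \<in> probs_on \<Omega>" if "\<theta> \<in> S" for \<theta>
    using assms(4) that unfolding bilipschitz_parametrization_def by blast
  note vf = assms(5)[unfolded velocity_field_map_def Let_def]
  obtain C0 where C0: "0 < C0" and bounds: "\<And>z. z \<in> D \<Longrightarrow> case z of (\<theta>, \<eta>) \<Rightarrow>
        tnorm A G \<theta> \<eta> / C0 \<le> L2_norm (E \<theta>) (B \<theta> \<eta>) \<and>
        L2_norm (E \<theta>) (B \<theta> \<eta>) \<le> C0 * tnorm A G \<theta> \<eta> \<and>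
        C1_norm (B \<theta> \<eta>) \<le> ennreal (C0 * tnorm A G \<theta> \<eta>) \<and>
           (\<forall>x. \<forall>t\<in>{0..1}. \<exists>w. ((\<lambda>s. B (rexp A G \<theta> (tscale s \<eta>)) (velocity A (\<lambda>t. rexp A G \<theta> (tscale t \<eta>)) s) x) has_vector_derivative w)
             (at t within {0..1}) \<and> norm w \<le> C0 * (tnorm A G \<theta> \<eta>)\<^sup>2)"
    using vf[THEN conjunct2, THEN conjunct2] by blast
  have C1: "Ck_on 1 UNIV (B \<theta> \<eta>) \<and> (\<exists>\<psi>. \<forall>x. GDERIV \<psi> x :> B \<theta> \<eta> x)" if "\<theta> \<in> S" "\<eta> \<in> tangent_space A \<theta>" for \<theta> \<eta>
    using vf that by blast
  interpret transport_family \<Omega> S "rdist A G S" E C0 L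
  proof
    show "compact \<Omega>" by (rule assms(1))
    show "E \<theta> \<in> probs_on \<Omega>" if "\<theta> \<in> S" for \<theta> by (rule probs[OF that])
    show "0 \<le> C0" "0 \<le> L" using C0 L by auto
    show "0 \<le> rdist A G S \<theta> \<theta>'" for \<theta> \<theta>' by (simp add: rdist_def)
    show "rdist A G S \<theta> \<theta>' \<le> L * W2 (E \<theta>) (E \<theta>')" if "\<theta> \<in> S" "\<theta>' \<in> S" for \<theta> \<theta>'
      using lower[OF that] L by (simp add: pos_divide_le_eq mult.commute)
    show "W2 (E \<theta>) (E \<theta>') \<le> L * rdist A G S \<theta> \<theta>'" if "\<theta> \<in> S" "\<theta>' \<in> S" for \<theta> \<theta>' by (rule upper[OF that])
    show "\<exists>\<gamma> v X f \<psi>. transport_flow \<Omega> S (rdist A G S) E C0 \<theta> \<theta>' \<gamma> v X f \<psi>" if "\<theta> \<in> S" "\<theta>' \<in> S" for \<theta> \<theta>'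
    proof (rule exponential_transport_flow[OF assms(1,3) probs assms(6) C1 _ _ _ that])
      show "0 \<le> C0" using C0 by simp
      show "C1_norm (B \<theta> \<eta>) \<le> ennreal (C0 * tnorm A G \<theta> \<eta>)" if "(\<theta>, \<eta>) \<in> D" for \<theta> \<eta>
        using bounds[OF that] by simp
      show "\<exists>w. ((\<lambda>s. B (rexp A G \<theta> (tscale s \<eta>)) (velocity A (\<lambda>t. rexp A G \<theta> (tscale t \<eta>)) s) x)
          has_vector_derivative w) (at t within {0..1}) \<and> norm w \<le> C0 * (tnorm A G \<theta> \<eta>)\<^sup>2"
        if "(\<theta>, \<eta>) \<in> D" "t \<in> {0..1}" for \<theta> \<eta> x t
        using bounds[OF that(1)] that(2) by auto
    qed
  qed
  show ?thesis by (rule W2_restr_deviation)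
qed

end
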